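(* There exists an absolute constant $c_3>0$ such that, for every $n\geq 2$ and every convex body $K$ in $\mathbb{R}^n$, $$\int_{S^{n-1}}S(P_{\xi^{\perp}}(K))\,d\sigma(\xi)\geq c_3\,S(K)^{\frac{n-2}{n-1}}.$$
   Context: A convex body in $\mathbb{R}^n$ is a compact convex set with non-empty interior. $\sigma$ is the rotationally invariant probability measure on the Euclidean unit sphere $S^{n-1}$, and $P_{\xi^{\perp}}$ is the orthogonal projection onto the hyperplane $\xi^{\perp}$. $S(A)$ is the surface area of a convex body $A$; $P_{\xi^\perp}(K)$ is regarded as a convex body in the $(n-1)$-dimensional Euclidean space $\xi^\perp$, and its surface area is taken there. In dimension $m$ one has $S(A)=mV((A,m-1),(B_2^m,1))$ (a mixed volume, $B_2^m$ the Euclidean unit ball); in particular the surface area of a segment in a one-dimensional space is $2$. "Absolute constant" means a constant independent of $n$ and of $K$. *)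

theory Defs
  imports "HOL-Analysis.Analysis"
begin

text \<open>
  The dimension varies inside the statement, so \<open>R^n\<close> is the library's
  \<^const>\<open>Euclidean_space\<close> \<open>n\<close>: the sequences \<open>x :: nat \<Rightarrow> real\<close> with \<open>x i = 0\<close> for all
  \<open>i \<ge> n\<close>, with the product topology. The function type is not a \<open>real_vector\<close>, so
  the vector operations are written out coordinatewise.
\<close>

abbreviation Rn :: "nat \<Rightarrow> (nat \<Rightarrow> real) set" where
  "Rn n \<equiv> topspace (Euclidean_space n)"

definition inner_n :: "nat \<Rightarrow> (nat \<Rightarrow> real) \<Rightarrow> (nat \<Rightarrow> real) \<Rightarrow> real" where
  "inner_n n x y = (\<Sum>i<n. x i * y i)"

definition norm_n :: "nat \<Rightarrow> (nat \<Rightarrow> real) \<Rightarrow> real" where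
  "norm_n n x = sqrt (inner_n n x x)"

definition unit_ball :: "nat \<Rightarrow> (nat \<Rightarrow> real) set" where
  "unit_ball n = {x \<in> Rn n. norm_n n x \<le> 1}"

definition unit_sphere :: "nat \<Rightarrow> (nat \<Rightarrow> real) set" where
  "unit_sphere n = {x \<in> Rn n. norm_n n x = 1}"

definition convex_n :: "(nat \<Rightarrow> real) set \<Rightarrow> bool" where
  "convex_n A \<longleftrightarrow>
     (\<forall>x\<in>A. \<forall>y\<in>A. \<forall>t. 0 \<le> t \<and> t \<le> 1 \<longrightarrow> (\<lambda>i. (1 - t) * x i + t * y i) \<in> A)"

definition convex_body :: "nat \<Rightarrow> (nat \<Rightarrow> real) set \<Rightarrow> bool" where
  "convex_body n K \<longleftrightarrow>
     compactin (Euclidean_space n) K \<and> convex_n K \<and> Euclidean_space n interior_of K \<noteq> {}"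

text \<open>
  Functions in the space of \<^const>\<open>PiM\<close> are \<open>undefined\<close> outside the index set; they are
  extended by 0 instead to obtain Lebesgue measure on \<open>Rn n\<close>.
\<close>

definition lborel_n :: "nat \<Rightarrow> (nat \<Rightarrow> real) measure" where
  "lborel_n n =
     distr (\<Pi>\<^sub>M i\<in>{..<n}. (lborel :: real measure)) borel (\<lambda>x i. if i < n then x i else 0)"

definition parallel_body :: "nat \<Rightarrow> (nat \<Rightarrow> real) set \<Rightarrow> real \<Rightarrow> (nat \<Rightarrow> real) set" where
  "parallel_body n A \<epsilon> = {(\<lambda>i. a i + \<epsilon> * b i) | a b. a \<in> A \<and> b \<in> unit_ball n}"

text \<open>
  Minkowski's surface area: the right derivative at 0 of the volume of the parallel body
  \<open>A + \<epsilon> B\<close>, i.e. \<open>n\<close> times the mixed volume \<open>V((A, n - 1), (B, 1))\<close>. In dimension 1 it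
  equals 2 for every segment.
\<close>

definition surface_area :: "nat \<Rightarrow> (nat \<Rightarrow> real) set \<Rightarrow> real" where
  "surface_area n A =
     Lim (at_right 0)
       (\<lambda>\<epsilon>. (measure (lborel_n n) (parallel_body n A \<epsilon>) - measure (lborel_n n) A) / \<epsilon>)"

text \<open>
  \<open>T\<close> is a linear isometry of \<open>Rn m\<close> onto the subspace \<open>V\<close> of \<open>Rn n\<close>; its values outside
  \<open>Rn m\<close> are irrelevant.
\<close>

definition linear_isometry_onto ::
  "nat \<Rightarrow> nat \<Rightarrow> (nat \<Rightarrow> real) set \<Rightarrow> ((nat \<Rightarrow> real) \<Rightarrow> (nat \<Rightarrow> real)) \<Rightarrow> bool" where
  "linear_isometry_onto m n V T \<longleftrightarrow>
     V \<subseteq> Rn n \<and> T ` Rn m = V \<and>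
     (\<forall>x\<in>Rn m. \<forall>y\<in>Rn m. \<forall>a b. T (\<lambda>i. a * x i + b * y i) = (\<lambda>i. a * T x i + b * T y i)) \<and>
     (\<forall>x\<in>Rn m. norm_n n (T x) = norm_n m x)"

abbreviation orthogonal_map :: "nat \<Rightarrow> ((nat \<Rightarrow> real) \<Rightarrow> (nat \<Rightarrow> real)) \<Rightarrow> bool" where
  "orthogonal_map n T \<equiv> linear_isometry_onto n n (Rn n) T"

text \<open>
  Surface area of a subset of an \<open>m\<close>-dimensional subspace \<open>V\<close> of \<open>Rn n\<close>, regarded as a
  Euclidean space: \<open>V\<close> is identified with \<open>Rn m\<close> by a linear isometry. The choice of the
  isometry is immaterial, since volume and unit ball of \<open>Rn m\<close> are invariant under orthogonal
  maps.
\<close>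

definition surface_area_in ::
  "nat \<Rightarrow> nat \<Rightarrow> (nat \<Rightarrow> real) set \<Rightarrow> (nat \<Rightarrow> real) set \<Rightarrow> real" where
  "surface_area_in m n V A =
     (let T = (SOME T. linear_isometry_onto m n V T) in surface_area m {y \<in> Rn m. T y \<in> A})"

definition hyperplane :: "nat \<Rightarrow> (nat \<Rightarrow> real) \<Rightarrow> (nat \<Rightarrow> real) set" where
  "hyperplane n \<xi> = {x \<in> Rn n. inner_n n x \<xi> = 0}"

text \<open>Orthogonal projection onto \<open>hyperplane n \<xi>\<close>, for a unit vector \<open>\<xi>\<close>.\<close>

definition hyperplane_proj :: "nat \<Rightarrow> (nat \<Rightarrow> real) \<Rightarrow> (nat \<Rightarrow> real) \<Rightarrow> (nat \<Rightarrow> real)" where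
  "hyperplane_proj n \<xi> x = (\<lambda>i. x i - inner_n n x \<xi> * \<xi> i)"

lemma hyperplane_proj_in_hyperplane:
  assumes "\<xi> \<in> unit_sphere n" "x \<in> Rn n"
  shows "hyperplane_proj n \<xi> x \<in> hyperplane n \<xi>"
proof -
  have "inner_n n \<xi> \<xi> = 1"
    using assms(1) by (simp add: unit_sphere_def norm_n_def)
  moreover have "inner_n n (hyperplane_proj n \<xi> x) \<xi> = inner_n n x \<xi> - inner_n n x \<xi> * inner_n n \<xi> \<xi>"
    unfolding inner_n_def hyperplane_proj_def
    by (simp add: left_diff_distrib sum_subtractf sum_distrib_left mult.assoc)
  ultimately show ?thesis
    using assms
    by (auto simp: hyperplane_def hyperplane_proj_def unit_sphere_def topspace_Euclidean_space)
qed

lemma hyperplane_proj_orthogonal: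
  assumes "y \<in> hyperplane n \<xi>"
  shows "inner_n n (\<lambda>i. x i - hyperplane_proj n \<xi> x i) y = 0"
proof -
  have "inner_n n (\<lambda>i. x i - hyperplane_proj n \<xi> x i) y = inner_n n x \<xi> * inner_n n y \<xi>"
    unfolding inner_n_def hyperplane_proj_def by (simp add: sum_distrib_left mult_ac)
  then show ?thesis
    using assms by (simp add: hyperplane_def)
qed

text \<open>
  \<open>\<sigma>\<close> is the Borel probability measure on the unit sphere that is invariant under all
  orthogonal maps; these conditions determine it uniquely.
\<close>

definition rotation_invariant_prob :: "nat \<Rightarrow> (nat \<Rightarrow> real) measure \<Rightarrow> bool" where
  "rotation_invariant_prob n \<sigma> \<longleftrightarrow>
     space \<sigma> = unit_sphere n \<and> sets \<sigma> = sets (restrict_space borel (unit_sphere n)) \<and>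
     emeasure \<sigma> (unit_sphere n) = 1 \<and>
     (\<forall>T. orthogonal_map n T \<longrightarrow> distr \<sigma> \<sigma> T = \<sigma>)"

end

theory Submission
  imports Defs "HOL-Library.Function_Algebras"
begin

text \<open>
  The gain \<open>w K v = |K + [-v, v]| - |K|\<close> (\<open>seg_gain\<close>) is, by Fubini, \<open>2 |v|\<close> times the volume of the projection of
  \<open>K\<close> to the hyperplane orthogonal to \<open>v\<close>; it is homogeneous in \<open>v\<close> and monotone in \<open>K\<close>. The identity
  \<open>\<integral>sgn \<langle>\<xi>, u\<rangle> \<xi> d\<sigma> = \<alpha> u\<close> with \<open>\<alpha> = \<integral>|\<langle>\<xi>, u\<rangle>| d\<sigma>\<close> for unit vectors \<open>u\<close> approximates the unit ball by
  sums of segments. Hence the limit defining the surface area exists, also for the projections of \<open>K\<close>,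
  and \<open>\<alpha> S(K) \<le> \<integral>w K d\<sigma>\<close>. Fourth moments give \<open>\<alpha> \<ge> c / sqrt n\<close>.

  In \<open>m = n - 1\<close> dimensions, comparing the ball with the inscribed cube and applying an inequality of
  Loomis-Whitney type yields \<open>S(A) \<ge> 2 sqrt m |A| powr ((m - 1) / m)\<close>. As the projection \<open>A\<close> of \<open>K\<close>
  along \<open>\<xi>\<close> satisfies \<open>|A| = w K \<xi> / 2 \<le> S(K)\<close>, this power is at least \<open>|A| S(K) powr (- 1 / m)\<close>,
  which is linear in \<open>|A|\<close> and can be integrated over \<open>\<xi>\<close>.
\<close>

section \<open>Linear algebra and compact convex sets for finitely supported sequences\<close>

section \<open>Vector operations on sequences\<close>

text \<open>Surface area enters as a \<open>Lim\<close>, which says nothing until convergence is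
  proved, and the Bochner integral of a function that is not integrable is 0. So existence of the
  limit and measurability in \<xi> are genuine obligations. The gain settles both: the projection of
  the ball is the ball, so parallel bodies of a projection are projections of parallel bodies, and
  the surface area of the projection along \<xi> is the limit of (w (K + \<epsilon> B) \<xi> - w K
  \<xi>) / (2 \<epsilon>), from which the arbitrarily chosen isometry onto the hyperplane has
  disappeared. The powers of n have to cancel: passing from S(K) to the mean of w costs the factor
  \<alpha>, of order 1 / sqrt n, and the factor 2 sqrt m repays it. This is the right order, since
  for the ball the isoperimetric ratio is also of order sqrt m. The bound of w K \<xi> by S(K) holds
  pointwise, because [-\<xi>, \<xi>] is by itself a zonotope inside the ball.\<close>

instantiation "fun" :: (type, real_vector) real_vector
begin

definition "r *\<^sub>R f = (\<lambda>x. r *\<^sub>R f x)"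

instance
  by standard (simp_all add: scaleR_fun_def fun_eq_iff scaleR_add_right scaleR_add_left)

end

lemma scaleR_fun_apply [simp]: "(r *\<^sub>R f) x = r *\<^sub>R f x"
  by (simp add: scaleR_fun_def)

lemma sum_fun_apply [simp]: "sum f A x = (\<Sum>a\<in>A. f a x)"
  by (induction A rule: infinite_finite_induct) auto

lemma convex_n_iff_convex: "convex_n A \<longleftrightarrow> convex A"
proof -
  have "(\<lambda>i. (1 - t) * x i + t * y i) = (1 - t) *\<^sub>R x + t *\<^sub>R y" for t and x y :: "nat \<Rightarrow> real"
    by (simp add: fun_eq_iff)
  then show ?thesis
    by (auto simp: convex_n_def convex_alt)
qed

lemma mem_Rn: "x \<in> Rn n \<longleftrightarrow> (\<forall>i\<ge>n. x i = 0)"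
  by (simp add: topspace_Euclidean_space)

lemma subspace_Rn: "subspace (Rn n)"
  by (auto simp: subspace_def mem_Rn)

lemma Rn_add: "x \<in> Rn n \<Longrightarrow> y \<in> Rn n \<Longrightarrow> x + y \<in> Rn n"
  and Rn_diff: "x \<in> Rn n \<Longrightarrow> y \<in> Rn n \<Longrightarrow> x - y \<in> Rn n"
  and Rn_scaleR: "x \<in> Rn n \<Longrightarrow> c *\<^sub>R x \<in> Rn n"
  and Rn_0: "0 \<in> Rn n"
  by (auto simp: mem_Rn)

lemma Rn_sum: "(\<And>a. a \<in> A \<Longrightarrow> f a \<in> Rn n) \<Longrightarrow> sum f A \<in> Rn n"
  by (simp add: subspace_Rn subspace_sum)

lemma closed_Rn: "closed (Rn n)"
  using closedin_Euclidean_imp_closed closedin_topspace by blast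

section \<open>Inner product and norm\<close>

lemma inner_n_commute: "inner_n n x y = inner_n n y x"
  by (simp add: inner_n_def mult.commute)

lemma inner_n_add_left: "inner_n n (x + y) z = inner_n n x z + inner_n n y z"
  and inner_n_diff_left: "inner_n n (x - y) z = inner_n n x z - inner_n n y z"
  and inner_n_scaleR_left: "inner_n n (c *\<^sub>R x) z = c * inner_n n x z"
  by (simp_all add: inner_n_def algebra_simps sum.distrib sum_distrib_left sum_subtractf)

lemma inner_n_add_right: "inner_n n z (x + y) = inner_n n z x + inner_n n z y"
  and inner_n_diff_right: "inner_n n z (x - y) = inner_n n z x - inner_n n z y"
  and inner_n_scaleR_right: "inner_n n z (c *\<^sub>R x) = c * inner_n n z x"
  by (simp_all add: inner_n_commute[of n z] inner_n_add_left inner_n_diff_left inner_n_scaleR_left)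

lemma inner_n_zero [simp]: "inner_n n 0 z = 0" "inner_n n z 0 = 0"
  by (simp_all add: inner_n_def)

lemma inner_n_sum_left: "inner_n n (sum f A) z = (\<Sum>a\<in>A. inner_n n (f a) z)"
  by (simp add: inner_n_def sum_distrib_right) (rule sum.swap)

lemmas inner_n_simps =
  inner_n_add_left inner_n_diff_left inner_n_scaleR_left
  inner_n_add_right inner_n_diff_right inner_n_scaleR_right

lemma norm_n_L2_set: "norm_n n x = L2_set x {..<n}"
  by (simp add: norm_n_def inner_n_def L2_set_def power2_eq_square)

lemma norm_n_nonneg [simp]: "0 \<le> norm_n n x"
  by (simp add: norm_n_L2_set)

lemma inner_n_self: "inner_n n x x = (norm_n n x)\<^sup>2"
  by (simp add: norm_n_def inner_n_def sum_nonneg)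

lemma norm_n_triangle: "norm_n n (x + y) \<le> norm_n n x + norm_n n y"
  using L2_set_triangle_ineq[of x y] by (simp add: norm_n_L2_set plus_fun_def)

lemma norm_n_scaleR: "norm_n n (c *\<^sub>R x) = \<bar>c\<bar> * norm_n n x"
  by (simp add: norm_n_def inner_n_simps real_sqrt_mult)

lemma norm_n_zero [simp]: "norm_n n 0 = 0"
  by (simp add: norm_n_def)

lemma norm_n_minus_commute: "norm_n n (x - y) = norm_n n (y - x)"
  using norm_n_scaleR[of n "-1" "x - y"] by (simp add: scaleR_fun_def fun_diff_def)

lemma norm_n_cauchy_schwarz: "\<bar>inner_n n x y\<bar> \<le> norm_n n x * norm_n n y"
proof -
  have "\<bar>inner_n n x y\<bar> \<le> (\<Sum>i<n. \<bar>x i\<bar> * \<bar>y i\<bar>)"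
    unfolding inner_n_def by (rule order_trans[OF sum_abs]) (simp add: abs_mult)
  also have "\<dots> \<le> norm_n n x * norm_n n y"
    unfolding norm_n_L2_set by (rule L2_set_mult_ineq)
  finally show ?thesis .
qed

lemma norm_n_eq_0: "x \<in> Rn n \<Longrightarrow> norm_n n x = 0 \<longleftrightarrow> x = 0"
  unfolding norm_n_L2_set L2_set_eq_0_iff[OF finite_lessThan] mem_Rn fun_eq_iff
  by (metis lessThan_iff not_le zero_fun_apply)

lemma abs_le_norm_n: "i < n \<Longrightarrow> \<bar>x i\<bar> \<le> norm_n n x"
  using member_le_L2_set[of "{..<n}" i "\<lambda>i. \<bar>x i\<bar>"] by (simp add: norm_n_L2_set L2_set_def)

lemma norm_n_le_sum_abs: "norm_n n x \<le> (\<Sum>i<n. \<bar>x i\<bar>)"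
  unfolding norm_n_L2_set by (rule L2_set_le_sum_abs)

definition axis_n :: "nat \<Rightarrow> nat \<Rightarrow> real" where
  "axis_n i = (\<lambda>j. if j = i then 1 else 0)"

lemma axis_n_Rn [simp]: "i < n \<Longrightarrow> axis_n i \<in> Rn n"
  by (simp add: axis_n_def mem_Rn)

lemma inner_n_axis_n: "i < n \<Longrightarrow> inner_n n x (axis_n i) = x i"
  by (simp add: inner_n_def axis_n_def if_distrib cong: if_cong)

lemma norm_n_axis_n [simp]: "i < n \<Longrightarrow> norm_n n (axis_n i) = 1"
  by (simp add: norm_n_def inner_n_axis_n) (simp add: axis_n_def)

lemma Rn_eq_sum_axis_n: "x \<in> Rn n \<Longrightarrow> x = (\<Sum>i<n. x i *\<^sub>R axis_n i)"
  by (auto simp: fun_eq_iff axis_n_def mem_Rn if_distrib cong: if_cong)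

section \<open>Compact convex sets\<close>

lemma continuous_on_fun_add:
  fixes f g :: "'a::topological_space \<Rightarrow> nat \<Rightarrow> real"
  assumes "continuous_on S f" "continuous_on S g"
  shows "continuous_on S (\<lambda>x. f x + g x)"
  using assms by (intro continuous_on_coordinatewise_then_product)
    (simp add: continuous_on_add continuous_on_product_then_coordinatewise)

lemma continuous_on_fun_scaleR:
  fixes g :: "'a::topological_space \<Rightarrow> nat \<Rightarrow> real"
  assumes "continuous_on S f" "continuous_on S g"
  shows "continuous_on S (\<lambda>x. f x *\<^sub>R g x)"
  using assms by (intro continuous_on_coordinatewise_then_product)
    (simp add: continuous_on_mult continuous_on_product_then_coordinatewise)

lemma continuous_on_inner_n:
  fixes f g :: "'a::topological_space \<Rightarrow> nat \<Rightarrow> real"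
  assumes "continuous_on S f" "continuous_on S g"
  shows "continuous_on S (\<lambda>x. inner_n n (f x) (g x))"
  unfolding inner_n_def
  by (intro continuous_on_sum continuous_on_mult assms[THEN continuous_on_product_then_coordinatewise])

lemma continuous_on_norm_n:
  fixes f :: "'a::topological_space \<Rightarrow> nat \<Rightarrow> real"
  assumes "continuous_on S f"
  shows "continuous_on S (\<lambda>x. norm_n n (f x))"
  unfolding norm_n_def by (intro continuous_on_real_sqrt continuous_on_inner_n assms)

lemma compact_fun_plus:
  fixes A B :: "(nat \<Rightarrow> real) set"
  assumes "compact A" "compact B"
  shows "compact (A + B)"
proof -
  have "compact ((\<lambda>p. fst p + snd p) ` (A \<times> B))"
    by (intro compact_continuous_image compact_Times assms continuous_on_fun_add
        continuous_on_fst continuous_on_snd continuous_on_id)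
  moreover have "A + B = (\<lambda>p. fst p + snd p) ` (A \<times> B)"
    unfolding set_plus_def by force
  ultimately show ?thesis
    by (simp only:)
qed

lemma compact_fun_scaleR:
  fixes A :: "(nat \<Rightarrow> real) set"
  shows "compact A \<Longrightarrow> compact ((*\<^sub>R) c ` A)"
  by (intro compact_continuous_image continuous_on_fun_scaleR continuous_on_const continuous_on_id)

lemma set_plus_scaleR_image: "(*\<^sub>R) c ` (A + B) = (*\<^sub>R) c ` A + (*\<^sub>R) c ` (B :: 'a::real_vector set)"
  by (force simp: set_plus_def scaleR_add_right image_iff)

lemma convex_scaleR_add:
  fixes A :: "'a::real_vector set"
  assumes "convex A" "0 \<le> a" "0 \<le> b"
  shows "(*\<^sub>R) a ` A + (*\<^sub>R) b ` A = (*\<^sub>R) (a + b) ` A"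
proof (cases "a + b = 0")
  case True
  then have "a = 0" "b = 0" using assms by auto
  then show ?thesis by (auto simp: set_plus_def image_iff)
next
  case False
  show ?thesis
  proof (intro subset_antisym subsetI)
    fix z assume "z \<in> (*\<^sub>R) a ` A + (*\<^sub>R) b ` A"
    then obtain x y where xy: "x \<in> A" "y \<in> A" "z = a *\<^sub>R x + b *\<^sub>R y"
      by (auto simp: set_plus_def)
    have "(a / (a + b)) *\<^sub>R x + (b / (a + b)) *\<^sub>R y \<in> A"
      using xy assms False by (intro convexD) (auto simp: add_divide_distrib[symmetric])
    moreover have "z = (a + b) *\<^sub>R ((a / (a + b)) *\<^sub>R x + (b / (a + b)) *\<^sub>R y)"
      using xy False by (simp add: scaleR_add_right)
    ultimately show "z \<in> (*\<^sub>R) (a + b) ` A" by blast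
  next
    fix z assume "z \<in> (*\<^sub>R) (a + b) ` A"
    then show "z \<in> (*\<^sub>R) a ` A + (*\<^sub>R) b ` A"
      by (auto simp: set_plus_def scaleR_add_left)
  qed
qed

definition compact_convex :: "nat \<Rightarrow> (nat \<Rightarrow> real) set \<Rightarrow> bool" where
  "compact_convex n A \<longleftrightarrow> compact A \<and> convex A \<and> A \<subseteq> Rn n"

lemma compact_convexD:
  assumes "compact_convex n A"
  shows "compact A" "convex A" "A \<subseteq> Rn n"
  using assms by (auto simp: compact_convex_def)

lemma compact_convex_plus:
  "compact_convex n A \<Longrightarrow> compact_convex n B \<Longrightarrow> compact_convex n (A + B)"
  unfolding compact_convex_def
  by (auto intro!: compact_fun_plus convex_set_plus) (auto simp: set_plus_def intro!: Rn_add)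

lemma compact_convex_scaleR:
  "compact_convex n A \<Longrightarrow> compact_convex n ((*\<^sub>R) c ` A)"
  unfolding compact_convex_def
  by (auto intro!: compact_fun_scaleR convex_scaling Rn_scaleR)

lemma compact_convex_singleton: "x \<in> Rn n \<Longrightarrow> compact_convex n {x}"
  by (simp add: compact_convex_def)

text \<open>Tychonoff: in the product topology the box is a product of compact factors, with the
  factor {0} at every index from n on.\<close>

lemma compact_Rn_box: "compact {x \<in> Rn n. \<forall>i<n. \<bar>x i\<bar> \<le> R}"
proof -
  have "{x \<in> Rn n. \<forall>i<n. \<bar>x i\<bar> \<le> R} = PiE UNIV (\<lambda>i. if i < n then {-R..R} else {0})"
    by (auto simp: mem_Rn PiE_def Pi_def extensional_def abs_le_iff not_less; metis (full_types) atLeastAtMost_iff linorder_not_less minus_le_iff singleton_iff)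
  moreover have "compact (PiE UNIV (\<lambda>i::nat. if i < n then {-R..R} else {0::real}))"
    using compactin_PiE[of "\<lambda>i. euclidean" UNIV "\<lambda>i::nat. if i < n then {-R..R} else {0::real}"]
    by (auto simp: euclidean_product_topology)
  ultimately show ?thesis by simp
qed

lemma norm_n_convex_combination:
  assumes "norm_n n x \<le> R" "norm_n n y \<le> R" "0 \<le> u" "0 \<le> v" "u + v = 1"
  shows "norm_n n (u *\<^sub>R x + v *\<^sub>R y) \<le> R"
proof -
  have "norm_n n (u *\<^sub>R x + v *\<^sub>R y) \<le> u * norm_n n x + v * norm_n n y"
    using norm_n_triangle[of n "u *\<^sub>R x" "v *\<^sub>R y"] assms by (simp add: norm_n_scaleR)
  also have "\<dots> \<le> R"
    using assms by (intro convex_bound_le) auto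
  finally show ?thesis .
qed

lemma compact_convex_unit_ball: "compact_convex n (unit_ball n)"
proof -
  have "unit_ball n = {x \<in> Rn n. \<forall>i<n. \<bar>x i\<bar> \<le> 1} \<inter> {x. norm_n n x \<le> 1}"
    by (auto simp: unit_ball_def intro: order_trans[OF abs_le_norm_n])
  moreover have "closed {x. norm_n n x \<le> 1}"
    by (intro closed_Collect_le continuous_on_norm_n continuous_on_id continuous_on_const)
  ultimately have "compact (unit_ball n)"
    by (simp add: compact_Int_closed compact_Rn_box)
  moreover have "convex (unit_ball n)"
    by (auto simp: convex_def unit_ball_def intro!: Rn_add Rn_scaleR norm_n_convex_combination)
  ultimately show ?thesis
    by (auto simp: compact_convex_def unit_ball_def)
qed

lemma parallel_body_eq: "parallel_body n A \<epsilon> = A + (*\<^sub>R) \<epsilon> ` unit_ball n"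
proof -
  have "(\<lambda>i. a i + \<epsilon> * b i) = a + \<epsilon> *\<^sub>R b" for a b :: "nat \<Rightarrow> real"
    by (rule ext) simp
  then have "parallel_body n A \<epsilon> = {a + \<epsilon> *\<^sub>R b | a b. a \<in> A \<and> b \<in> unit_ball n}"
    unfolding parallel_body_def by (simp only:)
  also have "\<dots> = A + (*\<^sub>R) \<epsilon> ` unit_ball n"
    unfolding set_plus_def by blast
  finally show ?thesis .
qed

definition seg :: "(nat \<Rightarrow> real) \<Rightarrow> (nat \<Rightarrow> real) set" where
  "seg v = (\<lambda>t. t *\<^sub>R v) ` {-1..1}"

lemma compact_convex_seg: 
  assumes "v \<in> Rn n" shows "compact_convex n (seg v)"
proof -
  have "convex (seg v)"
    unfolding seg_def by (intro convex_linear_image linearI) (auto simp: scaleR_add_left)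
  then show ?thesis
    using assms by (auto simp: compact_convex_def seg_def
        intro!: Rn_scaleR compact_continuous_image continuous_on_fun_scaleR continuous_on_const continuous_on_id)
qed

lemma zero_in_seg: "0 \<in> seg v"
  unfolding seg_def by (rule image_eqI[of _ _ 0]) auto

lemma scaleR_seg: "(*\<^sub>R) c ` seg v = seg (c *\<^sub>R v)"
  by (simp add: seg_def image_image mult.commute)

lemma seg_0 [simp]: "seg 0 = {0}"
  by (auto simp: seg_def image_constant_conv)

section \<open>Lebesgue measure: Fubini, scaling and invariance under isometries\<close>

section \<open>Lebesgue measure on \<open>Rn n\<close>\<close>

interpretation lborel_family: product_sigma_finite "\<lambda>_::nat. lborel :: real measure" ..

definition ext_n :: "nat \<Rightarrow> (nat \<Rightarrow> real) \<Rightarrow> (nat \<Rightarrow> real)" where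
  "ext_n n x = (\<lambda>i. if i < n then x i else 0)"

lemma measurable_ext_n [measurable]: "ext_n n \<in> borel_measurable (\<Pi>\<^sub>M i\<in>{..<n}. (lborel :: real measure))"
proof (rule measurable_coordinatewise_then_product)
  fix i
  show "(\<lambda>x. ext_n n x i) \<in> borel_measurable (\<Pi>\<^sub>M i\<in>{..<n}. (lborel :: real measure))"
    by (cases "i < n") (simp_all add: ext_n_def)
qed

lemma lborel_n_eq: "lborel_n n = distr (\<Pi>\<^sub>M i\<in>{..<n}. lborel) borel (ext_n n)"
  unfolding lborel_n_def ext_n_def ..

lemma space_lborel_n [simp]: "space (lborel_n n) = UNIV"
  and sets_lborel_n [simp, measurable_cong]: "sets (lborel_n n) = sets borel"
  by (simp_all add: lborel_n_def)

lemma nn_integral_lborel_n: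
  assumes [measurable]: "f \<in> borel_measurable borel"
  shows "(\<integral>\<^sup>+x. f x \<partial>lborel_n n) = (\<integral>\<^sup>+x. f (ext_n n x) \<partial>(\<Pi>\<^sub>M i\<in>{..<n}. lborel))"
  unfolding lborel_n_eq by (rule nn_integral_distr) measurable

lemma borel_measurable_fun_upd [measurable (raw)]:
  fixes f :: "'a \<Rightarrow> nat \<Rightarrow> real"
  assumes [measurable]: "f \<in> borel_measurable M" "g \<in> borel_measurable M"
  shows "(\<lambda>x. (f x)(n := g x)) \<in> borel_measurable M"
proof (rule measurable_coordinatewise_then_product)
  fix i
  show "(\<lambda>x. ((f x)(n := g x)) i) \<in> borel_measurable M"
    by (cases "i = n") (simp_all add: measurable_product_then_coordinatewise)
qed

lemma borel_measurable_fun_add [measurable (raw)]: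
  fixes f g :: "'a \<Rightarrow> nat \<Rightarrow> real"
  assumes "f \<in> borel_measurable M" "g \<in> borel_measurable M"
  shows "(\<lambda>x. f x + g x) \<in> borel_measurable M"
  using assms[THEN measurable_product_then_coordinatewise]
  by (intro measurable_coordinatewise_then_product) simp

lemma borel_measurable_fun_diff [measurable (raw)]:
  fixes f g :: "'a \<Rightarrow> nat \<Rightarrow> real"
  assumes "f \<in> borel_measurable M" "g \<in> borel_measurable M"
  shows "(\<lambda>x. f x - g x) \<in> borel_measurable M"
  using assms[THEN measurable_product_then_coordinatewise]
  by (intro measurable_coordinatewise_then_product) simp

lemma borel_measurable_fun_scaleR [measurable (raw)]:
  fixes g :: "'a \<Rightarrow> nat \<Rightarrow> real"
  assumes "f \<in> borel_measurable M" "g \<in> borel_measurable M"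
  shows "(\<lambda>x. f x *\<^sub>R g x) \<in> borel_measurable M"
  using assms(1) assms(2)[THEN measurable_product_then_coordinatewise]
  by (intro measurable_coordinatewise_then_product) simp

lemma ext_n_fun_upd: "ext_n (Suc n) (x(n := t)) = (ext_n n x)(n := t)"
  by (auto simp: ext_n_def fun_eq_iff)

text \<open>Fubini in both orders: the last coordinate inside, for lengths of fibres, and outside,
  for volumes of slices.\<close>

lemma nn_integral_lborel_n_Suc:
  assumes [measurable]: "f \<in> borel_measurable borel"
  shows "(\<integral>\<^sup>+x. f x \<partial>lborel_n (Suc n)) = (\<integral>\<^sup>+x. (\<integral>\<^sup>+t. f (x(n := t)) \<partial>lborel) \<partial>lborel_n n)"
    and "(\<integral>\<^sup>+x. f x \<partial>lborel_n (Suc n)) = (\<integral>\<^sup>+t. (\<integral>\<^sup>+x. f (x(n := t)) \<partial>lborel_n n) \<partial>lborel)"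
proof -
  have *: "(\<lambda>x. f (ext_n (Suc n) x)) \<in> borel_measurable (\<Pi>\<^sub>M i\<in>insert n {..<n}. lborel)"
    unfolding lessThan_Suc[symmetric] by measurable
  have 1: "(\<integral>\<^sup>+x. f x \<partial>lborel_n (Suc n)) = (\<integral>\<^sup>+x. f (ext_n (Suc n) x) \<partial>(\<Pi>\<^sub>M i\<in>insert n {..<n}. lborel))"
    by (simp add: nn_integral_lborel_n lessThan_Suc)
  show "(\<integral>\<^sup>+x. f x \<partial>lborel_n (Suc n)) = (\<integral>\<^sup>+x. (\<integral>\<^sup>+t. f (x(n := t)) \<partial>lborel) \<partial>lborel_n n)"
    unfolding 1 by (subst lborel_family.product_nn_integral_insert[OF _ _ *])
      (simp_all add: ext_n_fun_upd nn_integral_lborel_n)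
  show "(\<integral>\<^sup>+x. f x \<partial>lborel_n (Suc n)) = (\<integral>\<^sup>+t. (\<integral>\<^sup>+x. f (x(n := t)) \<partial>lborel_n n) \<partial>lborel)"
    unfolding 1 by (subst lborel_family.product_nn_integral_insert_rev[OF _ _ *])
      (simp_all add: ext_n_fun_upd nn_integral_lborel_n)
qed

lemma nn_integral_lborel_n_0:
  assumes [measurable]: "f \<in> borel_measurable borel"
  shows "(\<integral>\<^sup>+x. f x \<partial>lborel_n 0) = f 0"
proof -
  have "ext_n 0 x = 0" for x
    by (simp add: ext_n_def fun_eq_iff)
  then show ?thesis
    by (simp add: nn_integral_lborel_n PiM_empty nn_integral_count_space_finite)
qed

text \<open>The measure is defined on all sequences but concentrated on \<open>Rn n\<close>, so
  integrands need to agree only there.\<close>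

lemma AE_lborel_n_Rn: "AE x in lborel_n n. x \<in> Rn n"
proof -
  have [measurable]: "Rn n \<in> sets borel"
    by (simp add: closed_Rn)
  show ?thesis
    unfolding lborel_n_eq by (subst AE_distr_iff) (auto simp: ext_n_def mem_Rn)
qed

lemma nn_integral_lborel_n_cong:
  "(\<And>x. x \<in> Rn n \<Longrightarrow> f x = g x) \<Longrightarrow> (\<integral>\<^sup>+x. f x \<partial>lborel_n n) = (\<integral>\<^sup>+x. g x \<partial>lborel_n n)"
  using AE_lborel_n_Rn[of n] by (intro nn_integral_cong_AE) auto

lemma nn_integral_lborel_n_translate:
  assumes "f \<in> borel_measurable borel" "a \<in> Rn n"
  shows "(\<integral>\<^sup>+x. f (x + a) \<partial>lborel_n n) = (\<integral>\<^sup>+x. f x \<partial>lborel_n n)"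
  using assms
proof (induction n arbitrary: f a)
  case 0
  note [measurable] = 0(1)
  have "a = 0" using 0 by (auto simp: mem_Rn fun_eq_iff)
  then show ?case by simp
next
  case (Suc n)
  note [measurable] = Suc.prems(1)
  have "(\<integral>\<^sup>+x. f (x + a) \<partial>lborel_n (Suc n)) = (\<integral>\<^sup>+x. (\<integral>\<^sup>+t. f (x(n := t) + a) \<partial>lborel) \<partial>lborel_n n)"
    by (subst nn_integral_lborel_n_Suc) simp_all
  also have "\<dots> = (\<integral>\<^sup>+x. (\<integral>\<^sup>+t. f ((x + a(n := 0))(n := a n + 1 * t)) \<partial>lborel) \<partial>lborel_n n)"
    by (intro nn_integral_cong arg_cong[of _ _ f]) (auto simp: fun_eq_iff)
  also have "\<dots> = (\<integral>\<^sup>+x. (\<integral>\<^sup>+t. f ((x + a(n := 0))(n := t)) \<partial>lborel) \<partial>lborel_n n)"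
  proof (rule nn_integral_cong)
    fix x
    have "(\<lambda>t. f ((x + a(n := 0))(n := t))) \<in> borel_measurable borel"
      by measurable
    from nn_integral_real_affine[OF this, of 1 "a n"]
    show "(\<integral>\<^sup>+t. f ((x + a(n := 0))(n := a n + 1 * t)) \<partial>lborel)
        = (\<integral>\<^sup>+t. f ((x + a(n := 0))(n := t)) \<partial>lborel)"
      by simp
  qed
  also have "\<dots> = (\<integral>\<^sup>+x. (\<integral>\<^sup>+t. f (x(n := t)) \<partial>lborel) \<partial>lborel_n n)"
    using Suc.prems(2)
    by (intro Suc.IH[of "\<lambda>x. (\<integral>\<^sup>+t. f (x(n := t)) \<partial>lborel)"]) (auto simp: mem_Rn)
  also have "\<dots> = (\<integral>\<^sup>+x. f x \<partial>lborel_n (Suc n))"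
    by (subst nn_integral_lborel_n_Suc) simp_all
  finally show ?case .
qed

lemma nn_integral_lborel_n_scaleR:
  assumes "f \<in> borel_measurable borel" "c > 0"
  shows "(\<integral>\<^sup>+x. f x \<partial>lborel_n n) = ennreal (c ^ n) * (\<integral>\<^sup>+x. f (c *\<^sub>R x) \<partial>lborel_n n)"
  using assms(1)
proof (induction n arbitrary: f)
  case 0
  note [measurable] = 0
  have "(\<integral>\<^sup>+x. f (c *\<^sub>R x) \<partial>lborel_n 0) = f (c *\<^sub>R 0)"
    by (rule nn_integral_lborel_n_0) measurable
  then show "(\<integral>\<^sup>+x. f x \<partial>lborel_n 0) = ennreal (c ^ 0) * (\<integral>\<^sup>+x. f (c *\<^sub>R x) \<partial>lborel_n 0)"
    unfolding nn_integral_lborel_n_0[OF 0] by (simp only: power_0 ennreal_1 mult_1 scaleR_zero_right)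
next
  case (Suc n)
  note [measurable] = Suc.prems
  have "(\<integral>\<^sup>+x. f x \<partial>lborel_n (Suc n)) = (\<integral>\<^sup>+x. (\<integral>\<^sup>+t. f (x(n := t)) \<partial>lborel) \<partial>lborel_n n)"
    by (subst nn_integral_lborel_n_Suc) simp_all
  also have "\<dots> = ennreal (c ^ n) * (\<integral>\<^sup>+x. (\<integral>\<^sup>+t. f ((c *\<^sub>R x)(n := t)) \<partial>lborel) \<partial>lborel_n n)"
    by (rule Suc.IH) measurable
  also have "\<dots> = ennreal (c ^ n) * (\<integral>\<^sup>+x. ennreal c * (\<integral>\<^sup>+t. f ((c *\<^sub>R x)(n := 0 + c * t)) \<partial>lborel) \<partial>lborel_n n)"
    using assms(2) by (subst nn_integral_real_affine[of _ c 0]) simp_all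
  also have "\<dots> = ennreal (c ^ n) * (\<integral>\<^sup>+x. ennreal c * (\<integral>\<^sup>+t. f (c *\<^sub>R (x(n := t))) \<partial>lborel) \<partial>lborel_n n)"
    by (intro arg_cong2[where f = "(*)"] refl nn_integral_cong arg_cong[of _ _ f]) (auto simp: fun_eq_iff)
  also have "\<dots> = ennreal (c ^ Suc n) * (\<integral>\<^sup>+x. f (c *\<^sub>R x) \<partial>lborel_n (Suc n))"
    using assms(2) by (subst nn_integral_lborel_n_Suc)
      (simp_all add: nn_integral_cmult ennreal_mult mult_ac)
  finally show ?case .
qed

lemma emeasure_lborel_n_box:
  assumes "R \<ge> 0"
  shows "emeasure (lborel_n n) {x \<in> Rn n. \<forall>i<n. \<bar>x i\<bar> \<le> R} = ennreal ((2 * R) ^ n)"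
proof -
  have box: "{x \<in> Rn n. \<forall>i<n. \<bar>x i\<bar> \<le> R} \<in> sets borel"
    by (intro borel_closed compact_imp_closed compact_Rn_box)
  have "ext_n n -` {x \<in> Rn n. \<forall>i<n. \<bar>x i\<bar> \<le> R} \<inter> space (\<Pi>\<^sub>M i\<in>{..<n}. lborel)
      = PiE {..<n} (\<lambda>_. {-R..R})"
    by (auto simp: ext_n_def mem_Rn space_PiM PiE_def Pi_def abs_le_iff)
  then have "emeasure (lborel_n n) {x \<in> Rn n. \<forall>i<n. \<bar>x i\<bar> \<le> R} = (\<Prod>i<n. ennreal (2 * R))"
    using assms unfolding lborel_n_eq emeasure_distr[OF measurable_ext_n box]
    by (simp add: lborel_family.emeasure_PiM)
  then show ?thesis
    using assms by (simp add: prod_constant ennreal_power)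
qed

lemma emeasure_lborel_n_bounded:
  assumes "A \<subseteq> Rn n" "\<And>x. x \<in> A \<Longrightarrow> norm_n n x \<le> R"
  shows "emeasure (lborel_n n) A < \<infinity>"
proof -
  have box: "{x \<in> Rn n. \<forall>i<n. \<bar>x i\<bar> \<le> \<bar>R\<bar>} \<in> sets borel"
    by (intro borel_closed compact_imp_closed compact_Rn_box)
  have "\<bar>x i\<bar> \<le> \<bar>R\<bar>" if "x \<in> A" "i < n" for x i
    using abs_le_norm_n[OF that(2), of x] assms(2)[OF that(1)] by linarith
  then have "A \<subseteq> {x \<in> Rn n. \<forall>i<n. \<bar>x i\<bar> \<le> \<bar>R\<bar>}"
    using assms(1) by blast
  then have "emeasure (lborel_n n) A \<le> emeasure (lborel_n n) {x \<in> Rn n. \<forall>i<n. \<bar>x i\<bar> \<le> \<bar>R\<bar>}"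
    by (rule emeasure_mono) (simp only: box sets_lborel_n)
  also have "\<dots> = ennreal ((2 * \<bar>R\<bar>) ^ n)"
    by (rule emeasure_lborel_n_box) simp
  also have "\<dots> < \<infinity>"
    by simp
  finally show ?thesis .
qed

lemma compact_norm_n_bound:
  assumes "compact A"
  obtains R where "R > 0" "\<And>x. x \<in> A \<Longrightarrow> norm_n n x \<le> R"
proof -
  have "compact (norm_n n ` A)"
    by (intro compact_continuous_image continuous_on_norm_n continuous_on_id assms)
  then obtain R where "R > 0" "\<forall>y\<in>norm_n n ` A. norm y \<le> R"
    by (meson bounded_pos compact_imp_bounded)
  then show thesis
    by (intro that[of R]) auto
qed

lemma emeasure_lborel_n_compact:
  assumes "compact A" "A \<subseteq> Rn n"
  shows "emeasure (lborel_n n) A < \<infinity>"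
  using compact_norm_n_bound[OF assms(1), of n] emeasure_lborel_n_bounded[OF assms(2)] by metis

lemma sigma_finite_lborel_n: "sigma_finite_measure (lborel_n n)"
proof
  define B where "B k = {x \<in> Rn n. \<forall>i<n. \<bar>x i\<bar> \<le> real k}" for k
  have B: "B k \<in> sets borel" for k
    unfolding B_def by (intro borel_closed compact_imp_closed compact_Rn_box)
  have "x \<in> (\<Union>k. B k)" if "x \<in> Rn n" for x
  proof -
    obtain k where "norm_n n x \<le> real k"
      using real_arch_simple by blast
    then show ?thesis
      using that by (auto simp: B_def intro!: exI[of _ k] order_trans[OF abs_le_norm_n])
  qed
  \<comment> \<open>The boxes cover only \<open>Rn n\<close>; its complement, a null set, completes
    the cover of the space.\<close>
  then have "\<Union>(insert (- Rn n) (range B)) = space (lborel_n n)"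
    by auto
  moreover have "emeasure (lborel_n n) (- Rn n) = 0"
    using AE_lborel_n_Rn[of n] by (subst (asm) AE_iff_measurable[of "- Rn n"]) (auto simp: closed_Rn)
  moreover have "emeasure (lborel_n n) (B k) \<noteq> \<infinity>" for k
    by (simp add: B_def emeasure_lborel_n_box)
  ultimately show "\<exists>A. countable A \<and> A \<subseteq> sets (lborel_n n) \<and> \<Union>A = space (lborel_n n) \<and>
      (\<forall>a\<in>A. emeasure (lborel_n n) a \<noteq> \<infinity>)"
    using B by (intro exI[of _ "insert (- Rn n) (range B)"]) (auto simp: closed_Rn)
qed

text \<open>The cube of half side 1 / (n + 1) lies in the ball because the sum of the absolute
  values of the coordinates bounds the Euclidean norm.\<close>

lemma emeasure_unit_ball_pos: "0 < emeasure (lborel_n n) (unit_ball n)"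
proof -
  have meas: "unit_ball n \<in> sets borel"
    using compact_convex_unit_ball[of n] by (simp add: compact_convex_def compact_imp_closed)
  have sub: "{x \<in> Rn n. \<forall>i<n. \<bar>x i\<bar> \<le> 1 / (real n + 1)} \<subseteq> unit_ball n"
  proof safe
    fix x assume "x \<in> Rn n" and x: "\<forall>i<n. \<bar>x i\<bar> \<le> 1 / (real n + 1)"
    have "norm_n n x \<le> (\<Sum>i<n. \<bar>x i\<bar>)"
      by (rule norm_n_le_sum_abs)
    also have "\<dots> \<le> (\<Sum>i<n. 1 / (real n + 1))"
      using x by (intro sum_mono) auto
    also have "\<dots> \<le> 1"
      by (simp add: field_simps)
    finally show "x \<in> unit_ball n"
      using \<open>x \<in> Rn n\<close> by (simp add: unit_ball_def)
  qed
  have "0 < ennreal ((2 * (1 / (real n + 1))) ^ n)"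
    by simp
  also have "\<dots> = emeasure (lborel_n n) {x \<in> Rn n. \<forall>i<n. \<bar>x i\<bar> \<le> 1 / (real n + 1)}"
    by (rule emeasure_lborel_n_box[symmetric]) simp
  also have "\<dots> \<le> emeasure (lborel_n n) (unit_ball n)"
    using sub meas by (intro emeasure_mono) simp_all
  finally show ?thesis .
qed

section \<open>Linear isometries\<close>

context
  fixes m n V T
  assumes T: "linear_isometry_onto m n V T"
begin

lemma isometry_comb:
  assumes "x \<in> Rn m" "y \<in> Rn m"
  shows "T (a *\<^sub>R x + b *\<^sub>R y) = a *\<^sub>R T x + b *\<^sub>R T y"
proof -
  have "T (\<lambda>i. a * x i + b * y i) = (\<lambda>i. a * T x i + b * T y i)"
    using T assms unfolding linear_isometry_onto_def by blast
  moreover have "(\<lambda>i. a * x i + b * y i) = a *\<^sub>R x + b *\<^sub>R y"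
    by (rule ext) simp
  moreover have "(\<lambda>i. a * T x i + b * T y i) = a *\<^sub>R T x + b *\<^sub>R T y"
    by (rule ext) simp
  ultimately show ?thesis by simp
qed

lemma isometry_add: "x \<in> Rn m \<Longrightarrow> y \<in> Rn m \<Longrightarrow> T (x + y) = T x + T y"
  using isometry_comb[of x y 1 1] by simp

lemma isometry_scaleR: "x \<in> Rn m \<Longrightarrow> T (a *\<^sub>R x) = a *\<^sub>R T x"
  using isometry_comb[of x x a 0] by simp

lemma isometry_zero: "T 0 = 0"
  using isometry_scaleR[of 0 0] Rn_0 by simp

lemma isometry_sum:
  assumes "finite I" "\<And>i. i \<in> I \<Longrightarrow> f i \<in> Rn m"
  shows "T (\<Sum>i\<in>I. f i) = (\<Sum>i\<in>I. T (f i))"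
  using assms
proof (induction I rule: finite_induct)
  case empty
  show ?case by (simp only: sum.empty isometry_zero)
next
  case (insert x F)
  then have "T (f x + sum f F) = T (f x) + T (sum f F)"
    by (intro isometry_add Rn_sum) auto
  moreover have "T (sum f F) = (\<Sum>i\<in>F. T (f i))"
    using insert by blast
  ultimately show ?case
    by (simp only: sum.insert[OF insert(1,2)])
qed

lemma isometry_norm: "x \<in> Rn m \<Longrightarrow> norm_n n (T x) = norm_n m x"
  using T by (auto simp: linear_isometry_onto_def)

lemma isometry_mem: "x \<in> Rn m \<Longrightarrow> T x \<in> V"
  and isometry_mem_Rn: "x \<in> Rn m \<Longrightarrow> T x \<in> Rn n"
  using T by (auto simp: linear_isometry_onto_def)

lemma isometry_surj: "y \<in> V \<Longrightarrow> \<exists>x\<in>Rn m. T x = y"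
  using T by (auto simp: linear_isometry_onto_def)

text \<open>Polarization of the preserved norm.\<close>

lemma isometry_inner:
  assumes "x \<in> Rn m" "y \<in> Rn m"
  shows "inner_n n (T x) (T y) = inner_n m x y"
proof -
  have "(norm_n n (T (x + y)))\<^sup>2 = (norm_n m (x + y))\<^sup>2"
    using assms by (simp add: isometry_norm Rn_add)
  then show ?thesis
    using assms by (simp add: isometry_add isometry_norm inner_n_self[symmetric] inner_n_simps inner_n_commute)
      (simp add: inner_n_self isometry_norm)
qed

end

lemma linear_isometry_ontoI:
  assumes "linear T" "V \<subseteq> Rn n" "\<And>x. x \<in> Rn m \<Longrightarrow> T x \<in> V"
    and "\<And>y. y \<in> V \<Longrightarrow> \<exists>x\<in>Rn m. T x = y"
    and "\<And>x. x \<in> Rn m \<Longrightarrow> norm_n n (T x) = norm_n m x"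
  shows "linear_isometry_onto m n V T"
proof -
  have "T (\<lambda>i. a * x i + b * y i) = (\<lambda>i. a * T x i + b * T y i)" for x y a b
  proof -
    have "(\<lambda>i. a * x i + b * y i) = a *\<^sub>R x + b *\<^sub>R y"
      by (rule ext) simp
    moreover have "(\<lambda>i. a * T x i + b * T y i) = a *\<^sub>R T x + b *\<^sub>R T y"
      by (rule ext) simp
    ultimately show ?thesis
      by (simp add: linear_add[OF assms(1)] linear_scale[OF assms(1)])
  qed
  then show ?thesis
    using assms(2-5) unfolding linear_isometry_onto_def by (auto simp: image_iff) metis
qed

section \<open>Rotation invariance of Lebesgue measure\<close>

lemma unit_ball_measurable [measurable]: "unit_ball n \<in> sets borel"
  using compact_convex_unit_ball[of n] by (simp add: compact_convex_def compact_imp_closed)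

lemma Rn_measurable [measurable]: "Rn n \<in> sets borel"
  by (simp add: closed_Rn)

lemma borel_measurable_fun_sum [measurable (raw)]:
  fixes f :: "'i \<Rightarrow> 'a \<Rightarrow> nat \<Rightarrow> real"
  assumes "\<And>i. i \<in> I \<Longrightarrow> f i \<in> borel_measurable M"
  shows "(\<lambda>x. \<Sum>i\<in>I. f i x) \<in> borel_measurable M"
  using assms[THEN measurable_product_then_coordinatewise]
  by (intro measurable_coordinatewise_then_product) simp

text \<open>
  Uniqueness of translation invariant measures: integrating \<open>f (U x + y) * g y\<close> over \<open>x\<close> and \<open>y\<close>,
  with \<open>g\<close> the indicator of the unit ball, in both orders gives
  \<open>\<integral>f (U x) \<cdot> \<integral>g = \<integral>f \<cdot> \<integral>g\<close>.
\<close>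

lemma emeasure_lborel_n_orthogonal_vimage:
  assumes U: "orthogonal_map n U" and A [measurable]: "A \<in> sets borel" and "A \<subseteq> Rn n"
  shows "emeasure (lborel_n n) {x \<in> Rn n. U x \<in> A} = emeasure (lborel_n n) A"
proof -
  let ?L = "lborel_n n"
  interpret P: pair_sigma_finite ?L ?L
    by (simp add: pair_sigma_finite_def sigma_finite_lborel_n)
  \<comment> \<open>\<open>U\<close> is constrained only on \<open>Rn n\<close>. \<open>W\<close>
    extends it from there to a map that is additive and Borel measurable on all sequences.\<close>
  define W where "W x = (\<Sum>i<n. x i *\<^sub>R U (axis_n i))" for x :: "nat \<Rightarrow> real"
  have W_eq: "W x = U x" if "x \<in> Rn n" for x
  proof -
    have "U x = U (\<Sum>i<n. x i *\<^sub>R axis_n i)"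
      using Rn_eq_sum_axis_n[OF that] by simp
    also have "\<dots> = (\<Sum>i<n. U (x i *\<^sub>R axis_n i))"
      by (intro isometry_sum[OF U] Rn_scaleR) auto
    also have "\<dots> = W x"
      unfolding W_def by (intro sum.cong refl isometry_scaleR[OF U]) auto
    finally show ?thesis by simp
  qed
  have W_add: "W (x + y) = W x + W y" for x y
    by (simp add: W_def scaleR_add_left sum.distrib)
  have W_Rn: "W x \<in> Rn n" for x
    unfolding W_def by (intro Rn_sum Rn_scaleR isometry_mem[OF U]) auto
  have W_measurable [measurable]: "W \<in> borel_measurable borel"
    unfolding W_def by (intro borel_measurable_fun_sum borel_measurable_fun_scaleR measurable_product_coordinates) simp
  define f :: "(nat \<Rightarrow> real) \<Rightarrow> ennreal" where "f = indicator A"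
  define g :: "(nat \<Rightarrow> real) \<Rightarrow> ennreal" where "g = indicator (unit_ball n)"
  have [measurable]: "f \<in> borel_measurable borel" "g \<in> borel_measurable borel"
    by (auto simp: f_def g_def)
  \<comment> \<open>On \<open>Rn n\<close> the function \<open>g\<close> sees only the length of its
    argument, which the isometry preserves.\<close>
  have g_W: "g (W x - W z) = g (x - z)" if "x \<in> Rn n" "z \<in> Rn n" for x z
  proof -
    have "W x = W (x - z) + W z"
      unfolding W_add[symmetric] by simp
    then have "W x - W z = U (x - z)"
      using W_eq[of "x - z"] that by (simp add: Rn_diff)
    then show ?thesis
      using isometry_norm[OF U, of "x - z"] isometry_mem[OF U, of "x - z"] that
      by (simp add: g_def unit_ball_def indicator_def Rn_diff)
  qed
  have g_sym: "g (x - z) = g (z - x)" if "x \<in> Rn n" "z \<in> Rn n" for x z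
    using that by (simp add: g_def unit_ball_def indicator_def Rn_diff norm_n_minus_commute)
  have "(\<integral>\<^sup>+x. f (W x) \<partial>?L) * (\<integral>\<^sup>+y. g y \<partial>?L) = (\<integral>\<^sup>+y. (\<integral>\<^sup>+x. f (W x) \<partial>?L) * g y \<partial>?L)"
    by (simp add: nn_integral_cmult)
  also have "\<dots> = (\<integral>\<^sup>+y. (\<integral>\<^sup>+x. f (W x + y) * g y \<partial>?L) \<partial>?L)"
  proof (rule nn_integral_lborel_n_cong)
    fix y assume "y \<in> Rn n"
    then obtain z where z: "z \<in> Rn n" "y = W z"
      using isometry_surj[OF U] W_eq by metis
    have "(\<integral>\<^sup>+x. f (W x) \<partial>?L) = (\<integral>\<^sup>+x. f (W (x + z)) \<partial>?L)"
      by (rule nn_integral_lborel_n_translate[symmetric, of "\<lambda>x. f (W x)"]) (use z in measurable)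
    then show "(\<integral>\<^sup>+x. f (W x) \<partial>?L) * g y = (\<integral>\<^sup>+x. f (W x + y) * g y \<partial>?L)"
      by (simp add: W_add z(2) nn_integral_multc)
  qed
  also have "\<dots> = (\<integral>\<^sup>+x. (\<integral>\<^sup>+y. f (W x + y) * g y \<partial>?L) \<partial>?L)"
    by (rule P.Fubini') measurable
  also have "\<dots> = (\<integral>\<^sup>+x. (\<integral>\<^sup>+y. f y * g (y - W x) \<partial>?L) \<partial>?L)"
  proof (rule nn_integral_cong)
    fix x
    have "(\<integral>\<^sup>+y. f (y + W x) * g (y + W x - W x) \<partial>?L) = (\<integral>\<^sup>+y. f y * g (y - W x) \<partial>?L)"
      by (rule nn_integral_lborel_n_translate[of "\<lambda>y. f y * g (y - W x)"]) (simp_all add: W_Rn)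
    then show "(\<integral>\<^sup>+y. f (W x + y) * g y \<partial>?L) = (\<integral>\<^sup>+y. f y * g (y - W x) \<partial>?L)"
      by (simp add: add.commute)
  qed
  also have "\<dots> = (\<integral>\<^sup>+y. (\<integral>\<^sup>+x. f y * g (y - W x) \<partial>?L) \<partial>?L)"
    by (rule P.Fubini') measurable
  also have "\<dots> = (\<integral>\<^sup>+y. f y * (\<integral>\<^sup>+x. g x \<partial>?L) \<partial>?L)"
  proof (rule nn_integral_lborel_n_cong)
    fix y assume "y \<in> Rn n"
    then obtain z where z: "z \<in> Rn n" "y = W z"
      using isometry_surj[OF U] W_eq by metis
    have mz: "- z \<in> Rn n"
      using z(1) by (simp add: mem_Rn)
    have "(\<integral>\<^sup>+x. g (y - W x) \<partial>?L) = (\<integral>\<^sup>+x. g (x + - z) \<partial>?L)"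
      unfolding z(2) by (rule nn_integral_lborel_n_cong) (simp add: g_W z(1) g_sym[of z])
    also have "\<dots> = (\<integral>\<^sup>+x. g x \<partial>?L)"
      by (rule nn_integral_lborel_n_translate[OF _ mz]) simp
    finally show "(\<integral>\<^sup>+x. f y * g (y - W x) \<partial>?L) = f y * (\<integral>\<^sup>+x. g x \<partial>?L)"
      by (simp add: nn_integral_cmult)
  qed
  also have "\<dots> = (\<integral>\<^sup>+x. f x \<partial>?L) * (\<integral>\<^sup>+y. g y \<partial>?L)"
    by (simp add: nn_integral_multc)
  finally have *: "(\<integral>\<^sup>+x. f (W x) \<partial>?L) * (\<integral>\<^sup>+y. g y \<partial>?L) = (\<integral>\<^sup>+x. f x \<partial>?L) * (\<integral>\<^sup>+y. g y \<partial>?L)" .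
  have "(\<integral>\<^sup>+y. g y \<partial>?L) = emeasure ?L (unit_ball n)"
    by (simp add: g_def)
  moreover have "emeasure ?L (unit_ball n) < \<infinity>"
    using compact_convex_unit_ball[of n] by (intro emeasure_lborel_n_compact compact_convexD)
  moreover have "emeasure ?L (unit_ball n) \<noteq> 0"
    using emeasure_unit_ball_pos[of n] by (metis less_irrefl)
  ultimately have "(\<integral>\<^sup>+x. f (W x) \<partial>?L) = (\<integral>\<^sup>+x. f x \<partial>?L)"
    using * ennreal_mult_cancel_left[of "\<integral>\<^sup>+y. g y \<partial>?L" "\<integral>\<^sup>+x. f (W x) \<partial>?L" "\<integral>\<^sup>+x. f x \<partial>?L"]
    by (auto simp: mult.commute)
  moreover have "(\<integral>\<^sup>+x. f (W x) \<partial>?L) = emeasure ?L {x \<in> Rn n. W x \<in> A}"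
  proof -
    have "(\<integral>\<^sup>+x. f (W x) \<partial>?L) = (\<integral>\<^sup>+x. indicator {x \<in> Rn n. W x \<in> A} x \<partial>?L)"
      by (rule nn_integral_lborel_n_cong) (simp add: f_def indicator_def)
    also have "\<dots> = emeasure ?L {x \<in> Rn n. W x \<in> A}"
    proof (rule nn_integral_indicator)
      have "{x \<in> Rn n. W x \<in> A} = Rn n \<inter> (W -` A \<inter> space borel)"
        by auto
      also have "\<dots> \<in> sets borel"
        by measurable
      finally show "{x \<in> Rn n. W x \<in> A} \<in> sets ?L" by simp
    qed
    finally show ?thesis .
  qed
  moreover have "{x \<in> Rn n. W x \<in> A} = {x \<in> Rn n. U x \<in> A}"
    using W_eq by auto
  ultimately show ?thesis
    by (simp add: f_def)
qed

section \<open>Volume of compact convex sets\<close>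

abbreviation vol :: "nat \<Rightarrow> (nat \<Rightarrow> real) set \<Rightarrow> real" where
  "vol n A \<equiv> measure (lborel_n n) A"

lemma compact_convex_measurable: "compact_convex n A \<Longrightarrow> A \<in> sets borel"
  by (simp add: compact_convex_def compact_imp_closed)

lemma emeasure_eq_vol: "compact_convex n A \<Longrightarrow> emeasure (lborel_n n) A = ennreal (vol n A)"
  by (intro emeasure_eq_ennreal_measure)
    (use emeasure_lborel_n_compact[of A n] in \<open>auto simp: compact_convex_def\<close>)

lemma vol_eqI:
  assumes "emeasure (lborel_n n) A = ennreal r" "r \<ge> 0"
  shows "vol n A = r"
  using assms by (simp add: measure_def)

lemma vol_mono:
  assumes "compact_convex n A" "compact_convex n B" "A \<subseteq> B"
  shows "vol n A \<le> vol n B"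
proof -
  have "emeasure (lborel_n n) A \<le> emeasure (lborel_n n) B"
    using assms by (intro emeasure_mono) (simp_all add: compact_convex_measurable)
  then show ?thesis
    using assms by (simp add: emeasure_eq_vol)
qed

lemma vol_translate:
  assumes A: "compact_convex n A" and a: "a \<in> Rn n"
  shows "vol n ({a} + A) = vol n A"
proof -
  have B: "compact_convex n ({a} + A)"
    by (intro compact_convex_plus compact_convex_singleton assms)
  have [measurable]: "A \<in> sets borel" "{a} + A \<in> sets borel"
    using A B by (auto intro: compact_convex_measurable)
  have "(\<integral>\<^sup>+x. indicator ({a} + A) (x + a) \<partial>lborel_n n) = (\<integral>\<^sup>+x. indicator ({a} + A) x \<partial>lborel_n n)"
    by (rule nn_integral_lborel_n_translate[OF _ a]) measurable
  moreover have "x + a \<in> {a} + A \<longleftrightarrow> x \<in> A" for x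
    by (auto simp: set_plus_def add.commute)
  then have "indicator ({a} + A) (x + a) = (indicator A x :: ennreal)" for x
    by (simp add: indicator_def)
  ultimately have "emeasure (lborel_n n) A = emeasure (lborel_n n) ({a} + A)"
    by simp
  then show ?thesis
    by (simp add: measure_def)
qed

lemma vol_scaleR:
  assumes A: "compact_convex n A" and "c > 0"
  shows "vol n ((*\<^sub>R) c ` A) = c ^ n * vol n A"
proof -
  have B: "compact_convex n ((*\<^sub>R) c ` A)"
    by (intro compact_convex_scaleR assms)
  have [measurable]: "A \<in> sets borel" "(*\<^sub>R) c ` A \<in> sets borel"
    using A B by (auto intro: compact_convex_measurable)
  have "(\<integral>\<^sup>+x. indicator ((*\<^sub>R) c ` A) x \<partial>lborel_n n)
      = ennreal (c ^ n) * (\<integral>\<^sup>+x. indicator ((*\<^sub>R) c ` A) (c *\<^sub>R x) \<partial>lborel_n n)"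
    using \<open>c > 0\<close> by (intro nn_integral_lborel_n_scaleR) simp_all
  moreover have "c *\<^sub>R x \<in> (*\<^sub>R) c ` A \<longleftrightarrow> x \<in> A" for x
    using \<open>c > 0\<close> by auto
  then have "indicator ((*\<^sub>R) c ` A) (c *\<^sub>R x) = (indicator A x :: ennreal)" for x
    by (simp add: indicator_def)
  ultimately have "emeasure (lborel_n n) ((*\<^sub>R) c ` A) = ennreal (c ^ n) * emeasure (lborel_n n) A"
    by simp
  then show ?thesis
    using \<open>c > 0\<close> by (intro vol_eqI) (simp_all add: emeasure_eq_vol[OF A] ennreal_mult)
qed

lemma vol_orthogonal_image:
  assumes U: "orthogonal_map n U" and A: "compact_convex n A" and B: "compact_convex n (U ` A)"
  shows "vol n (U ` A) = vol n A"
proof -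
  have "emeasure (lborel_n n) {x \<in> Rn n. U x \<in> U ` A} = emeasure (lborel_n n) (U ` A)"
    using B by (intro emeasure_lborel_n_orthogonal_vimage U compact_convex_measurable compact_convexD)
  moreover have "{x \<in> Rn n. U x \<in> U ` A} = A"
  proof safe
    fix x y assume x: "x \<in> Rn n" and y: "y \<in> A" "U x = U y"
    have yR: "y \<in> Rn n"
      using y A by (auto simp: compact_convex_def)
    have "U (1 *\<^sub>R x + (-1) *\<^sub>R y) = 0"
      unfolding isometry_comb[OF U x yR] y(2) by simp
    then have "norm_n n (x - y) = 0"
      using isometry_norm[OF U, of "x - y"] x yR by (simp add: Rn_diff)
    then show "x \<in> A"
      using norm_n_eq_0[of "x - y" n] x yR y by (simp add: Rn_diff)
  qed (use A in \<open>auto simp: compact_convex_def\<close>)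
  ultimately show ?thesis
    by (simp add: measure_def)
qed

lemma emeasure_lborel_n_Suc:
  assumes [measurable]: "A \<in> sets borel"
  shows "emeasure (lborel_n (Suc n)) A = (\<integral>\<^sup>+x. emeasure lborel {t. x(n := t) \<in> A} \<partial>lborel_n n)"
    and "emeasure (lborel_n (Suc n)) A = (\<integral>\<^sup>+t. emeasure (lborel_n n) {x. x(n := t) \<in> A} \<partial>lborel)"
proof -
  have [measurable]: "{t. x(n := t) \<in> A} \<in> sets borel" for x
  proof -
    have "(\<lambda>t. x(n := t)) -` A \<inter> space borel \<in> sets borel"
      by measurable
    then show ?thesis by (simp add: vimage_def)
  qed
  have [measurable]: "{x. x(n := t) \<in> A} \<in> sets borel" for t
  proof -
    have "(\<lambda>x. x(n := t)) -` A \<inter> space borel \<in> sets borel"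
      by measurable
    then show ?thesis by (simp add: vimage_def)
  qed
  have 1: "indicator A (x(n := t)) = (indicator {t. x(n := t) \<in> A} t :: ennreal)"
    and 2: "indicator A (x(n := t)) = (indicator {x. x(n := t) \<in> A} x :: ennreal)" for x t
    by (simp_all add: indicator_def)
  have "emeasure (lborel_n (Suc n)) A = (\<integral>\<^sup>+x. indicator A x \<partial>lborel_n (Suc n))"
    by simp
  also have "\<dots> = (\<integral>\<^sup>+x. (\<integral>\<^sup>+t. indicator A (x(n := t)) \<partial>lborel) \<partial>lborel_n n)"
    by (rule nn_integral_lborel_n_Suc) measurable
  finally show "emeasure (lborel_n (Suc n)) A = (\<integral>\<^sup>+x. emeasure lborel {t. x(n := t) \<in> A} \<partial>lborel_n n)"
    unfolding 1 by simp
  have "emeasure (lborel_n (Suc n)) A = (\<integral>\<^sup>+x. indicator A x \<partial>lborel_n (Suc n))"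
    by simp
  also have "\<dots> = (\<integral>\<^sup>+t. (\<integral>\<^sup>+x. indicator A (x(n := t)) \<partial>lborel_n n) \<partial>lborel)"
    by (rule nn_integral_lborel_n_Suc) measurable
  finally show "emeasure (lborel_n (Suc n)) A = (\<integral>\<^sup>+t. emeasure (lborel_n n) {x. x(n := t) \<in> A} \<partial>lborel)"
    unfolding 2 by simp
qed

section \<open>Orthogonal coordinates and the volume gained by adding a segment\<close>

section \<open>Coordinate maps\<close>

text \<open>Coordinates of \<open>z\<close> with respect to \<open>u 0\<close>, ...,
  \<open>u (m - 1)\<close>. For an orthonormal basis of a hyperplane this is the orthogonal
  projection, read in \<open>Rn m\<close>.\<close>

definition frame :: "nat \<Rightarrow> nat \<Rightarrow> (nat \<Rightarrow> nat \<Rightarrow> real) \<Rightarrow> (nat \<Rightarrow> real) \<Rightarrow> nat \<Rightarrow> real" where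
  "frame n m u z = (\<lambda>i. if i < m then inner_n n z (u i) else 0)"

lemma linear_frame: "linear (frame n m u)"
  by (rule linearI) (auto simp: frame_def fun_eq_iff inner_n_simps)

lemma frame_Rn: "frame n m u z \<in> Rn m"
  by (simp add: frame_def mem_Rn)

lemma continuous_on_frame: "continuous_on S (frame n m u)"
proof (rule continuous_on_coordinatewise_then_product)
  fix i
  show "continuous_on S (\<lambda>z. frame n m u z i)"
    by (cases "i < m") (simp_all add: frame_def continuous_on_inner_n continuous_on_id)
qed

lemma compact_convex_frame:
  "compact_convex n A \<Longrightarrow> compact_convex m (frame k m u ` A)"
  unfolding compact_convex_def
  by (auto intro!: compact_continuous_image continuous_on_frame convex_linear_image linear_frame frame_Rn)

lemma linear_image_set_plus: 
  assumes "linear f"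
  shows "f ` (A + B) = f ` A + f ` B"
proof (intro subset_antisym subsetI)
  fix y assume "y \<in> f ` (A + B)"
  then obtain a b where "a \<in> A" "b \<in> B" "y = f (a + b)"
    by (auto elim!: set_plus_elim)
  then show "y \<in> f ` A + f ` B"
    by (auto simp: linear_add[OF assms])
next
  fix y assume "y \<in> f ` A + f ` B"
  then obtain a b where "a \<in> A" "b \<in> B" "y = f a + f b"
    by (auto elim!: set_plus_elim)
  then show "y \<in> f ` (A + B)"
    by (auto simp: linear_add[OF assms, symmetric])
qed

lemma linear_image_seg:
  assumes "linear f"
  shows "f ` seg v = seg (f v)"
  by (simp add: seg_def image_image linear_scale[OF assms])

lemma linear_image_scaleR:
  assumes "linear f"
  shows "f ` ((*\<^sub>R) c ` A) = (*\<^sub>R) c ` f ` A"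
  unfolding image_image by (rule image_cong[OF refl]) (rule linear_scale[OF assms])

section \<open>Householder reflections\<close>

text \<open>For \<open>w = 0\<close> this is the identity, so every \<open>w\<close> in
  \<open>Rn n\<close> yields an orthogonal map. The invariance of \<sigma> is applied to these maps
  only.\<close>

definition reflection_n :: "nat \<Rightarrow> (nat \<Rightarrow> real) \<Rightarrow> (nat \<Rightarrow> real) \<Rightarrow> nat \<Rightarrow> real" where
  "reflection_n n w x = x - (2 * inner_n n x w / inner_n n w w) *\<^sub>R w"

lemma linear_reflection_n: "linear (reflection_n n w)"
  by (rule linearI)
    (simp_all add: reflection_n_def inner_n_simps add_divide_distrib algebra_simps scaleR_add_left scaleR_diff_right)

lemma inner_reflection_n: "inner_n n (reflection_n n w x) y = inner_n n x (reflection_n n w y)"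
  by (simp add: reflection_n_def inner_n_simps inner_n_commute[of n w y] mult.commute)

lemma reflection_n_involution:
  assumes "w \<in> Rn n"
  shows "reflection_n n w (reflection_n n w x) = x"
proof (cases "w = 0")
  case True
  then show ?thesis by (simp add: reflection_n_def)
next
  case False
  then have "inner_n n w w \<noteq> 0"
    using norm_n_eq_0[OF assms] by (simp add: inner_n_self)
  then show ?thesis
    by (simp add: reflection_n_def inner_n_simps fun_eq_iff field_simps)
qed

lemma reflection_n_Rn: "w \<in> Rn n \<Longrightarrow> x \<in> Rn n \<Longrightarrow> reflection_n n w x \<in> Rn n"
  unfolding reflection_n_def by (intro Rn_diff Rn_scaleR)

lemma norm_reflection_n: "w \<in> Rn n \<Longrightarrow> norm_n n (reflection_n n w x) = norm_n n x"
  unfolding norm_n_def inner_reflection_n reflection_n_involution ..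

lemma orthogonal_reflection_n:
  assumes "w \<in> Rn n"
  shows "orthogonal_map n (reflection_n n w)"
  using assms
  by (intro linear_isometry_ontoI linear_reflection_n)
    (auto simp: norm_reflection_n intro: reflection_n_Rn reflection_n_involution)

text \<open>Equal norms give \<open>inner_n n (u - v) (u - v) = 2 * inner_n n u (u - v)\<close>, so
  the coefficient of \<open>u - v\<close> in the reflection is 1.\<close>

lemma reflection_n_swap:
  assumes "norm_n n u = norm_n n v" "u \<in> Rn n" "v \<in> Rn n"
  shows "reflection_n n (u - v) u = v"
proof (cases "u = v")
  case True
  then show ?thesis by (simp add: reflection_n_def)
next
  case False
  have "inner_n n u u = inner_n n v v"
    using assms by (simp add: inner_n_self)
  then have "inner_n n (u - v) (u - v) = 2 * inner_n n u (u - v)"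
    by (simp add: inner_n_simps inner_n_commute[of n v u])
  moreover have "inner_n n (u - v) (u - v) \<noteq> 0"
    using False norm_n_eq_0[of "u - v" n] assms by (simp add: inner_n_self Rn_diff)
  ultimately show ?thesis
    by (simp add: reflection_n_def)
qed

lemma Rn_Suc_orthogonal_axis: "x \<in> Rn m \<longleftrightarrow> x \<in> Rn (Suc m) \<and> inner_n (Suc m) x (axis_n m) = 0"
  by (auto simp: mem_Rn inner_n_axis_n) (metis le_antisym not_less_eq_eq)

lemma norm_n_Suc: "x \<in> Rn m \<Longrightarrow> norm_n (Suc m) x = norm_n m x"
  by (simp add: norm_n_def inner_n_def mem_Rn)

text \<open>The reflection exchanging \<xi> and the last axis carries \<open>Rn m\<close>, the
  orthogonal complement of that axis, onto the hyperplane. This also makes the choice in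
  \<open>surface_area_in\<close> meaningful.\<close>

lemma exists_isometry_onto_hyperplane:
  assumes "\<xi> \<in> unit_sphere (Suc m)"
  shows "\<exists>T. linear_isometry_onto m (Suc m) (hyperplane (Suc m) \<xi>) T"
proof -
  have \<xi>: "\<xi> \<in> Rn (Suc m)" "norm_n (Suc m) \<xi> = 1"
    using assms by (auto simp: unit_sphere_def)
  define w where "w = \<xi> - axis_n m"
  define T where "T = reflection_n (Suc m) w"
  have w: "w \<in> Rn (Suc m)"
    using \<xi> by (simp add: w_def Rn_diff)
  have T\<xi>: "T \<xi> = axis_n m"
    unfolding T_def w_def using \<xi> by (intro reflection_n_swap) auto
  have inner_T: "inner_n (Suc m) (T x) \<xi> = inner_n (Suc m) x (axis_n m)" for x
    using inner_reflection_n[of "Suc m" w x \<xi>] T\<xi> by (simp add: T_def)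
  have T_T: "T (T x) = x" for x
    unfolding T_def by (rule reflection_n_involution[OF w])
  have inner_T': "inner_n (Suc m) (T x) (axis_n m) = inner_n (Suc m) x \<xi>" for x
    using inner_T[of "T x"] by (simp add: T_T)
  have "linear_isometry_onto m (Suc m) (hyperplane (Suc m) \<xi>) T"
  proof (rule linear_isometry_ontoI)
    show "linear T"
      unfolding T_def by (rule linear_reflection_n)
    show "hyperplane (Suc m) \<xi> \<subseteq> Rn (Suc m)"
      by (auto simp: hyperplane_def)
    show "T x \<in> hyperplane (Suc m) \<xi>" if "x \<in> Rn m" for x
      using that reflection_n_Rn[OF w, of x]
      by (auto simp: hyperplane_def inner_T Rn_Suc_orthogonal_axis[of x m] T_def[symmetric])
    show "\<exists>x\<in>Rn m. T x = y" if "y \<in> hyperplane (Suc m) \<xi>" for y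
    proof (rule bexI)
      show "T (T y) = y" by (rule T_T)
      show "T y \<in> Rn m"
        using that reflection_n_Rn[OF w, of y]
        by (auto simp: hyperplane_def inner_T' Rn_Suc_orthogonal_axis[of "T y" m] T_def[symmetric])
    qed
    show "norm_n (Suc m) (T x) = norm_n m x" if "x \<in> Rn m" for x
      using norm_reflection_n[OF w, of x] norm_n_Suc[OF that] by (simp add: T_def)
  qed
  then show ?thesis
    by - (rule exI[where x = T])
qed

section \<open>Volume of the sum of a convex body and a segment\<close>

lemma frame_axis_n: "frame (Suc n) n axis_n x = (\<lambda>i. if i < n then x i else 0)"
  by (auto simp: frame_def inner_n_axis_n)

text \<open>A fibre is a compact convex subset of the line; the empty fibre is the case
  \<open>a > b\<close>.\<close>

lemma slice_interval:
  assumes A: "compact_convex (Suc n) A"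
  obtains a b where "{t. x(n := t) \<in> A} = {a..b::real}"
proof -
  let ?S = "{t. x(n := t) \<in> A}"
  have cont: "continuous_on UNIV (\<lambda>t. x(n := t))"
  proof (rule continuous_on_coordinatewise_then_product)
    fix i
    show "continuous_on UNIV (\<lambda>t. (x(n := t)) i)"
      by (cases "i = n") simp_all
  qed
  have "closed ((\<lambda>t. x(n := t)) -` A)"
    using A by (intro closed_vimage cont compact_imp_closed compact_convexD)
  then have "closed ?S" by (simp add: vimage_def)
  moreover obtain R where R: "\<And>y. y \<in> A \<Longrightarrow> norm_n (Suc n) y \<le> R"
    using compact_norm_n_bound[OF compact_convexD(1)[OF A], of "Suc n"] by blast
  have "\<bar>t\<bar> \<le> R" if "t \<in> ?S" for t
    using abs_le_norm_n[of n "Suc n" "x(n := t)"] R[of "x(n := t)"] that by simp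
  then have "bounded ?S"
    by (auto simp: bounded_iff)
  ultimately have "compact ?S"
    by (simp add: compact_eq_bounded_closed)
  moreover have "convex ?S"
    unfolding convex_def
  proof safe
    fix s t u v :: real
    assume "x(n := s) \<in> A" "x(n := t) \<in> A" and uv: "0 \<le> u" "0 \<le> v" "u + v = 1"
    then have "u *\<^sub>R x(n := s) + v *\<^sub>R x(n := t) \<in> A"
      using A by (intro convexD compact_convexD)
    moreover have "x i = u * x i + v * x i" for i
      using uv by (simp flip: distrib_right)
    then have "x(n := u *\<^sub>R s + v *\<^sub>R t) = u *\<^sub>R x(n := s) + v *\<^sub>R x(n := t)"
      by (auto simp: fun_eq_iff)
    ultimately show "x(n := u *\<^sub>R s + v *\<^sub>R t) \<in> A" by simp
  qed
  then have "connected ?S"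
    by (rule convex_connected)
  ultimately show thesis
    using that connected_compact_interval_1[of ?S] by blast
qed

lemma slice_plus_seg_axis:
  assumes "0 \<le> c"
  shows "{t. x(n := t) \<in> A + seg (c *\<^sub>R axis_n n)} = {t. \<exists>s. x(n := s) \<in> A \<and> \<bar>t - s\<bar> \<le> c}"
proof safe
  fix t assume "x(n := t) \<in> A + seg (c *\<^sub>R axis_n n)"
  then obtain a r where a: "a \<in> A" and r: "-1 \<le> r" "r \<le> 1" and eq: "x(n := t) = a + r *\<^sub>R c *\<^sub>R axis_n n"
    by (auto simp: seg_def elim!: set_plus_elim)
  have "a i = (x(n := t - r * c)) i" for i
    using fun_cong[OF eq, of i] by (auto simp: axis_n_def split: if_splits)
  then have "x(n := t - r * c) \<in> A"
    using a by (metis ext)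
  moreover have "\<bar>t - (t - r * c)\<bar> \<le> c"
    using r assms mult_right_mono[of "\<bar>r\<bar>" 1 c] by (simp add: abs_mult)
  ultimately show "\<exists>s. x(n := s) \<in> A \<and> \<bar>t - s\<bar> \<le> c" by blast
next
  fix t s assume s: "x(n := s) \<in> A" "\<bar>t - s\<bar> \<le> c"
  have eq: "x(n := t) = x(n := s) + ((t - s) / c) *\<^sub>R c *\<^sub>R axis_n n"
    using s assms by (auto simp: fun_eq_iff axis_n_def)
  have "(t - s) / c \<in> {-1..1}"
    using s assms by (cases "c = 0") (auto simp: field_simps)
  then have "((t - s) / c) *\<^sub>R c *\<^sub>R axis_n n \<in> seg (c *\<^sub>R axis_n n)"
    unfolding seg_def by blast
  then show "x(n := t) \<in> A + seg (c *\<^sub>R axis_n n)"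
    unfolding eq using s(1) by (rule set_plus_intro[rotated])
qed

text \<open>Every nonempty fibre along the last axis is an interval and grows by \<open>c\<close> at
  both ends, while empty fibres stay empty. The nonempty ones are those over the projection of
  \<open>A\<close>.\<close>

lemma vol_plus_seg_axis:
  assumes A: "compact_convex (Suc n) A" and c: "0 \<le> c"
  shows "vol (Suc n) (A + seg (c *\<^sub>R axis_n n)) = vol (Suc n) A + 2 * c * vol n (frame (Suc n) n axis_n ` A)"
proof -
  let ?B = "A + seg (c *\<^sub>R axis_n n)" and ?P = "frame (Suc n) n axis_n ` A"
  have B: "compact_convex (Suc n) ?B"
    by (intro compact_convex_plus A compact_convex_seg Rn_scaleR axis_n_Rn) simp
  have P: "compact_convex n ?P"
    by (rule compact_convex_frame[OF A])
  have [measurable]: "A \<in> sets borel" "?B \<in> sets borel" "?P \<in> sets borel"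
    using A B P compact_convex_measurable by blast+
  have mem_P: "x \<in> ?P \<longleftrightarrow> (\<exists>t. x(n := t) \<in> A)" if "x \<in> Rn n" for x
  proof safe
    fix y assume y: "y \<in> A" "x = frame (Suc n) n axis_n y"
    have "(frame (Suc n) n axis_n y)(n := y n) = y"
      using y(1) compact_convexD(3)[OF A] by (auto simp: fun_eq_iff frame_axis_n mem_Rn)
    then show "\<exists>t. (frame (Suc n) n axis_n y)(n := t) \<in> A"
      using y(1) by metis
  next
    fix t assume t: "x(n := t) \<in> A"
    have "x = frame (Suc n) n axis_n (x(n := t))"
      using that by (auto simp: fun_eq_iff frame_axis_n mem_Rn)
    then show "x \<in> ?P"
      using t by blast
  qed
  have slice: "emeasure lborel {t. x(n := t) \<in> ?B}
      = emeasure lborel {t. x(n := t) \<in> A} + ennreal (2 * c) * indicator ?P x" if x: "x \<in> Rn n" for x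
  proof (cases "x \<in> ?P")
    case False
    then show ?thesis
      using mem_P[OF x] by (simp add: slice_plus_seg_axis[OF c])
  next
    case True
    obtain a b where ab: "{t. x(n := t) \<in> A} = {a..b}"
      using slice_interval[OF A] by blast
    have "a \<le> b"
      using True ab mem_P[OF x] by (metis atLeastatMost_empty_iff2 empty_iff mem_Collect_eq)
    have "x(n := s) \<in> A \<longleftrightarrow> a \<le> s \<and> s \<le> b" for s
      using ab by (metis atLeastAtMost_iff mem_Collect_eq)
    then have "{t. x(n := t) \<in> ?B} = {t. \<exists>s. (a \<le> s \<and> s \<le> b) \<and> \<bar>t - s\<bar> \<le> c}"
      by (simp add: slice_plus_seg_axis[OF c])
    also have "\<dots> = {a - c..b + c}"
    proof safe
      \<comment> \<open>The witness is the point of the interval from \<open>a\<close> to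
        \<open>b\<close> that is nearest to \<open>t\<close>.\<close>
      fix t assume "t \<in> {a - c..b + c}"
      then show "\<exists>s. (a \<le> s \<and> s \<le> b) \<and> \<bar>t - s\<bar> \<le> c"
        using \<open>a \<le> b\<close> c by (intro exI[of _ "max a (min b t)"]) auto
    qed auto
    finally show ?thesis
      using True \<open>a \<le> b\<close> c by (simp add: ab ennreal_plus[symmetric] del: ennreal_plus)
  qed
  have [measurable]: "(\<lambda>x. emeasure lborel {t. x(n := t) \<in> A}) \<in> borel_measurable borel"
  proof -
    have "(\<lambda>p. (fst p)(n := snd p)) -` A \<inter> space (borel \<Otimes>\<^sub>M lborel) \<in> sets (borel \<Otimes>\<^sub>M lborel)"
      by measurable
    from sigma_finite_measure.measurable_emeasure_Pair[OF sigma_finite_lborel this]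
    show ?thesis by (simp add: space_pair_measure vimage_def)
  qed
  have "emeasure (lborel_n (Suc n)) ?B
      = (\<integral>\<^sup>+x. emeasure lborel {t. x(n := t) \<in> A} + ennreal (2 * c) * indicator ?P x \<partial>lborel_n n)"
    by (subst emeasure_lborel_n_Suc) (auto intro: nn_integral_lborel_n_cong slice)
  also have "\<dots> = emeasure (lborel_n (Suc n)) A + ennreal (2 * c) * emeasure (lborel_n n) ?P"
    by (subst nn_integral_add) (simp_all add: emeasure_lborel_n_Suc(1) nn_integral_cmult)
  also have "\<dots> = ennreal (vol (Suc n) A + 2 * c * vol n ?P)"
    using c by (simp add: emeasure_eq_vol[OF A] emeasure_eq_vol[OF P] ennreal_mult)
  finally show ?thesis
    using c by (intro vol_eqI) simp_all
qed

lemma vol_plus_seg: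
  assumes \<xi>: "\<xi> \<in> unit_sphere (Suc m)"
    and T: "linear_isometry_onto m (Suc m) (hyperplane (Suc m) \<xi>) T"
    and A: "compact_convex (Suc m) A" and c: "0 \<le> c"
  shows "vol (Suc m) (A + seg (c *\<^sub>R \<xi>))
    = vol (Suc m) A + 2 * c * vol m (frame (Suc m) m (\<lambda>i. T (axis_n i)) ` A)"
proof -
  let ?n = "Suc m"
  \<comment> \<open>The orthogonal map taking the hyperplane to the first m coordinates and \<xi> to
    the last axis. It reduces the claim to a segment along that axis.\<close>
  define V where "V = frame ?n ?n ((\<lambda>i. T (axis_n i))(m := \<xi>))"
  have \<xi>': "\<xi> \<in> Rn ?n" "inner_n ?n \<xi> \<xi> = 1"
    using \<xi> by (auto simp: unit_sphere_def inner_n_self)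
  have T_\<xi>: "inner_n ?n (T y) \<xi> = 0" if "y \<in> Rn m" for y
    using isometry_mem[OF T that] by (simp add: hyperplane_def)
  have V_T: "V (T y + s *\<^sub>R \<xi>) = y(m := s)" if "y \<in> Rn m" for y s
  proof (rule ext)
    fix i
    consider "i < m" | "i = m" | "i > m" by linarith
    then show "V (T y + s *\<^sub>R \<xi>) i = (y(m := s)) i"
    proof cases
      case 1
      then show ?thesis
        using T_\<xi>[of "axis_n i"] isometry_inner[OF T that, of "axis_n i"]
        by (simp add: V_def frame_def inner_n_simps inner_n_commute[of ?n \<xi>] inner_n_axis_n)
    next
      case 2
      then show ?thesis
        by (simp add: V_def frame_def inner_n_simps T_\<xi>[OF that] \<xi>')
    next
      case 3
      then show ?thesis
        using that by (simp add: V_def frame_def mem_Rn)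
    qed
  qed
  have decomp: "\<exists>y\<in>Rn m. z = T y + inner_n ?n z \<xi> *\<^sub>R \<xi>" if "z \<in> Rn ?n" for z
  proof -
    have "z - inner_n ?n z \<xi> *\<^sub>R \<xi> \<in> hyperplane ?n \<xi>"
      using that \<xi>' by (auto simp: hyperplane_def inner_n_simps intro!: Rn_diff Rn_scaleR)
    then obtain y where "y \<in> Rn m" "T y = z - inner_n ?n z \<xi> *\<^sub>R \<xi>"
      using isometry_surj[OF T] by blast
    then show ?thesis by (intro bexI[of _ y]) auto
  qed
  have lin: "linear V"
    unfolding V_def by (rule linear_frame)
  have norm_upd: "(norm_n ?n (y(m := s)))\<^sup>2 = (norm_n m y)\<^sup>2 + s\<^sup>2" for y s
    unfolding inner_n_self[symmetric] by (simp add: inner_n_def power2_eq_square)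
  have orth: "orthogonal_map ?n V"
  proof (rule linear_isometry_ontoI[OF lin order_refl])
    show "V x \<in> Rn ?n" for x
      by (simp add: V_def frame_Rn)
    show "\<exists>z\<in>Rn ?n. V z = x" if "x \<in> Rn ?n" for x
    proof -
      have y: "x(m := 0) \<in> Rn m"
        using that by (auto simp: mem_Rn)
      have "V (T (x(m := 0)) + x m *\<^sub>R \<xi>) = x"
        by (subst V_T[OF y]) simp
      moreover have "T (x(m := 0)) + x m *\<^sub>R \<xi> \<in> Rn ?n"
        by (intro Rn_add Rn_scaleR \<xi>' isometry_mem_Rn[OF T y])
      ultimately show ?thesis by blast
    qed
    show "norm_n ?n (V z) = norm_n ?n z" if z: "z \<in> Rn ?n" for z
    proof -
      obtain y where y: "y \<in> Rn m" "z = T y + inner_n ?n z \<xi> *\<^sub>R \<xi>"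
        using decomp[OF z] by blast
      define s where "s = inner_n ?n z \<xi>"
      have zs: "z = T y + s *\<^sub>R \<xi>"
        using y(2) by (simp add: s_def)
      have "(norm_n ?n (V z))\<^sup>2 = (norm_n m y)\<^sup>2 + s\<^sup>2"
        unfolding zs V_T[OF y(1)] by (rule norm_upd)
      also have "\<dots> = (norm_n ?n z)\<^sup>2"
        unfolding zs inner_n_self[symmetric]
        using T_\<xi>[OF y(1)] isometry_inner[OF T y(1) y(1)] \<xi>'(2)
        by (simp add: inner_n_simps inner_n_commute[of ?n \<xi> "T y"] power2_eq_square)
      finally show ?thesis by simp
    qed
  qed
  have VA: "compact_convex ?n (V ` S)" if "compact_convex ?n S" for S
    unfolding V_def by (rule compact_convex_frame[OF that])
  have V\<xi>: "V (c *\<^sub>R \<xi>) = c *\<^sub>R axis_n m"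
  proof -
    have "V (T 0 + c *\<^sub>R \<xi>) = 0(m := c)"
      by (rule V_T) (simp add: mem_Rn)
    then show ?thesis
      by (auto simp: isometry_zero[OF T] axis_n_def fun_eq_iff)
  qed
  have sum: "compact_convex ?n (A + seg (c *\<^sub>R \<xi>))"
    by (intro compact_convex_plus A compact_convex_seg Rn_scaleR \<xi>')
  have "vol ?n (A + seg (c *\<^sub>R \<xi>)) = vol ?n (V ` (A + seg (c *\<^sub>R \<xi>)))"
    by (rule vol_orthogonal_image[OF orth sum VA[OF sum], symmetric])
  also have "V ` (A + seg (c *\<^sub>R \<xi>)) = V ` A + seg (c *\<^sub>R axis_n m)"
    by (simp only: linear_image_set_plus[OF lin] linear_image_seg[OF lin] V\<xi>)
  also have "vol ?n \<dots> = vol ?n (V ` A) + 2 * c * vol m (frame ?n m axis_n ` V ` A)"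
    by (rule vol_plus_seg_axis[OF VA[OF A] c])
  also have "vol ?n (V ` A) = vol ?n A"
    by (rule vol_orthogonal_image[OF orth A VA[OF A]])
  also have "frame ?n m axis_n ` V ` A = frame ?n m (\<lambda>i. T (axis_n i)) ` A"
    unfolding image_image
  proof (rule image_cong[OF refl])
    fix z assume "z \<in> A"
    show "frame ?n m axis_n (V z) = frame ?n m (\<lambda>i. T (axis_n i)) z"
      unfolding frame_axis_n by (auto simp: V_def frame_def fun_eq_iff)
  qed
  finally show ?thesis .
qed

section \<open>Volume gained by adding a segment\<close>

definition seg_gain :: "nat \<Rightarrow> (nat \<Rightarrow> real) set \<Rightarrow> (nat \<Rightarrow> real) \<Rightarrow> real" where
  "seg_gain n A v = vol n (A + seg v) - vol n A"

text \<open>\<open>g A\<close> is 2 |v| times the volume of the projection of \<open>A\<close> along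
  \<open>v\<close>. Leaving it unspecified hides the isometry onto the hyperplane and includes
  \<open>v = 0\<close>, which determines no hyperplane.\<close>

lemma seg_gain_repr:
  assumes "v \<in> Rn n"
  obtains g where "\<forall>A c. compact_convex n A \<longrightarrow> 0 \<le> c \<longrightarrow> vol n (A + seg (c *\<^sub>R v)) = vol n A + c * g A"
    and "\<forall>A B. compact_convex n A \<longrightarrow> compact_convex n B \<longrightarrow> A \<subseteq> B \<longrightarrow> g A \<le> g B"
    and "\<forall>A. 0 \<le> g A"
proof (cases "v = 0")
  case True
  show thesis
  proof (rule that[of "\<lambda>_. 0"])
    show "\<forall>A c. compact_convex n A \<longrightarrow> 0 \<le> c \<longrightarrow> vol n (A + seg (c *\<^sub>R v)) = vol n A + c * 0"
      unfolding True scaleR_zero_right seg_0 by simp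
  qed auto
next
  case False
  then obtain m where n: "n = Suc m"
    using assms by (cases n) (auto simp: mem_Rn fun_eq_iff)
  define \<xi> where "\<xi> = (1 / norm_n n v) *\<^sub>R v"
  have v: "norm_n n v > 0"
    using False assms norm_n_eq_0[OF assms] by (metis norm_n_nonneg order_le_less)
  have "\<xi> \<in> unit_sphere (Suc m)"
    using v assms by (auto simp: unit_sphere_def \<xi>_def norm_n_scaleR n intro!: Rn_scaleR)
  then obtain T where T: "linear_isometry_onto m (Suc m) (hyperplane (Suc m) \<xi>) T"
    using exists_isometry_onto_hyperplane by blast
  let ?u = "\<lambda>i. T (axis_n i)"
  show thesis
  proof (rule that[of "\<lambda>A. 2 * norm_n n v * vol m (frame n m ?u ` A)"])
    have "c *\<^sub>R v = (c * norm_n n v) *\<^sub>R \<xi>" for c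
      using v by (simp add: \<xi>_def)
    then show "\<forall>A c. compact_convex n A \<longrightarrow> 0 \<le> c \<longrightarrow>
        vol n (A + seg (c *\<^sub>R v)) = vol n A + c * (2 * norm_n n v * vol m (frame n m ?u ` A))"
      using vol_plus_seg[OF \<open>\<xi> \<in> unit_sphere (Suc m)\<close> T] v by (simp add: n)
    show "\<forall>A B. compact_convex n A \<longrightarrow> compact_convex n B \<longrightarrow> A \<subseteq> B \<longrightarrow>
        2 * norm_n n v * vol m (frame n m ?u ` A) \<le> 2 * norm_n n v * vol m (frame n m ?u ` B)"
      using v by (auto intro!: mult_left_mono vol_mono compact_convex_frame[of n] image_mono)
  qed (use v in auto)
qed

lemma seg_gain_scaleR:
  assumes "compact_convex n A" "v \<in> Rn n" "0 \<le> c"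
  shows "seg_gain n A (c *\<^sub>R v) = c * seg_gain n A v"
proof -
  obtain g where g: "\<forall>A c. compact_convex n A \<longrightarrow> 0 \<le> c \<longrightarrow> vol n (A + seg (c *\<^sub>R v)) = vol n A + c * g A"
    by (rule seg_gain_repr[OF assms(2)])
  show ?thesis
    using g[rule_format, OF assms(1,3)] g[rule_format, OF assms(1), of 1] by (simp add: seg_gain_def)
qed

lemma seg_gain_mono:
  assumes "compact_convex n A" "compact_convex n B" "A \<subseteq> B" "v \<in> Rn n"
  shows "seg_gain n A v \<le> seg_gain n B v"
proof -
  obtain g where g: "\<forall>A c. compact_convex n A \<longrightarrow> 0 \<le> c \<longrightarrow> vol n (A + seg (c *\<^sub>R v)) = vol n A + c * g A"
    and mono: "\<forall>A B. compact_convex n A \<longrightarrow> compact_convex n B \<longrightarrow> A \<subseteq> B \<longrightarrow> g A \<le> g B"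
    by (rule seg_gain_repr[OF assms(4)])
  show ?thesis
    using g[rule_format, OF assms(1), of 1] g[rule_format, OF assms(2), of 1]
      mono[rule_format, OF assms(1-3)]
    by (simp add: seg_gain_def)
qed

lemma seg_gain_nonneg:
  assumes "compact_convex n A" "v \<in> Rn n"
  shows "0 \<le> seg_gain n A v"
proof -
  obtain g where g: "\<forall>A c. compact_convex n A \<longrightarrow> 0 \<le> c \<longrightarrow> vol n (A + seg (c *\<^sub>R v)) = vol n A + c * g A"
    and "\<forall>A. 0 \<le> g A"
    by (rule seg_gain_repr[OF assms(2)])
  then show ?thesis
    using g[rule_format, OF assms(1), of 1] by (simp add: seg_gain_def)
qed

section \<open>Dilation estimates, zonotopes and the existence of the surface area\<close>

section \<open>Bodies with interior points\<close>

text \<open>A quantitative form of having interior points: the radius \<open>r\<close> enters the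
  dilation factors below.\<close>

definition has_inball :: "nat \<Rightarrow> (nat \<Rightarrow> real) set \<Rightarrow> (nat \<Rightarrow> real) \<Rightarrow> real \<Rightarrow> bool" where
  "has_inball n A x r \<longleftrightarrow> x \<in> Rn n \<and> 0 < r \<and> {x} + (*\<^sub>R) r ` unit_ball n \<subseteq> A"

lemma has_inball_mono: "has_inball n A x r \<Longrightarrow> A \<subseteq> B \<Longrightarrow> has_inball n B x r"
  by (auto simp: has_inball_def)

lemma zero_in_unit_ball: "0 \<in> unit_ball n"
  by (simp add: unit_ball_def Rn_0)

text \<open>From x + r B \<subseteq> A follows \<epsilon> B \<subseteq> (\<epsilon> / r) (A - x),
  and A + (\<epsilon> / r) A = (1 + \<epsilon> / r) A by convexity. Additive errors thus become
  dilations, which multiply the volume by a power.\<close>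

lemma plus_ball_subset:
  assumes A: "convex A" and x: "has_inball n A x r" and \<epsilon>: "0 \<le> \<epsilon>"
  shows "A + (*\<^sub>R) \<epsilon> ` unit_ball n \<subseteq> {(- (\<epsilon> / r)) *\<^sub>R x} + (*\<^sub>R) (1 + \<epsilon> / r) ` A"
proof
  have r: "r > 0" using x by (simp add: has_inball_def)
  fix y assume "y \<in> A + (*\<^sub>R) \<epsilon> ` unit_ball n"
  then obtain a b where ab: "a \<in> A" "b \<in> unit_ball n" "y = a + \<epsilon> *\<^sub>R b"
    by (auto elim!: set_plus_elim)
  have "x + r *\<^sub>R b \<in> A"
    using x ab(2) by (auto simp: has_inball_def)
  then have "1 *\<^sub>R a + (\<epsilon> / r) *\<^sub>R (x + r *\<^sub>R b) \<in> (*\<^sub>R) 1 ` A + (*\<^sub>R) (\<epsilon> / r) ` A"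
    using ab(1) by (intro set_plus_intro imageI)
  also have "\<dots> = (*\<^sub>R) (1 + \<epsilon> / r) ` A"
    using A \<epsilon> r by (intro convex_scaleR_add) auto
  finally have "(- (\<epsilon> / r)) *\<^sub>R x + (1 *\<^sub>R a + (\<epsilon> / r) *\<^sub>R (x + r *\<^sub>R b))
      \<in> {(- (\<epsilon> / r)) *\<^sub>R x} + (*\<^sub>R) (1 + \<epsilon> / r) ` A"
    by (intro set_plus_intro singletonI)
  also have "(- (\<epsilon> / r)) *\<^sub>R x + (1 *\<^sub>R a + (\<epsilon> / r) *\<^sub>R (x + r *\<^sub>R b)) = y"
    unfolding ab(3) using r by (simp add: scaleR_add_right)
  finally show "y \<in> {(- (\<epsilon> / r)) *\<^sub>R x} + (*\<^sub>R) (1 + \<epsilon> / r) ` A" .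
qed

lemma plus_subset_dilation:
  assumes A: "compact_convex n A" and x: "has_inball n A x r" and \<epsilon>: "0 \<le> \<epsilon>"
    and M: "M \<subseteq> (*\<^sub>R) \<epsilon> ` unit_ball n"
  shows "A + M \<subseteq> {(- (\<epsilon> / r)) *\<^sub>R x} + (*\<^sub>R) (1 + \<epsilon> / r) ` A"
  using plus_ball_subset[OF compact_convexD(2)[OF A] x \<epsilon>] set_plus_mono2[OF order_refl[of A] M] by blast

lemma vol_plus_le:
  assumes A: "compact_convex n A" and x: "has_inball n A x r" and \<epsilon>: "0 \<le> \<epsilon>"
    and M: "compact_convex n M" "M \<subseteq> (*\<^sub>R) \<epsilon> ` unit_ball n"
  shows "vol n (A + M) \<le> (1 + \<epsilon> / r) ^ n * vol n A"
proof -
  have r: "r > 0" "x \<in> Rn n" using x by (simp_all add: has_inball_def)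
  have "vol n (A + M) \<le> vol n ({(- (\<epsilon> / r)) *\<^sub>R x} + (*\<^sub>R) (1 + \<epsilon> / r) ` A)"
    using assms r by (intro vol_mono plus_subset_dilation compact_convex_plus
        compact_convex_singleton compact_convex_scaleR Rn_scaleR)
  also have "\<dots> = vol n ((*\<^sub>R) (1 + \<epsilon> / r) ` A)"
    using A r by (intro vol_translate compact_convex_scaleR Rn_scaleR)
  also have "\<dots> = (1 + \<epsilon> / r) ^ n * vol n A"
    using r \<epsilon> by (intro vol_scaleR A) (simp add: add_pos_nonneg)
  finally show ?thesis .
qed

text \<open>The gain is monotone in the body, translation invariant, and multiplied by c ^ (n - 1)
  when the body is dilated by c.\<close>

lemma seg_gain_plus_le:
  assumes A: "compact_convex n A" and x: "has_inball n A x r" and \<epsilon>: "0 \<le> \<epsilon>"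
    and M: "compact_convex n M" "M \<subseteq> (*\<^sub>R) \<epsilon> ` unit_ball n" and v: "v \<in> Rn n"
  shows "seg_gain n (A + M) v \<le> (1 + \<epsilon> / r) ^ n * seg_gain n A v"
proof -
  have r: "r > 0" "x \<in> Rn n" using x by (simp_all add: has_inball_def)
  define c where "c = 1 + \<epsilon> / r"
  define y where "y = (- (\<epsilon> / r)) *\<^sub>R x"
  have c: "c \<ge> 1" using \<epsilon> r by (simp add: c_def)
  have y: "y \<in> Rn n" unfolding y_def by (intro Rn_scaleR r)
  have "seg_gain n (A + M) v \<le> seg_gain n ({y} + (*\<^sub>R) c ` A) v"
    unfolding c_def y_def using assms r by (intro seg_gain_mono plus_subset_dilation compact_convex_plus
        compact_convex_singleton compact_convex_scaleR Rn_scaleR)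
  also have "\<dots> = vol n ({y} + (*\<^sub>R) c ` (A + seg ((1 / c) *\<^sub>R v))) - vol n ({y} + (*\<^sub>R) c ` A)"
    using c by (simp add: seg_gain_def set_plus_scaleR_image scaleR_seg add.assoc)
  also have "\<dots> = vol n ((*\<^sub>R) c ` (A + seg ((1 / c) *\<^sub>R v))) - vol n ((*\<^sub>R) c ` A)"
    using y A v by (subst (1 2) vol_translate)
      (auto intro!: compact_convex_plus compact_convex_scaleR compact_convex_seg Rn_scaleR)
  also have "\<dots> = c ^ n * seg_gain n A ((1 / c) *\<^sub>R v)"
    using c A v by (subst (1 2) vol_scaleR)
      (auto intro!: compact_convex_plus compact_convex_scaleR compact_convex_seg Rn_scaleR
        simp: seg_gain_def right_diff_distrib)
  also have "\<dots> = c ^ n * ((1 / c) * seg_gain n A v)"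
    using c A v by (subst seg_gain_scaleR) auto
  \<comment> \<open>Dropping 1 / c weakens the exponent n - 1 to n. This avoids a subtraction and
    still gives a factor tending to 1 with \<epsilon> tending to 0.\<close>
  also have "\<dots> \<le> c ^ n * (1 * seg_gain n A v)"
    using c seg_gain_nonneg[OF A v] by (intro mult_left_mono mult_right_mono) auto
  finally show ?thesis by (simp add: c_def)
qed

section \<open>Zonotopes\<close>

text \<open>The sum is taken in the monoid of sets under Minkowski addition, so the empty zonotope
  is {0}.\<close>

abbreviation zonotope :: "'j set \<Rightarrow> ('j \<Rightarrow> nat \<Rightarrow> real) \<Rightarrow> (nat \<Rightarrow> real) set" where
  "zonotope J \<eta> \<equiv> (\<Sum>j\<in>J. seg (\<eta> j))"

lemma zonotope_insert:
  "finite J \<Longrightarrow> j \<notin> J \<Longrightarrow> zonotope (insert j J) \<eta> = seg (\<eta> j) + zonotope J \<eta>"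
  by (rule sum.insert)

lemma zero_in_zonotope: "0 \<in> zonotope J \<eta>"
proof (induction J rule: infinite_finite_induct)
  case (insert j J)
  have "0 + 0 \<in> seg (\<eta> j) + zonotope J \<eta>"
    by (intro set_plus_intro zero_in_seg insert.IH)
  then show "0 \<in> zonotope (insert j J) \<eta>"
    by (simp only: zonotope_insert[OF insert(1,2)] add_0_left)
next
  case (infinite J)
  show "0 \<in> zonotope J \<eta>"
    by (simp only: sum.infinite[OF infinite] set_zero singletonI)
next
  case empty
  show "0 \<in> zonotope {} \<eta>"
    by (simp only: sum.empty set_zero singletonI)
qed

lemma compact_convex_zonotope:
  assumes "\<And>j. j \<in> J \<Longrightarrow> \<eta> j \<in> Rn n"
  shows "compact_convex n (zonotope J \<eta>)"
  using assms
proof (induction J rule: infinite_finite_induct)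
  case (insert j J)
  then have "compact_convex n (seg (\<eta> j) + zonotope J \<eta>)"
    by (intro compact_convex_plus compact_convex_seg) auto
  then show "compact_convex n (zonotope (insert j J) \<eta>)"
    by (simp only: zonotope_insert[OF insert(1,2)])
qed (simp_all add: set_zero compact_convex_singleton Rn_0)

lemma linear_image_zonotope:
  assumes "linear f"
  shows "f ` zonotope J \<eta> = zonotope J (\<lambda>j. f (\<eta> j))"
proof (induction J rule: infinite_finite_induct)
  case (insert j J)
  then show "f ` zonotope (insert j J) \<eta> = zonotope (insert j J) (\<lambda>j. f (\<eta> j))"
    by (simp only: zonotope_insert[OF insert(1,2)] linear_image_set_plus[OF assms] linear_image_seg[OF assms])
next
  case (infinite J)
  show "f ` zonotope J \<eta> = zonotope J (\<lambda>j. f (\<eta> j))"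
    by (simp only: sum.infinite[OF infinite] set_zero image_insert image_empty linear_0[OF assms])
next
  case empty
  show "f ` zonotope {} \<eta> = zonotope {} (\<lambda>j. f (\<eta> j))"
    by (simp only: sum.empty set_zero image_insert image_empty linear_0[OF assms])
qed

lemma scaleR_zonotope: "(*\<^sub>R) c ` zonotope J \<eta> = zonotope J (\<lambda>j. c *\<^sub>R \<eta> j)"
  by (rule linear_image_zonotope) (simp add: linear_iff scaleR_add_right)

lemma mem_zonotopeI:
  assumes "finite J" "\<And>j. j \<in> J \<Longrightarrow> \<bar>t j\<bar> \<le> 1"
  shows "(\<Sum>j\<in>J. t j *\<^sub>R \<eta> j) \<in> zonotope J \<eta>"
  using assms
proof (induction J rule: finite_induct)
  case empty
  show "(\<Sum>j\<in>{}. t j *\<^sub>R \<eta> j) \<in> zonotope {} \<eta>"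
    by (simp only: sum.empty) (simp add: set_zero)
next
  case (insert j J)
  have "t j *\<^sub>R \<eta> j \<in> seg (\<eta> j)"
    using insert.prems[of j] by (auto simp: seg_def abs_le_iff)
  moreover have "(\<Sum>j\<in>J. t j *\<^sub>R \<eta> j) \<in> zonotope J \<eta>"
    using insert by blast
  ultimately have "t j *\<^sub>R \<eta> j + (\<Sum>j\<in>J. t j *\<^sub>R \<eta> j) \<in> seg (\<eta> j) + zonotope J \<eta>"
    by (rule set_plus_intro)
  then show "(\<Sum>j\<in>insert j J. t j *\<^sub>R \<eta> j) \<in> zonotope (insert j J) \<eta>"
    by (simp only: sum.insert[OF insert(1,2)])
qed

text \<open>The right-hand side is the support function of the zonotope at \<open>u\<close>.\<close>

lemma inner_zonotope_le:
  assumes "finite J" "z \<in> zonotope J \<eta>"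
  shows "inner_n n z u \<le> (\<Sum>j\<in>J. \<bar>inner_n n (\<eta> j) u\<bar>)"
  using assms
proof (induction J arbitrary: z rule: finite_induct)
  case empty
  then show ?case by (simp add: set_zero) (simp add: inner_n_def)
next
  case (insert j J)
  from insert.prems obtain t y where ty: "-1 \<le> t" "t \<le> 1" "y \<in> zonotope J \<eta>" "z = t *\<^sub>R \<eta> j + y"
    unfolding zonotope_insert[OF insert(1,2)] by (auto simp: seg_def elim!: set_plus_elim)
  have "inner_n n z u = t * inner_n n (\<eta> j) u + inner_n n y u"
    unfolding ty(4) by (simp only: inner_n_simps)
  also have "t * inner_n n (\<eta> j) u \<le> \<bar>inner_n n (\<eta> j) u\<bar>"
    using ty(1,2) mult_right_mono[of "\<bar>t\<bar>" 1 "\<bar>inner_n n (\<eta> j) u\<bar>"]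
    by (simp add: abs_le_iff[of t] abs_mult[symmetric])
  also have "inner_n n y u \<le> (\<Sum>j\<in>J. \<bar>inner_n n (\<eta> j) u\<bar>)"
    by (rule insert.IH[OF ty(3)])
  finally show ?case
    using insert(1,2) by simp
qed

text \<open>When the segments are added one at a time, each is added to a body containing
  \<open>A\<close>, so it contributes at least its gain over \<open>A\<close>.\<close>

lemma vol_plus_zonotope_ge:
  assumes "finite J" "\<And>j. j \<in> J \<Longrightarrow> \<eta> j \<in> Rn n" "compact_convex n A"
  shows "vol n A + (\<Sum>j\<in>J. seg_gain n A (\<eta> j)) \<le> vol n (A + zonotope J \<eta>)"
  using assms
proof (induction J rule: finite_induct)
  case empty
  show "vol n A + (\<Sum>j\<in>{}. seg_gain n A (\<eta> j)) \<le> vol n (A + zonotope {} \<eta>)"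
    by (simp only: sum.empty add_0_right order_refl)
next
  case (insert j J)
  let ?B = "A + zonotope J \<eta>"
  have B: "compact_convex n ?B"
    using insert by (intro compact_convex_plus compact_convex_zonotope) auto
  have "A \<subseteq> ?B"
    using set_zero_plus2[OF zero_in_zonotope[of \<eta> J], of A] by (simp only: add.commute)
  then have "seg_gain n A (\<eta> j) \<le> seg_gain n ?B (\<eta> j)"
    using insert B by (intro seg_gain_mono) auto
  also have "\<dots> = vol n (A + zonotope (insert j J) \<eta>) - vol n ?B"
    unfolding seg_gain_def zonotope_insert[OF insert(1,2)] by (simp only: ac_simps)
  finally show ?case
    using insert by simp
qed

text \<open>Every partial sum stays inside \<open>A'\<close>, so monotonicity bounds each increment
  by a gain of \<open>A'\<close>.\<close>

lemma vol_plus_zonotope_le: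
  assumes "finite J" "\<And>j. j \<in> J \<Longrightarrow> \<eta> j \<in> Rn n" "compact_convex n A" "compact_convex n A'"
    and "A + zonotope J \<eta> \<subseteq> A'"
  shows "vol n (A + zonotope J \<eta>) \<le> vol n A + (\<Sum>j\<in>J. seg_gain n A' (\<eta> j))"
  using assms
proof (induction J rule: finite_induct)
  case empty
  show "vol n (A + zonotope {} \<eta>) \<le> vol n A + (\<Sum>j\<in>{}. seg_gain n A' (\<eta> j))"
    by (simp only: sum.empty add_0_right order_refl)
next
  case (insert j J)
  let ?B = "A + zonotope J \<eta>"
  have B: "compact_convex n ?B"
    using insert by (intro compact_convex_plus compact_convex_zonotope) auto
  have eq: "A + zonotope (insert j J) \<eta> = seg (\<eta> j) + ?B"
    unfolding zonotope_insert[OF insert(1,2)] by (simp only: ac_simps)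
  have sub: "?B \<subseteq> A'"
    using set_zero_plus2[OF zero_in_seg[of "\<eta> j"], of ?B] insert.prems(4) unfolding eq by (rule order_trans)
  have "vol n (A + zonotope (insert j J) \<eta>) - vol n ?B = seg_gain n ?B (\<eta> j)"
    unfolding eq seg_gain_def by (simp only: ac_simps)
  also have "\<dots> \<le> seg_gain n A' (\<eta> j)"
    using insert B sub by (intro seg_gain_mono) auto
  finally show ?case
    using insert sub by simp
qed

section \<open>Existence of the surface area\<close>

definition area_quotient :: "nat \<Rightarrow> (nat \<Rightarrow> real) set \<Rightarrow> real \<Rightarrow> real" where
  "area_quotient n A \<epsilon> = (vol n (parallel_body n A \<epsilon>) - vol n A) / \<epsilon>"

text \<open>Closeness to the ball, expressed by inclusions that survive scaling and the addition of
  a body. The first alone gives a lower bound for the difference quotient, both together an upper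
  bound.\<close>

definition ball_approx :: "nat \<Rightarrow> real \<Rightarrow> 'j set \<Rightarrow> ('j \<Rightarrow> nat \<Rightarrow> real) \<Rightarrow> bool" where
  "ball_approx n \<delta> J \<eta> \<longleftrightarrow> finite J \<and> (\<forall>j\<in>J. \<eta> j \<in> Rn n) \<and>
     zonotope J \<eta> \<subseteq> (*\<^sub>R) (1 + \<delta>) ` unit_ball n \<and>
     unit_ball n \<subseteq> zonotope J \<eta> + (*\<^sub>R) \<delta> ` unit_ball n"

text \<open>The index type is fixed because a type cannot be quantified here; sequences suffice, as
  the zonotopes will be indexed by grid points.\<close>

definition ball_approximable :: "nat \<Rightarrow> bool" where
  "ball_approximable n \<longleftrightarrow>
     (\<forall>\<delta>>0. \<exists>(J :: (nat \<Rightarrow> real) set) \<eta>. ball_approx n \<delta> J \<eta>)"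

lemma scaleR_unit_ball: "c > 0 \<Longrightarrow> (*\<^sub>R) c ` unit_ball n = {x \<in> Rn n. norm_n n x \<le> c}"
proof safe
  fix x assume c: "c > 0" and x: "x \<in> Rn n" "norm_n n x \<le> c"
  then have "(1 / c) *\<^sub>R x \<in> unit_ball n"
    by (auto simp: unit_ball_def norm_n_scaleR intro!: Rn_scaleR)
  then have "c *\<^sub>R (1 / c) *\<^sub>R x \<in> (*\<^sub>R) c ` unit_ball n"
    by (rule imageI)
  then show "x \<in> (*\<^sub>R) c ` unit_ball n"
    using c by simp
next
  fix x assume c: "c > 0" and x: "x \<in> unit_ball n"
  show "c *\<^sub>R x \<in> Rn n"
    using x by (intro Rn_scaleR) (simp add: unit_ball_def)
  show "norm_n n (c *\<^sub>R x) \<le> c"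
    using x c by (simp add: norm_n_scaleR unit_ball_def)
qed

lemma compact_convex_parallel_body:
  "compact_convex n A \<Longrightarrow> compact_convex n (parallel_body n A \<epsilon>)"
  unfolding parallel_body_eq
  by (intro compact_convex_plus compact_convex_scaleR compact_convex_unit_ball)

lemma area_quotient_ge:
  assumes A: "compact_convex n A" and J: "finite J" "\<And>j. j \<in> J \<Longrightarrow> \<eta> j \<in> Rn n"
    and sub: "zonotope J \<eta> \<subseteq> unit_ball n" and \<epsilon>: "\<epsilon> > 0"
  shows "(\<Sum>j\<in>J. seg_gain n A (\<eta> j)) \<le> area_quotient n A \<epsilon>"
proof -
  have "vol n A + \<epsilon> * (\<Sum>j\<in>J. seg_gain n A (\<eta> j)) = vol n A + (\<Sum>j\<in>J. seg_gain n A (\<epsilon> *\<^sub>R \<eta> j))"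
    using A J \<epsilon> by (simp add: seg_gain_scaleR sum_distrib_left)
  also have "\<dots> \<le> vol n (A + zonotope J (\<lambda>j. \<epsilon> *\<^sub>R \<eta> j))"
    using A J by (intro vol_plus_zonotope_ge Rn_scaleR) auto
  also have "\<dots> \<le> vol n (parallel_body n A \<epsilon>)"
  proof (rule vol_mono)
    show "compact_convex n (A + zonotope J (\<lambda>j. \<epsilon> *\<^sub>R \<eta> j))"
      using A J by (intro compact_convex_plus compact_convex_zonotope Rn_scaleR)
    show "compact_convex n (parallel_body n A \<epsilon>)"
      by (rule compact_convex_parallel_body[OF A])
    show "A + zonotope J (\<lambda>j. \<epsilon> *\<^sub>R \<eta> j) \<subseteq> parallel_body n A \<epsilon>"
      unfolding parallel_body_eq scaleR_zonotope[symmetric]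
      by (intro set_plus_mono2 order_refl image_mono sub)
  qed
  finally show ?thesis
    using \<epsilon> by (simp add: area_quotient_def field_simps)
qed

text \<open>Shrinking the zonotope by 1 / (1 + \<delta>) puts it inside the ball, and by homogeneity
  the gains shrink by the same factor.\<close>

lemma ball_approx_sum_le:
  assumes A: "compact_convex n A" and app: "ball_approx n \<delta> J \<eta>" and \<delta>: "0 < \<delta>" and \<epsilon>: "\<epsilon> > 0"
  shows "(\<Sum>j\<in>J. seg_gain n A (\<eta> j)) \<le> (1 + \<delta>) * area_quotient n A \<epsilon>"
proof -
  have J: "finite J" "\<And>j. j \<in> J \<Longrightarrow> \<eta> j \<in> Rn n" "zonotope J \<eta> \<subseteq> (*\<^sub>R) (1 + \<delta>) ` unit_ball n"
    using app by (auto simp: ball_approx_def)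
  define c where "c = 1 / (1 + \<delta>)"
  have c: "c > 0" "(1 + \<delta>) * c = 1" using \<delta> by (auto simp: c_def)
  have "zonotope J (\<lambda>j. c *\<^sub>R \<eta> j) \<subseteq> (*\<^sub>R) c ` (*\<^sub>R) (1 + \<delta>) ` unit_ball n"
    unfolding scaleR_zonotope[symmetric] by (rule image_mono[OF J(3)])
  also have "\<dots> = unit_ball n"
    using c(2) by (simp add: image_image mult.commute)
  finally have "(\<Sum>j\<in>J. seg_gain n A (c *\<^sub>R \<eta> j)) \<le> area_quotient n A \<epsilon>"
    using J by (intro area_quotient_ge A \<epsilon> Rn_scaleR)
  then have "c * (\<Sum>j\<in>J. seg_gain n A (\<eta> j)) \<le> area_quotient n A \<epsilon>"
    using A J c by (simp add: seg_gain_scaleR sum_distrib_left)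
  then have "(1 + \<delta>) * (c * (\<Sum>j\<in>J. seg_gain n A (\<eta> j))) \<le> (1 + \<delta>) * area_quotient n A \<epsilon>"
    using \<delta> by (intro mult_left_mono) auto
  then show ?thesis
    using c(2) by (simp add: mult.assoc[symmetric])
qed

text \<open>With Z the zonotope, the parallel body lies in A + \<epsilon> Z + \<epsilon> \<delta> B.
  The last summand costs the outer power; measuring gains over A + \<epsilon> Z instead of A costs
  the inner one.\<close>

lemma area_quotient_le:
  assumes A: "compact_convex n A" and x: "has_inball n A x r"
    and app: "ball_approx n \<delta> J \<eta>" and \<delta>: "0 < \<delta>" "\<delta> \<le> 1" and \<epsilon>: "\<epsilon> > 0"
  defines "D \<equiv> (\<Sum>j\<in>J. seg_gain n A (\<eta> j))"
  shows "area_quotient n A \<epsilon>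
    \<le> ((1 + \<epsilon> * \<delta> / r) ^ n * (vol n A + \<epsilon> * ((1 + \<epsilon> * 2 / r) ^ n * D)) - vol n A) / \<epsilon>"
proof -
  have J: "finite J" "\<And>j. j \<in> J \<Longrightarrow> \<eta> j \<in> Rn n" "zonotope J \<eta> \<subseteq> (*\<^sub>R) (1 + \<delta>) ` unit_ball n"
    "unit_ball n \<subseteq> zonotope J \<eta> + (*\<^sub>R) \<delta> ` unit_ball n"
    using app by (auto simp: ball_approx_def)
  have r: "r > 0" using x by (simp add: has_inball_def)
  let ?Z = "zonotope J (\<lambda>j. \<epsilon> *\<^sub>R \<eta> j)"
  have Z: "compact_convex n ?Z"
    using J by (intro compact_convex_zonotope Rn_scaleR)
  have AZ: "compact_convex n (A + ?Z)"
    by (intro compact_convex_plus A Z)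
  have "A \<subseteq> A + ?Z"
    using set_zero_plus2[OF zero_in_zonotope[of "\<lambda>j. \<epsilon> *\<^sub>R \<eta> j" J], of A] by (simp only: add.commute)
  then have AZ_in: "has_inball n (A + ?Z) x r"
    by (rule has_inball_mono[OF x])
  have "(*\<^sub>R) \<epsilon> ` unit_ball n \<subseteq> (*\<^sub>R) \<epsilon> ` (zonotope J \<eta> + (*\<^sub>R) \<delta> ` unit_ball n)"
    by (rule image_mono[OF J(4)])
  also have "\<dots> = ?Z + (*\<^sub>R) (\<epsilon> * \<delta>) ` unit_ball n"
    by (simp add: set_plus_scaleR_image scaleR_zonotope image_image)
  finally have "parallel_body n A \<epsilon> \<subseteq> A + ?Z + (*\<^sub>R) (\<epsilon> * \<delta>) ` unit_ball n"
    unfolding parallel_body_eq add.assoc by (intro set_plus_mono2 order_refl)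
  then have "vol n (parallel_body n A \<epsilon>) \<le> vol n (A + ?Z + (*\<^sub>R) (\<epsilon> * \<delta>) ` unit_ball n)"
    by (intro vol_mono compact_convex_parallel_body A compact_convex_plus[OF AZ]
        compact_convex_scaleR compact_convex_unit_ball)
  also have "\<dots> \<le> (1 + \<epsilon> * \<delta> / r) ^ n * vol n (A + ?Z)"
    using \<epsilon> \<delta> by (intro vol_plus_le[OF AZ AZ_in] compact_convex_scaleR compact_convex_unit_ball) auto
  also have "vol n (A + ?Z) \<le> vol n A + (\<Sum>j\<in>J. seg_gain n (A + ?Z) (\<epsilon> *\<^sub>R \<eta> j))"
    using J by (intro vol_plus_zonotope_le A AZ Rn_scaleR order_refl) auto
  also have "\<dots> = vol n A + \<epsilon> * (\<Sum>j\<in>J. seg_gain n (A + ?Z) (\<eta> j))"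
    using J \<epsilon> by (simp add: seg_gain_scaleR[OF AZ] sum_distrib_left)
  also have "(\<Sum>j\<in>J. seg_gain n (A + ?Z) (\<eta> j)) \<le> (\<Sum>j\<in>J. (1 + \<epsilon> * 2 / r) ^ n * seg_gain n A (\<eta> j))"
  proof (rule sum_mono)
    fix j assume j: "j \<in> J"
    have "?Z = (*\<^sub>R) \<epsilon> ` zonotope J \<eta>"
      by (rule scaleR_zonotope[symmetric])
    also have "\<dots> \<subseteq> (*\<^sub>R) \<epsilon> ` (*\<^sub>R) (1 + \<delta>) ` unit_ball n"
      by (rule image_mono[OF J(3)])
    also have "\<dots> = {x \<in> Rn n. norm_n n x \<le> \<epsilon> * (1 + \<delta>)}"
      unfolding scaleR_unit_ball[of "\<epsilon> * (1 + \<delta>)" n, symmetric, OF mult_pos_pos[OF \<epsilon> add_pos_pos[OF zero_less_one \<delta>(1)]]]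
      by (simp add: image_image)
    \<comment> \<open>Bounding 1 + \<delta> by 2 keeps the inner dilation factor independent of
      \<delta>.\<close>
    also have "\<dots> \<subseteq> {x \<in> Rn n. norm_n n x \<le> \<epsilon> * 2}"
      using \<epsilon> \<delta> mult_left_mono[of "1 + \<delta>" 2 \<epsilon>] by (auto intro: order_trans)
    also have "\<dots> = (*\<^sub>R) (\<epsilon> * 2) ` unit_ball n"
      using \<epsilon> by (intro scaleR_unit_ball[symmetric]) simp
    finally show "seg_gain n (A + ?Z) (\<eta> j) \<le> (1 + \<epsilon> * 2 / r) ^ n * seg_gain n A (\<eta> j)"
      using \<epsilon> J j by (intro seg_gain_plus_le[OF A x] Z) auto
  qed
  also have "\<dots> = (1 + \<epsilon> * 2 / r) ^ n * D"
    by (simp add: D_def sum_distrib_left)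
  finally have "vol n (parallel_body n A \<epsilon>)
      \<le> (1 + \<epsilon> * \<delta> / r) ^ n * (vol n A + \<epsilon> * ((1 + \<epsilon> * 2 / r) ^ n * D))"
    using \<epsilon> \<delta> r by (simp add: mult_left_mono)
  then show ?thesis
    using \<epsilon> by (simp add: area_quotient_def divide_right_mono)
qed

text \<open>The expression is the difference quotient at 0 of a polynomial in \<epsilon>, so its
  limit is a derivative.\<close>

lemma area_quotient_bound_tendsto:
  fixes V D \<delta> r :: real
  assumes "r > 0"
  shows "((\<lambda>\<epsilon>. ((1 + \<epsilon> * \<delta> / r) ^ n * (V + \<epsilon> * ((1 + \<epsilon> * 2 / r) ^ n * D)) - V) / \<epsilon>)
    \<longlongrightarrow> real n * (\<delta> / r) * V + D) (at_right 0)"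
proof -
  let ?F = "\<lambda>\<epsilon>. (1 + \<epsilon> * \<delta> / r) ^ n * (V + \<epsilon> * ((1 + \<epsilon> * 2 / r) ^ n * D))"
  have "(?F has_real_derivative real n * (\<delta> / r) * V + D) (at 0)"
    using assms by (auto intro!: derivative_eq_intros)
  then have "((\<lambda>\<epsilon>. (?F \<epsilon> - ?F 0) / (\<epsilon> - 0)) \<longlongrightarrow> real n * (\<delta> / r) * V + D) (at 0)"
    by (simp add: has_field_derivative_iff)
  then show ?thesis
    by (auto intro: tendsto_mono[OF at_le[of "{0<..}" UNIV]] simp: at_eq_sup_left_right filterlim_sup)
qed

text \<open>
  Sandwiching the ball between zonotopes sandwiches the difference quotient between quantities
  that are linear in \<open>\<epsilon>\<close> to first order.
\<close>

theorem surface_area_exists: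
  assumes A: "compact_convex n A" and x: "has_inball n A x r" and app: "ball_approximable n"
  shows "(area_quotient n A \<longlongrightarrow> surface_area n A) (at_right 0)"
    and "\<epsilon> > 0 \<Longrightarrow> surface_area n A \<le> area_quotient n A \<epsilon>"
proof -
  have r: "r > 0" using x by (simp add: has_inball_def)
  \<comment> \<open>With the infimum as candidate for the limit the second claim is immediate, and
    convergence needs only an eventual upper bound.\<close>
  define L where "L = (INF \<epsilon>\<in>{0<..}. area_quotient n A \<epsilon>)"
  have nonneg: "0 \<le> area_quotient n A \<epsilon>" if "\<epsilon> > 0" for \<epsilon>
    using area_quotient_ge[OF A, of "{}" "\<lambda>_. 0" \<epsilon>] that zero_in_unit_ball by simp
  have bdd: "bdd_below (area_quotient n A ` {0<..})"
    using nonneg by (auto intro!: bdd_belowI2[of _ 0])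
  have L_le: "L \<le> area_quotient n A \<epsilon>" if "\<epsilon> > 0" for \<epsilon>
    unfolding L_def using bdd that by (intro cINF_lower) auto
  have L_nonneg: "0 \<le> L"
    unfolding L_def using nonneg by (intro cINF_greatest) auto
  have "(area_quotient n A \<longlongrightarrow> L) (at_right 0)"
  proof (rule tendstoI)
    fix e :: real assume e: "e > 0"
    \<comment> \<open>Once \<open>D \<le> (1 + \<delta>) * L\<close> is known, the limit of the
      upper bound is at most L + \<delta> (C - 1). The summand 1 keeps \<open>C\<close>
      positive.\<close>
    define C where "C = real n / r * vol n A + L + 1"
    have C: "C > 0"
      unfolding C_def using r L_nonneg by (intro add_nonneg_pos add_nonneg_nonneg mult_nonneg_nonneg) auto
    define \<delta> where "\<delta> = min 1 (e / (2 * C))"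
    have \<delta>: "0 < \<delta>" "\<delta> \<le> 1" "\<delta> * C < e"
    proof -
      have "\<delta> * C \<le> e / (2 * C) * C"
        unfolding \<delta>_def using C by (intro mult_right_mono) auto
      then show "\<delta> * C < e" using C e by simp
    qed (use e C in \<open>auto simp: \<delta>_def\<close>)
    obtain J :: "(nat \<Rightarrow> real) set" and \<eta> where J: "ball_approx n \<delta> J \<eta>"
      using app \<delta>(1) unfolding ball_approximable_def by blast
    define D where "D = (\<Sum>j\<in>J. seg_gain n A (\<eta> j))"
    have "D / (1 + \<delta>) \<le> L"
      unfolding L_def
      using ball_approx_sum_le[OF A J \<delta>(1)] \<delta>(1)
      by (intro cINF_greatest) (auto simp: D_def field_simps)
    then have "D \<le> (1 + \<delta>) * L"
      using \<delta>(1) by (simp add: field_simps)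
    then have "real n * (\<delta> / r) * vol n A + D < L + e"
    proof -
      have "real n * (\<delta> / r) * vol n A + D \<le> L + \<delta> * C - \<delta>"
        using \<open>D \<le> (1 + \<delta>) * L\<close> by (simp add: C_def algebra_simps)
      then show ?thesis using \<delta> by linarith
    qed
    then have "\<forall>\<^sub>F \<epsilon> in at_right 0.
        ((1 + \<epsilon> * \<delta> / r) ^ n * (vol n A + \<epsilon> * ((1 + \<epsilon> * 2 / r) ^ n * D)) - vol n A) / \<epsilon> < L + e"
      by (rule order_tendstoD(2)[OF area_quotient_bound_tendsto[OF r]])
    moreover have "\<forall>\<^sub>F \<epsilon> in at_right (0::real). \<epsilon> > 0"
      by (rule eventually_at_right_less)
    ultimately show "\<forall>\<^sub>F \<epsilon> in at_right 0. dist (area_quotient n A \<epsilon>) L < e"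
    proof eventually_elim
      case (elim \<epsilon>)
      then show ?case
        using area_quotient_le[OF A x J \<delta>(1,2), of \<epsilon>] L_le[of \<epsilon>]
        by (simp add: D_def dist_real_def)
    qed
  qed
  moreover from this have "surface_area n A = L"
    unfolding surface_area_def area_quotient_def by (intro tendsto_Lim) auto
  ultimately show "(area_quotient n A \<longlongrightarrow> surface_area n A) (at_right 0)"
    and "\<epsilon> > 0 \<Longrightarrow> surface_area n A \<le> area_quotient n A \<epsilon>"
    using L_le by simp_all
qed

lemma surface_area_ge:
  assumes "compact_convex n A" "has_inball n A x r" "ball_approximable n"
    and "finite J" "\<And>j. j \<in> J \<Longrightarrow> \<eta> j \<in> Rn n" "zonotope J \<eta> \<subseteq> unit_ball n"
  shows "(\<Sum>j\<in>J. seg_gain n A (\<eta> j)) \<le> surface_area n A"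
proof (rule tendsto_lowerbound[OF surface_area_exists(1)[OF assms(1-3)]])
  show "\<forall>\<^sub>F \<epsilon> in at_right 0. (\<Sum>j\<in>J. seg_gain n A (\<eta> j)) \<le> area_quotient n A \<epsilon>"
    using eventually_at_right_less[of "0::real"]
    by eventually_elim (use assms area_quotient_ge in blast)
qed simp

text \<open>The upper bound for the quotient, in the limit of \<epsilon> tending to 0. The error of
  the zonotope survives as a multiple of \<delta>, to be removed along a sequence of
  zonotopes.\<close>

lemma surface_area_le:
  assumes "compact_convex n A" "has_inball n A x r" "ball_approximable n"
    and "ball_approx n \<delta> J \<eta>" "0 < \<delta>" "\<delta> \<le> 1"
  shows "surface_area n A \<le> real n * (\<delta> / r) * vol n A + (\<Sum>j\<in>J. seg_gain n A (\<eta> j))"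
proof (rule tendsto_lowerbound[OF area_quotient_bound_tendsto])
  show "r > 0"
    using assms(2) by (simp add: has_inball_def)
  show "\<forall>\<^sub>F \<epsilon> in at_right 0. surface_area n A \<le> ((1 + \<epsilon> * \<delta> / r) ^ n *
      (vol n A + \<epsilon> * ((1 + \<epsilon> * 2 / r) ^ n * (\<Sum>j\<in>J. seg_gain n A (\<eta> j)))) - vol n A) / \<epsilon>"
    using eventually_at_right_less[of "0::real"]
  proof eventually_elim
    case (elim \<epsilon>)
    show ?case
      using surface_area_exists(2)[OF assms(1-3) elim] area_quotient_le[OF assms(1,2,4-6) elim]
      by linarith
  qed
qed simp

section \<open>Slices, a Loomis-Whitney inequality and an isoperimetric bound of the right
  order\<close>

section \<open>The isoperimetric inequality\<close>

definition slice :: "nat \<Rightarrow> (nat \<Rightarrow> real) set \<Rightarrow> real \<Rightarrow> (nat \<Rightarrow> real) set" where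
  "slice n A t = {x \<in> Rn n. x(n := t) \<in> A}"

text \<open>Writing a slice as a linear image of a hyperplane section transfers compactness and
  convexity to it.\<close>

lemma slice_eq:
  assumes "A \<subseteq> Rn (Suc n)"
  shows "slice n A t = frame (Suc n) n axis_n ` (A \<inter> {y. y n = t})"
proof (intro subset_antisym subsetI)
  fix x assume x: "x \<in> slice n A t"
  then have "x = frame (Suc n) n axis_n (x(n := t))"
    by (auto simp: slice_def fun_eq_iff frame_axis_n mem_Rn)
  then show "x \<in> frame (Suc n) n axis_n ` (A \<inter> {y. y n = t})"
    using x by (intro image_eqI[of _ _ "x(n := t)"]) (auto simp: slice_def)
next
  fix x assume "x \<in> frame (Suc n) n axis_n ` (A \<inter> {y. y n = t})"
  then obtain y where y: "y \<in> A" "y n = t" "x = frame (Suc n) n axis_n y"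
    by blast
  have "x(n := t) = y"
    using y assms by (auto simp: fun_eq_iff frame_axis_n mem_Rn)
  then show "x \<in> slice n A t"
    using y by (simp add: slice_def frame_Rn)
qed

lemma compact_convex_slice:
  assumes A: "compact_convex (Suc n) A"
  shows "compact_convex n (slice n A t)"
proof -
  have "closed {y :: nat \<Rightarrow> real. y n = t}"
    by (intro closed_Collect_eq continuous_on_const continuous_on_product_coordinates)
  moreover have "convex {y :: nat \<Rightarrow> real. y n = t}"
  proof (rule convexI)
    fix x y :: "nat \<Rightarrow> real" and u v :: real
    assume "x \<in> {y. y n = t}" "y \<in> {y. y n = t}" and uv: "u + v = 1"
    then have "(u *\<^sub>R x + v *\<^sub>R y) n = (u + v) * t"
      unfolding distrib_right by simp
    then show "u *\<^sub>R x + v *\<^sub>R y \<in> {y. y n = t}"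
      by (simp only: uv mult_1 mem_Collect_eq)
  qed
  ultimately have "compact_convex (Suc n) (A \<inter> {y. y n = t})"
    using compact_convexD[OF A] unfolding compact_convex_def
    by (intro conjI compact_Int_closed convex_Int le_infI1)
  then show ?thesis
    unfolding slice_eq[OF compact_convexD(3)[OF A]] by (rule compact_convex_frame)
qed

lemma slice_subset_frame:
  "A \<subseteq> Rn (Suc n) \<Longrightarrow> slice n A t \<subseteq> frame (Suc n) n axis_n ` A"
  by (auto simp: slice_eq)

text \<open>A segment along one of the first n axes is parallel to the slicing hyperplanes. Hence
  the gains of \<open>A\<close> in these directions can be computed slice by slice.\<close>

lemma slice_plus_seg:
  assumes "A \<subseteq> Rn (Suc n)" "i < n"
  shows "slice n (A + seg (axis_n i)) t = slice n A t + seg (axis_n i)"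
proof (intro subset_antisym subsetI)
  fix x assume x: "x \<in> slice n (A + seg (axis_n i)) t"
  then obtain a s where a: "a \<in> A" "-1 \<le> s" "s \<le> 1" "x(n := t) = a + s *\<^sub>R axis_n i"
    by (auto simp: slice_def seg_def elim!: set_plus_elim)
  have "((x - s *\<^sub>R axis_n i)(n := t)) j = a j" for j
    using fun_cong[OF a(4), of j] assms(2) by (auto simp: axis_n_def split: if_splits)
  then have "(x - s *\<^sub>R axis_n i)(n := t) = a"
    by (rule ext)
  moreover have "x - s *\<^sub>R axis_n i \<in> Rn n"
    using x assms(2) by (intro Rn_diff Rn_scaleR) (auto simp: slice_def)
  ultimately have "x - s *\<^sub>R axis_n i \<in> slice n A t"
    using a(1) by (simp add: slice_def)
  moreover have "s *\<^sub>R axis_n i \<in> seg (axis_n i)"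
    using a by (auto simp: seg_def)
  ultimately have "x - s *\<^sub>R axis_n i + s *\<^sub>R axis_n i \<in> slice n A t + seg (axis_n i)"
    by (rule set_plus_intro)
  then show "x \<in> slice n A t + seg (axis_n i)"
    by simp
next
  fix x assume "x \<in> slice n A t + seg (axis_n i)"
  then obtain y s where y: "y \<in> slice n A t" "-1 \<le> s" "s \<le> 1" "x = y + s *\<^sub>R axis_n i"
    by (auto simp: seg_def elim!: set_plus_elim)
  have "s *\<^sub>R axis_n i \<in> seg (axis_n i)"
    using y by (auto simp: seg_def)
  then have "y(n := t) + s *\<^sub>R axis_n i \<in> A + seg (axis_n i)"
    using y(1) by (intro set_plus_intro) (auto simp: slice_def)
  moreover have "x(n := t) = y(n := t) + s *\<^sub>R axis_n i"
    using assms(2) by (auto simp: y(4) fun_eq_iff axis_n_def)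
  moreover have "x \<in> Rn n"
    using y assms(2) by (auto simp: slice_def intro!: Rn_add Rn_scaleR)
  ultimately show "x \<in> slice n (A + seg (axis_n i)) t"
    by (simp add: slice_def)
qed

lemma vol_eq_nn_integral_slice:
  assumes A: "compact_convex (Suc n) A"
  shows "(\<lambda>t. ennreal (vol n (slice n A t))) \<in> borel_measurable lborel"
    and "ennreal (vol (Suc n) A) = (\<integral>\<^sup>+t. ennreal (vol n (slice n A t)) \<partial>lborel)"
proof -
  have [measurable]: "A \<in> sets borel"
    by (rule compact_convex_measurable[OF A])
  have set: "{x. x(n := t) \<in> A} \<in> sets borel" for t
  proof -
    have "(\<lambda>x. x(n := t)) -` A \<inter> space borel \<in> sets borel"
      by measurable
    then show ?thesis by (simp add: vimage_def)
  qed
  have eq: "emeasure (lborel_n n) {x. x(n := t) \<in> A} = ennreal (vol n (slice n A t))" for t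
  proof -
    have "emeasure (lborel_n n) {x. x(n := t) \<in> A} = emeasure (lborel_n n) (slice n A t)"
      using AE_lborel_n_Rn[of n] set compact_convex_measurable[OF compact_convex_slice[OF A]]
      by (intro emeasure_eq_AE) (auto simp: slice_def)
    then show ?thesis
      by (simp add: emeasure_eq_vol[OF compact_convex_slice[OF A]])
  qed
  have "(\<lambda>p. (snd p)(n := fst p)) -` A \<inter> space (lborel \<Otimes>\<^sub>M lborel_n n) \<in> sets (lborel \<Otimes>\<^sub>M lborel_n n)"
    by measurable
  from sigma_finite_measure.measurable_emeasure_Pair[OF sigma_finite_lborel_n this]
  show "(\<lambda>t. ennreal (vol n (slice n A t))) \<in> borel_measurable lborel"
    by (simp add: space_pair_measure vimage_def eq)
  show "ennreal (vol (Suc n) A) = (\<integral>\<^sup>+t. ennreal (vol n (slice n A t)) \<partial>lborel)"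
    unfolding eq[symmetric] emeasure_eq_vol[OF A, symmetric] by (rule emeasure_lborel_n_Suc) measurable
qed

lemma vol_0_singleton: "vol 0 {0} = 1"
proof -
  have "emeasure (lborel_n 0) {0} = (\<integral>\<^sup>+x. indicator {0} x \<partial>lborel_n 0)"
    by simp
  also have "\<dots> = 1"
    by (subst nn_integral_lborel_n_0) auto
  finally show ?thesis by (simp add: measure_def)
qed

text \<open>For positive \<open>a\<close> the right-hand side is
  \<open>a * a powr (- 1 / k)\<close>, and negative powers decrease. The bound trades a concave
  power for a function linear in \<open>a\<close>; it serves for slices and, at the end, for
  projections.\<close>

lemma mult_powr_minus_le:
  fixes a M k :: real
  assumes "0 \<le> a" "a \<le> M" "k > 0"
  shows "a * M powr (- 1 / k) \<le> a powr ((k - 1) / k)"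
proof (cases "a = 0")
  case False
  then have a: "a > 0"
    using assms by simp
  have "a * M powr (- 1 / k) \<le> a * a powr (- 1 / k)"
    using a assms by (intro mult_left_mono powr_mono2') auto
  also have "\<dots> = a powr (1 + - 1 / k)"
    using a by (simp only: powr_add) simp
  also have "1 + - 1 / k = (k - 1) / k"
    using assms by (simp add: field_simps)
  finally show ?thesis .
qed simp

text \<open>
  A form of the Loomis-Whitney inequality, by induction on the dimension. A slice \<open>A\<^sub>t\<close> has volume
  at most \<open>M\<close>, the volume of the projection of \<open>A\<close> along the last axis, hence
  \<open>|A\<^sub>t| powr ((n - 1) / n) \<ge> |A\<^sub>t| * M powr (- 1 / n)\<close>. This can be integrated over \<open>t\<close>, and weighted
  AM-GM concludes.
\<close>

theorem sum_seg_gain_axis_ge: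
  assumes "n \<ge> 1" "compact_convex n A"
  shows "2 * real n * vol n A powr ((real n - 1) / real n) \<le> (\<Sum>i<n. seg_gain n A (axis_n i))"
  using assms
proof (induction n arbitrary: A rule: nat_induct_at_least)
  case base
  \<comment> \<open>Only an inequality, because \<open>0 powr 0 = 0\<close>.\<close>
  have "vol 1 A powr 0 \<le> 1" by simp
  moreover have "2 * vol 1 A powr 0 \<le> seg_gain 1 A (axis_n 0)"
  proof (cases "A = {}")
    case True
    then show ?thesis by (simp add: seg_gain_def)
  next
    case False
    then obtain a where "a \<in> A" by blast
    then have "frame (Suc 0) 0 axis_n ` A = {0}"
      by (auto simp: frame_def fun_eq_iff)
    then have "seg_gain 1 A (axis_n 0) = 2"
      using vol_plus_seg_axis[of 0 A 1] base by (simp add: seg_gain_def vol_0_singleton)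
    then show ?thesis using \<open>vol 1 A powr 0 \<le> 1\<close> by simp
  qed
  ultimately show ?case by simp
next
  case (Suc n)
  note A = Suc.prems
  have n: "n \<ge> 1" by fact
  have gain_nonneg: "0 \<le> seg_gain (Suc n) A (axis_n i)" if "i < Suc n" for i
    using that by (intro seg_gain_nonneg A axis_n_Rn)
  show ?case
  proof (cases "vol (Suc n) A = 0")
    case True
    then show ?thesis
      using sum_nonneg[of "{..<Suc n}" "\<lambda>i. seg_gain (Suc n) A (axis_n i)"] gain_nonneg
      by (simp del: sum.lessThan_Suc)
  next
    case False
    define V where "V = vol (Suc n) A"
    define M where "M = vol n (frame (Suc n) n axis_n ` A)"
    define a where "a t = vol n (slice n A t)" for t
    have V: "V > 0" using False by (simp add: V_def order_less_le)
    have a_le: "a t \<le> M" for t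
      unfolding a_def M_def using A compact_convexD(3)[OF A]
      by (intro vol_mono compact_convex_slice compact_convex_frame[of "Suc n"] slice_subset_frame)
    have M: "M > 0"
    proof (rule ccontr)
      assume "\<not> M > 0"
      then have "a t = 0" for t
        using a_le[of t] measure_nonneg[of "lborel_n n" "slice n A t"] unfolding a_def by linarith
      then have "ennreal V = 0"
        using vol_eq_nn_integral_slice(2)[OF A] by (simp add: a_def V_def)
      then show False using V by simp
    qed
    \<comment> \<open>The linearized induction hypothesis says that the gains of a slice along the
      axes add up to at least \<kappa> times its volume.\<close>
    define \<kappa> where "\<kappa> = 2 * real n * M powr (- 1 / real n)"
    have \<kappa>: "\<kappa> \<ge> 0" by (simp add: \<kappa>_def)
    have Ai: "compact_convex (Suc n) (A + seg (axis_n i))" if "i < n" for i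
      using that by (intro compact_convex_plus A compact_convex_seg axis_n_Rn) simp
    \<comment> \<open>Stated with volumes of sums instead of gains, so that no differences occur
      under the nonnegative integral over \<open>t\<close>.\<close>
    have slice_ineq: "(real n + \<kappa>) * a t \<le> (\<Sum>i<n. vol n (slice n (A + seg (axis_n i)) t))" for t
    proof -
      have "a t * M powr (- 1 / real n) \<le> a t powr ((real n - 1) / real n)"
        using a_le[of t] n by (intro mult_powr_minus_le) (auto simp: a_def)
      then have "\<kappa> * a t \<le> 2 * real n * a t powr ((real n - 1) / real n)"
        using n by (simp add: \<kappa>_def mult.assoc mult.commute[of _ "a t"])
      also have "\<dots> \<le> (\<Sum>i<n. seg_gain n (slice n A t) (axis_n i))"
        unfolding a_def by (rule Suc.IH[OF compact_convex_slice[OF A]])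
      also have "\<dots> = (\<Sum>i<n. vol n (slice n (A + seg (axis_n i)) t)) - real n * a t"
        using compact_convexD(3)[OF A]
        by (simp add: seg_gain_def a_def sum_subtractf slice_plus_seg)
      finally show ?thesis by (simp add: algebra_simps)
    qed
    have "ennreal ((real n + \<kappa>) * V) = ennreal (real n + \<kappa>) * (\<integral>\<^sup>+t. ennreal (a t) \<partial>lborel)"
      using \<kappa> V vol_eq_nn_integral_slice(2)[OF A] by (simp add: ennreal_mult a_def V_def)
    also have "\<dots> = (\<integral>\<^sup>+t. ennreal ((real n + \<kappa>) * a t) \<partial>lborel)"
      using \<kappa> vol_eq_nn_integral_slice(1)[OF A]
      by (subst nn_integral_cmult[symmetric]) (simp_all add: a_def ennreal_mult)
    also have "\<dots> \<le> (\<integral>\<^sup>+t. ennreal (\<Sum>i<n. vol n (slice n (A + seg (axis_n i)) t)) \<partial>lborel)"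
      by (intro nn_integral_mono ennreal_leI slice_ineq)
    also have "\<dots> = (\<integral>\<^sup>+t. (\<Sum>i<n. ennreal (vol n (slice n (A + seg (axis_n i)) t))) \<partial>lborel)"
      by simp
    also have "\<dots> = (\<Sum>i<n. ennreal (vol (Suc n) (A + seg (axis_n i))))"
      using vol_eq_nn_integral_slice[OF Ai] by (subst nn_integral_sum) auto
    also have "\<dots> = ennreal (\<Sum>i<n. vol (Suc n) (A + seg (axis_n i)))"
      by simp
    finally have "(real n + \<kappa>) * V \<le> (\<Sum>i<n. vol (Suc n) (A + seg (axis_n i)))"
      by (simp add: sum_nonneg)
    then have "\<kappa> * V \<le> (\<Sum>i<n. seg_gain (Suc n) A (axis_n i))"
      by (simp add: seg_gain_def sum_subtractf V_def algebra_simps)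
    moreover have "seg_gain (Suc n) A (axis_n n) = 2 * M"
      using vol_plus_seg_axis[OF A, of 1] by (simp add: seg_gain_def M_def)
    ultimately have *: "2 * M + \<kappa> * V \<le> (\<Sum>i<Suc n. seg_gain (Suc n) A (axis_n i))"
      by simp
    \<comment> \<open>Weights with sum 1, chosen so that the powers of \<open>M\<close> cancel in
      the weighted geometric mean of \<open>M\<close> and \<open>V * M powr (- 1 / real n)\<close>,
      leaving the required power of \<open>V\<close>.\<close>
    let ?\<alpha> = "1 / real (Suc n)" and ?\<beta> = "real n / real (Suc n)"
    have "V powr ?\<beta> = M powr ?\<alpha> * (V * M powr (- 1 / real n)) powr ?\<beta>"
    proof -
      have "(- 1 / real n) * ?\<beta> = - ?\<alpha>"
        using n by (simp add: field_simps)
      then have "(M powr (- 1 / real n)) powr ?\<beta> = M powr (- ?\<alpha>)"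
        by (simp only: powr_powr)
      then have "M powr ?\<alpha> * (V * M powr (- 1 / real n)) powr ?\<beta> = V powr ?\<beta> * (M powr ?\<alpha> * M powr (- ?\<alpha>))"
        using V M by (simp only: powr_mult) (simp only: mult_ac)
      also have "M powr ?\<alpha> * M powr (- ?\<alpha>) = 1"
        using M by (simp add: powr_minus)
      finally show ?thesis by simp
    qed
    also have "\<dots> \<le> ?\<alpha> * M + ?\<beta> * (V * M powr (- 1 / real n))"
      using V M by (intro Youngs_inequality_0) (auto simp: field_simps)
    finally have "2 * real (Suc n) * V powr ?\<beta> \<le> 2 * real (Suc n) * (?\<alpha> * M + ?\<beta> * (V * M powr (- 1 / real n)))"
      by (intro mult_left_mono) auto
    also have "\<dots> = 2 * M + \<kappa> * V"
    proof -
      have "2 * N * (1 / N * M + k / N * W) = 2 * M + 2 * k * W" if "N \<noteq> 0" for N k W :: real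
        using that by (simp add: field_simps)
      from this[of "real (Suc n)" "real n" "V * M powr (- 1 / real n)"]
      show ?thesis by (simp add: \<kappa>_def mult_ac del: of_nat_Suc)
    qed
    also note *
    finally show ?thesis by (simp add: V_def)
  qed
qed

text \<open>The inscribed cube has half side c = 1 / sqrt n, so homogeneity turns the factor 2 n for
  unit axis vectors into 2 n c = 2 sqrt n.\<close>

theorem isoperimetric:
  assumes n: "n \<ge> 1" and A: "compact_convex n A" "has_inball n A x r" "ball_approximable n"
  shows "2 * sqrt (real n) * vol n A powr ((real n - 1) / real n) \<le> surface_area n A"
proof -
  define c where "c = 1 / sqrt (real n)"
  have c: "c > 0" "c * real n = sqrt (real n)" "real n * c\<^sup>2 = 1"
    using n by (auto simp: c_def real_div_sqrt power_divide)
  have "zonotope {..<n} (\<lambda>i. c *\<^sub>R axis_n i) \<subseteq> unit_ball n"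
  proof
    fix z assume z: "z \<in> zonotope {..<n} (\<lambda>i. c *\<^sub>R axis_n i)"
    have "compact_convex n (zonotope {..<n} (\<lambda>i. c *\<^sub>R axis_n i))"
      by (intro compact_convex_zonotope Rn_scaleR axis_n_Rn) simp
    then have zR: "z \<in> Rn n"
      using z compact_convexD(3) by blast
    \<comment> \<open>The support function of the cube at the positive and negative axis vectors
      bounds the coordinates of \<open>z\<close> by \<open>c\<close>; then n c^2 = 1 bounds its norm
      by 1.\<close>
    have le: "inner_n n z (s *\<^sub>R axis_n i) \<le> c" if "i < n" "\<bar>s\<bar> = 1" for i s
    proof -
      have "inner_n n z (s *\<^sub>R axis_n i) \<le> (\<Sum>j<n. \<bar>inner_n n (c *\<^sub>R axis_n j) (s *\<^sub>R axis_n i)\<bar>)"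
        using z by (intro inner_zonotope_le) auto
      also have "\<dots> = (\<Sum>j<n. if j = i then c else 0)"
      proof (intro sum.cong refl)
        fix j
        have "inner_n n (axis_n j) (axis_n i) = (if j = i then 1 else 0)"
          unfolding inner_n_axis_n[OF that(1)] by (simp add: axis_n_def)
        then show "\<bar>inner_n n (c *\<^sub>R axis_n j) (s *\<^sub>R axis_n i)\<bar> = (if j = i then c else 0)"
          using that c by (simp add: inner_n_simps abs_mult)
      qed
      finally show ?thesis using that by simp
    qed
    have "\<bar>z i\<bar> \<le> c" if "i < n" for i
      using le[OF that, of 1] le[OF that, of "-1"]
      unfolding inner_n_scaleR_right inner_n_axis_n[OF that] by (simp add: abs_le_iff)
    then have "(z i)\<^sup>2 \<le> c\<^sup>2" if "i < n" for i
      using that power_mono[of "\<bar>z i\<bar>" c 2] by simp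
    then have "(\<Sum>i<n. (z i)\<^sup>2) \<le> (\<Sum>i<n. c\<^sup>2)"
      by (intro sum_mono) auto
    then have "inner_n n z z \<le> 1"
      using c(3) by (simp add: inner_n_def power2_eq_square)
    then show "z \<in> unit_ball n"
      using zR by (simp add: unit_ball_def norm_n_def)
  qed
  then have "(\<Sum>i<n. seg_gain n A (c *\<^sub>R axis_n i)) \<le> surface_area n A"
    using A by (intro surface_area_ge Rn_scaleR) auto
  then have "c * (\<Sum>i<n. seg_gain n A (axis_n i)) \<le> surface_area n A"
    using A c by (simp add: seg_gain_scaleR sum_distrib_left)
  moreover have "c * (2 * real n * vol n A powr ((real n - 1) / real n)) \<le> c * (\<Sum>i<n. seg_gain n A (axis_n i))"
    using sum_seg_gain_axis_ge[OF n A(1)] c(1) by (intro mult_left_mono) auto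
  moreover have "c * (2 * real n * vol n A powr ((real n - 1) / real n))
      = 2 * sqrt (real n) * vol n A powr ((real n - 1) / real n)"
    using c(2) by (simp add: mult.assoc[symmetric] mult.commute[of c])
  ultimately show ?thesis by linarith
qed

section \<open>Moments of the invariant measure and zonotopes close to the ball\<close>

section \<open>The rotation invariant measure on the sphere\<close>

lemma unit_sphereD: "\<xi> \<in> unit_sphere n \<Longrightarrow> \<xi> \<in> Rn n" "\<xi> \<in> unit_sphere n \<Longrightarrow> norm_n n \<xi> = 1"
  by (simp_all add: unit_sphere_def)

lemma borel_measurable_inner_n [measurable]: "(\<lambda>x. inner_n n x u) \<in> borel_measurable borel"
  unfolding inner_n_def by measurable

text \<open>The choice of the axis is immaterial: for invariant \<sigma> every unit vector gives the
  same mean.\<close>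

definition mean_abs :: "nat \<Rightarrow> (nat \<Rightarrow> real) measure \<Rightarrow> real" where
  "mean_abs n \<sigma> = (LINT \<xi>|\<sigma>. \<bar>inner_n n \<xi> (axis_n 0)\<bar>)"

locale sphere_measure =
  fixes n :: nat and \<sigma> :: "(nat \<Rightarrow> real) measure"
  assumes n: "n \<ge> 2" and \<sigma>: "rotation_invariant_prob n \<sigma>"
begin

lemma space_\<sigma>: "space \<sigma> = unit_sphere n"
  and sets_\<sigma>: "sets \<sigma> = sets (restrict_space borel (unit_sphere n))"
  and emeasure_\<sigma>: "emeasure \<sigma> (space \<sigma>) = 1"
  using \<sigma> by (auto simp: rotation_invariant_prob_def)

lemma finite_measure_\<sigma>: "finite_measure \<sigma>"
  by (rule finite_measureI) (simp add: emeasure_\<sigma>)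

lemma measure_\<sigma>: "measure \<sigma> (space \<sigma>) = 1"
  by (simp add: measure_def emeasure_\<sigma>)

lemma measurable_\<sigma>: "f \<in> borel_measurable borel \<Longrightarrow> f \<in> borel_measurable \<sigma>"
  unfolding measurable_cong_sets[OF sets_\<sigma> refl] by (rule measurable_restrict_space1)

lemma integrable_\<sigma>:
  fixes f :: "(nat \<Rightarrow> real) \<Rightarrow> real"
  assumes "f \<in> borel_measurable \<sigma>" "\<And>\<xi>. \<xi> \<in> unit_sphere n \<Longrightarrow> \<bar>f \<xi>\<bar> \<le> B"
  shows "integrable \<sigma> f"
  using assms
  by (intro finite_measure.integrable_const_bound[OF finite_measure_\<sigma>, of f B] AE_I2)
    (auto simp: space_\<sigma>)

lemma integral_\<sigma>_const: "(LINT \<xi>|\<sigma>. c) = (c::real)"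
  by (simp add: measure_\<sigma>)

lemma integral_\<sigma>_mono:
  fixes f g :: "(nat \<Rightarrow> real) \<Rightarrow> real"
  assumes "integrable \<sigma> f" "integrable \<sigma> g" "\<And>\<xi>. \<xi> \<in> unit_sphere n \<Longrightarrow> f \<xi> \<le> g \<xi>"
  shows "(LINT \<xi>|\<sigma>. f \<xi>) \<le> (LINT \<xi>|\<sigma>. g \<xi>)"
  using assms by (intro integral_mono) (auto simp: space_\<sigma>)

lemma integral_\<sigma>_cong:
  fixes f g :: "(nat \<Rightarrow> real) \<Rightarrow> real"
  shows "(\<And>\<xi>. \<xi> \<in> unit_sphere n \<Longrightarrow> f \<xi> = g \<xi>) \<Longrightarrow> (LINT \<xi>|\<sigma>. f \<xi>) = (LINT \<xi>|\<sigma>. g \<xi>)"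
  by (intro Bochner_Integration.integral_cong) (auto simp: space_\<sigma>)

lemma inner_n_sphere_le: "\<xi> \<in> unit_sphere n \<Longrightarrow> \<bar>inner_n n \<xi> u\<bar> \<le> norm_n n u"
  using norm_n_cauchy_schwarz[of n \<xi> u] by (simp add: unit_sphere_def)

lemma integral_\<sigma>_reflection:
  fixes f :: "(nat \<Rightarrow> real) \<Rightarrow> real"
  assumes f: "f \<in> borel_measurable borel" and w: "w \<in> Rn n"
  shows "(LINT \<xi>|\<sigma>. f (reflection_n n w \<xi>)) = (LINT \<xi>|\<sigma>. f \<xi>)"
proof -
  let ?R = "reflection_n n w"
  have "?R \<in> borel_measurable borel"
    unfolding reflection_n_def by measurable
  moreover have "?R \<xi> \<in> unit_sphere n" if "\<xi> \<in> unit_sphere n" for \<xi>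
    using that w by (auto simp: unit_sphere_def norm_reflection_n intro: reflection_n_Rn)
  ultimately have R: "?R \<in> measurable \<sigma> \<sigma>"
    unfolding measurable_cong_sets[OF sets_\<sigma> sets_\<sigma>]
    by (intro measurable_restrict_space2 measurable_restrict_space1) (auto simp: space_restrict_space)
  have "(LINT \<xi>|\<sigma>. f \<xi>) = (LINT \<xi>|distr \<sigma> \<sigma> ?R. f \<xi>)"
    using \<sigma> orthogonal_reflection_n[OF w] by (simp add: rotation_invariant_prob_def)
  also have "\<dots> = (LINT \<xi>|\<sigma>. f (?R \<xi>))"
    by (rule integral_distr[OF R measurable_\<sigma>[OF f]])
  finally show ?thesis ..
qed

text \<open>The reflection exchanging \<open>u\<close> and \<open>v\<close> is self-adjoint and
  preserves \<sigma>.\<close>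

lemma integral_\<sigma>_inner_eq:
  fixes h :: "real \<Rightarrow> real"
  assumes h [measurable]: "h \<in> borel_measurable borel"
    and uv: "u \<in> Rn n" "v \<in> Rn n" "norm_n n u = norm_n n v"
  shows "(LINT \<xi>|\<sigma>. h (inner_n n \<xi> u)) = (LINT \<xi>|\<sigma>. h (inner_n n \<xi> v))"
proof -
  have "(LINT \<xi>|\<sigma>. h (inner_n n (reflection_n n (u - v) \<xi>) u)) = (LINT \<xi>|\<sigma>. h (inner_n n \<xi> u))"
    using uv by (intro integral_\<sigma>_reflection[of "\<lambda>\<xi>. h (inner_n n \<xi> u)"] Rn_diff) measurable
  then show ?thesis
    using uv by (simp add: inner_reflection_n reflection_n_swap)
qed

lemma integrable_\<sigma>_coord_power: "i < n \<Longrightarrow> integrable \<sigma> (\<lambda>\<xi>. (\<xi> i) ^ k)"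
proof (rule integrable_\<sigma>[where B = 1])
  fix \<xi> assume "i < n" "\<xi> \<in> unit_sphere n"
  then have "\<bar>\<xi> i\<bar> \<le> 1"
    using abs_le_norm_n[of i n \<xi>] by (simp add: unit_sphere_def)
  then show "\<bar>\<xi> i ^ k\<bar> \<le> 1"
    unfolding power_abs by (intro power_le_one) auto
qed (rule measurable_\<sigma>, measurable)

abbreviation "\<alpha> \<equiv> mean_abs n \<sigma>"

lemma integral_\<sigma>_abs_inner:
  assumes "u \<in> Rn n" "norm_n n u = 1"
  shows "(LINT \<xi>|\<sigma>. \<bar>inner_n n \<xi> u\<bar>) = \<alpha>"
  unfolding mean_abs_def using assms n by (intro integral_\<sigma>_inner_eq) auto

text \<open>By symmetry all n coordinates have the same second moment, and the squares add up to 1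
  on the sphere.\<close>

lemma integral_\<sigma>_power2_coord:
  assumes "i < n"
  shows "(LINT \<xi>|\<sigma>. (\<xi> i)\<^sup>2) = 1 / real n"
proof -
  have int: "integrable \<sigma> (\<lambda>\<xi>. (\<xi> i)\<^sup>2)" if "i < n" for i
    using that by (rule integrable_\<sigma>_coord_power)
  have eq: "(LINT \<xi>|\<sigma>. (\<xi> j)\<^sup>2) = (LINT \<xi>|\<sigma>. (\<xi> i)\<^sup>2)" if "j < n" for j
    using integral_\<sigma>_inner_eq[of "\<lambda>t. t\<^sup>2" "axis_n j" "axis_n i"] that assms
    by (simp add: inner_n_axis_n)
  have "1 = (LINT \<xi>|\<sigma>. (\<Sum>j<n. (\<xi> j)\<^sup>2))"
    using integral_\<sigma>_cong[of "\<lambda>_. 1" "\<lambda>\<xi>. \<Sum>j<n. (\<xi> j)\<^sup>2"] integral_\<sigma>_const[of 1]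
    by (simp add: unit_sphere_def norm_n_def inner_n_def power2_eq_square)
  also have "\<dots> = (\<Sum>j<n. LINT \<xi>|\<sigma>. (\<xi> j)\<^sup>2)"
    using int by (intro Bochner_Integration.integral_sum) auto
  also have "\<dots> = n * (LINT \<xi>|\<sigma>. (\<xi> i)\<^sup>2)"
    using eq by simp
  finally show ?thesis
    using n by (simp add: field_simps)
qed

text \<open>The invariance under rotation by 45 degrees determines the mixed fourth moments.\<close>

lemma integral_\<sigma>_power4_coord:
  assumes "i < n"
  shows "(LINT \<xi>|\<sigma>. (\<xi> i) ^ 4) = 3 / (real n * (real n + 2))"
proof -
  define M where "M = (LINT \<xi>|\<sigma>. (\<xi> i) ^ 4)"
  have coord: "\<bar>\<xi> j\<bar> \<le> 1" if "\<xi> \<in> unit_sphere n" "j < n" for \<xi> j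
    using that abs_le_norm_n[of j n \<xi>] by (simp add: unit_sphere_def)
  have int: "integrable \<sigma> (\<lambda>\<xi>. (\<xi> j) ^ 4)" if "j < n" for j
    using that by (rule integrable_\<sigma>_coord_power)
  have int2: "integrable \<sigma> (\<lambda>\<xi>. (\<xi> j)\<^sup>2 * (\<xi> k)\<^sup>2)" if "j < n" "k < n" for j k
    using that coord
    by (intro integrable_\<sigma>[where B = 1] measurable_\<sigma>)
      (auto simp: abs_mult abs_square_le_1 intro!: mult_le_one)
  have eq: "(LINT \<xi>|\<sigma>. (\<xi> j) ^ 4) = M" if "j < n" for j
    unfolding M_def using integral_\<sigma>_inner_eq[of "\<lambda>t. t ^ 4" "axis_n j" "axis_n i"] that assms
    by (simp add: inner_n_axis_n)
  have mixed: "(LINT \<xi>|\<sigma>. (\<xi> j)\<^sup>2 * (\<xi> k)\<^sup>2) = M / 3" if jk: "j < n" "k < n" "j \<noteq> k" for j k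
  proof -
    \<comment> \<open>The unit vectors along the two diagonals of the plane of axes \<open>j\<close>
      and \<open>k\<close> have the fourth moment of an axis; 4 is the fourth power of sqrt
      2.\<close>
    have diag: "(LINT \<xi>|\<sigma>. (\<xi> j + s * \<xi> k) ^ 4) = 4 * M" if s: "\<bar>s\<bar> = 1" for s
    proof -
      let ?u = "(1 / sqrt 2) *\<^sub>R (axis_n j + s *\<^sub>R axis_n k)"
      have u: "?u \<in> Rn n"
        using jk by (intro Rn_scaleR Rn_add axis_n_Rn)
      have axes: "inner_n n (axis_n j) (axis_n k) = 0" "inner_n n (axis_n k) (axis_n j) = 0"
        "inner_n n (axis_n j) (axis_n j) = 1" "inner_n n (axis_n k) (axis_n k) = 1"
        using jk by (simp_all add: inner_n_axis_n) (simp_all add: axis_n_def)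
      have "s * s = 1"
        using s by (metis abs_mult_self_eq mult_1)
      then have "inner_n n ?u ?u = 1"
        by (simp add: inner_n_simps axes)
      then have "norm_n n ?u = norm_n n (axis_n j)"
        using jk by (simp add: norm_n_def[of n ?u])
      then have "(LINT \<xi>|\<sigma>. inner_n n \<xi> ?u ^ 4) = M"
        using integral_\<sigma>_inner_eq[of "\<lambda>t. t ^ 4" ?u "axis_n j"] u jk eq[of j]
        by (simp add: inner_n_axis_n)
      moreover have "inner_n n \<xi> ?u ^ 4 = (1 / 4) * (\<xi> j + s * \<xi> k) ^ 4" for \<xi>
      proof -
        have "inner_n n \<xi> ?u = (1 / sqrt 2) * (\<xi> j + s * \<xi> k)"
          unfolding inner_n_simps using jk by (simp add: inner_n_axis_n)
        moreover have "(1 / sqrt 2) ^ 4 = (1 / 4 :: real)"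
          by (simp add: power_divide power4_eq_xxxx)
        ultimately show ?thesis
          by (simp only: power_mult_distrib)
      qed
      ultimately show ?thesis by simp
    qed
    \<comment> \<open>Adding the two diagonal moments isolates the mixed one: 8 M = 4 M + 12 times
      the mixed moment.\<close>
    have "(\<xi> j + 1 * \<xi> k) ^ 4 = 2 * (\<xi> j) ^ 4 + 2 * (\<xi> k) ^ 4 + 12 * ((\<xi> j)\<^sup>2 * (\<xi> k)\<^sup>2) - (\<xi> j + (-1) * \<xi> k) ^ 4"
      for \<xi> :: "nat \<Rightarrow> real"
      by algebra
    moreover have "integrable \<sigma> (\<lambda>\<xi>. (\<xi> j + (-1) * \<xi> k) ^ 4)"
    proof (rule integrable_\<sigma>[where B = "2 ^ 4"])
      show "(\<lambda>\<xi>. (\<xi> j + (-1) * \<xi> k) ^ 4) \<in> borel_measurable \<sigma>"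
        by (rule measurable_\<sigma>) measurable
      fix \<xi> assume "\<xi> \<in> unit_sphere n"
      then have "\<bar>\<xi> j + (-1) * \<xi> k\<bar> \<le> 2"
        using coord[of \<xi> j] coord[of \<xi> k] jk by linarith
      then show "\<bar>(\<xi> j + (-1) * \<xi> k) ^ 4\<bar> \<le> 2 ^ 4"
        unfolding power_abs by (rule power_mono) simp
    qed
    ultimately have "4 * M = 2 * M + 2 * M + 12 * (LINT \<xi>|\<sigma>. (\<xi> j)\<^sup>2 * (\<xi> k)\<^sup>2) - 4 * M"
      using diag[of 1] diag[of "-1"] int[OF jk(1)] int[OF jk(2)] int2[OF jk(1,2)] eq[OF jk(1)] eq[OF jk(2)]
      by simp
    then show ?thesis by simp
  qed
  \<comment> \<open>Expanding the square of |\<xi>|^2 = 1 gives 1 = n M + n (n - 1) M / 3.\<close>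
  have "1 = (LINT \<xi>|\<sigma>. (\<Sum>j<n. \<Sum>k<n. (\<xi> j)\<^sup>2 * (\<xi> k)\<^sup>2))"
  proof -
    have "(\<Sum>j<n. \<Sum>k<n. (\<xi> j)\<^sup>2 * (\<xi> k)\<^sup>2) = 1" if "\<xi> \<in> unit_sphere n" for \<xi>
    proof -
      have "(\<Sum>j<n. (\<xi> j)\<^sup>2) = 1"
        using that by (simp add: unit_sphere_def norm_n_def inner_n_def power2_eq_square)
      then show ?thesis
        by (simp add: sum_distrib_left[symmetric])
    qed
    then show ?thesis
      using integral_\<sigma>_cong[of "\<lambda>\<xi>. \<Sum>j<n. \<Sum>k<n. (\<xi> j)\<^sup>2 * (\<xi> k)\<^sup>2" "\<lambda>_. 1"] integral_\<sigma>_const[of 1] by simp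
  qed
  also have "\<dots> = (\<Sum>j<n. \<Sum>k<n. LINT \<xi>|\<sigma>. (\<xi> j)\<^sup>2 * (\<xi> k)\<^sup>2)"
    using int2 by (subst Bochner_Integration.integral_sum)
      (auto intro!: sum.cong Bochner_Integration.integral_sum Bochner_Integration.integrable_sum)
  also have "\<dots> = (\<Sum>j<n. \<Sum>k<n. M / 3 + (if k = j then 2 * M / 3 else 0))"
  proof (intro sum.cong refl)
    fix j k assume "j \<in> {..<n}" "k \<in> {..<n}"
    then show "(LINT \<xi>|\<sigma>. (\<xi> j)\<^sup>2 * (\<xi> k)\<^sup>2) = M / 3 + (if k = j then 2 * M / 3 else 0)"
      using mixed[of j k] eq[of j] by (auto simp: power2_eq_square power4_eq_xxxx mult.assoc)
  qed
  also have "\<dots> = n * (n * (M / 3) + 2 * M / 3)"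
    by (simp add: sum.distrib)
  finally have "M * (real n * (real n + 2)) = 3"
    by (simp add: algebra_simps)
  then show ?thesis
    using n unfolding M_def[symmetric] by (subst eq_divide_eq) auto
qed

text \<open>Integrates \<open>\<bar>t\<bar> \<ge> t\<^sup>2 / \<lambda> - t ^ 4 / \<lambda> ^ 3\<close> with \<open>\<lambda>\<^sup>2 = 6 / n\<close>.\<close>

lemma mean_abs_ge: "\<alpha> \<ge> 1 / (5 * sqrt (real n))"
proof -
  \<comment> \<open>This value makes the quartic term at most half of the quadratic one. What
    remains is 1 / (2 n l), and 2 n l = sqrt (24 n) \<le> 5 sqrt n explains the 5.\<close>
  define l where "l = sqrt (6 / real n)"
  have l: "l > 0" "l\<^sup>2 = 6 / real n"
    using n by (auto simp: l_def)
  have ineq: "t\<^sup>2 / l - t ^ 4 / l ^ 3 \<le> \<bar>t\<bar>" for t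
  proof -
    define y where "y = \<bar>t\<bar> / l"
    have y: "y \<ge> 0" using l by (simp add: y_def)
    \<comment> \<open>Multiplied by \<open>l * y\<close>, this becomes the claim about
      \<open>t\<close>.\<close>
    have "y \<le> 1 + y ^ 3"
    proof (cases "y \<le> 1")
      case False
      then have "y ^ 1 \<le> y ^ 3" by (intro power_increasing) auto
      then show ?thesis by simp
    qed (use y in \<open>simp add: add_increasing2\<close>)
    then have "l * y * y \<le> l * y * (1 + y ^ 3)"
      using l y by (intro mult_left_mono) auto
    moreover have "l * y = \<bar>t\<bar>" using l by (simp add: y_def)
    moreover have "\<bar>t\<bar> * y = t\<^sup>2 / l" by (simp add: y_def power2_eq_square)
    moreover have "\<bar>t\<bar> * y ^ 3 = t ^ 4 / l ^ 3"
      by (simp add: y_def power_divide power4_eq_xxxx power3_eq_cube abs_mult[symmetric])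
    ultimately show ?thesis by (simp add: distrib_left)
  qed
  have 0: "0 < n" using n by simp
  have int1: "integrable \<sigma> (\<lambda>\<xi>. \<bar>\<xi> 0\<bar>)"
    using integrable_\<sigma>_coord_power[OF 0, of 1] by simp
  have int2: "integrable \<sigma> (\<lambda>\<xi>. (\<xi> 0)\<^sup>2)"
    by (rule integrable_\<sigma>_coord_power[OF 0])
  have int4: "integrable \<sigma> (\<lambda>\<xi>. (\<xi> 0) ^ 4)"
    by (rule integrable_\<sigma>_coord_power[OF 0])
  have "1 / (real n * l) - 3 / (real n * (real n + 2)) / l ^ 3 = (LINT \<xi>|\<sigma>. (\<xi> 0)\<^sup>2 / l - (\<xi> 0) ^ 4 / l ^ 3)"
    using int2 int4 integral_\<sigma>_power2_coord[OF 0] integral_\<sigma>_power4_coord[OF 0] by simp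
  also have "\<dots> \<le> (LINT \<xi>|\<sigma>. \<bar>\<xi> 0\<bar>)"
    using int1 int2 int4 ineq by (intro integral_\<sigma>_mono) auto
  also have "\<dots> = \<alpha>"
    using 0 by (simp add: mean_abs_def inner_n_axis_n)
  finally have le: "1 / (real n * l) - 3 / (real n * (real n + 2)) / l ^ 3 \<le> \<alpha>" .
  have "3 / (real n * (real n + 2)) / l ^ 3 = (3 / (real n * (real n + 2)) / l\<^sup>2) / l"
    by (simp add: power3_eq_cube power2_eq_square algebra_simps)
  also have "3 / (real n * (real n + 2)) / l\<^sup>2 = 1 / (2 * (real n + 2))"
  proof -
    have "real n * 12 + real n * (real n * 6) > 0"
      using n by (intro add_pos_pos mult_pos_pos) auto
    then show ?thesis
      unfolding l(2) using n by (simp add: field_simps)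
  qed
  also have "1 / (2 * (real n + 2)) / l \<le> 1 / (2 * real n) / l"
    using n l by (intro divide_right_mono divide_left_mono) auto
  finally have "3 / (real n * (real n + 2)) / l ^ 3 \<le> 1 / (2 * real n) / l" .
  moreover have "1 / (real n * l) = 2 * (1 / (2 * real n) / l)"
    by simp
  ultimately have "1 / (2 * real n) / l \<le> \<alpha>"
    using le by linarith
  moreover have "1 / (5 * sqrt (real n)) \<le> 1 / (2 * real n) / l"
  proof -
    have "2 * real n * l = sqrt (24 * real n)"
      using n by (intro real_sqrt_unique[symmetric]) (auto simp: power_mult_distrib l(2) field_simps power2_eq_square l_def)
    also have "\<dots> \<le> sqrt (25 * real n)"
      by simp
    also have "\<dots> = 5 * sqrt (real n)"
      by (simp add: real_sqrt_mult)
    finally show ?thesis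
      using n l by (simp add: field_simps)
  qed
  ultimately show ?thesis by linarith
qed

lemma mean_abs_pos: "\<alpha> > 0"
  using mean_abs_ge n by (intro less_le_trans[OF _ mean_abs_ge]) simp

text \<open>Split \<open>w\<close> into its component along \<open>u\<close> and an orthogonal
  remainder. The reflection in the remainder fixes \<open>u\<close> and negates the remainder, whose
  integral therefore vanishes; along \<open>u\<close> the integrand is a multiple of |<\<xi>,
  u>|.\<close>

lemma integral_\<sigma>_sgn_inner:
  assumes u: "u \<in> Rn n" "norm_n n u = 1" and w: "w \<in> Rn n"
  shows "(LINT \<xi>|\<sigma>. sgn (inner_n n \<xi> u) * inner_n n \<xi> w) = \<alpha> * inner_n n w u"
proof -
  define w' where "w' = w - inner_n n w u *\<^sub>R u"
  have w': "w' \<in> Rn n" "inner_n n u w' = 0"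
    unfolding w'_def using u w
    by (auto intro!: Rn_diff Rn_scaleR simp: inner_n_simps inner_n_self inner_n_commute[of n w u])
  have int: "integrable \<sigma> (\<lambda>\<xi>. sgn (inner_n n \<xi> u) * inner_n n \<xi> v)" for v
    using inner_n_sphere_le[of _ v]
    by (intro integrable_\<sigma>[where B = "norm_n n v"] measurable_\<sigma>)
      (auto simp: abs_mult sgn_if intro: order_trans[OF abs_ge_zero])
  have refl_u: "reflection_n n w' u = u"
    by (simp add: reflection_n_def w')
  have refl_w: "reflection_n n w' w' = - w'"
  proof (cases "w' = 0")
    case False
    then have "inner_n n w' w' \<noteq> 0"
      using norm_n_eq_0[OF w'(1)] by (simp add: inner_n_self)
    then show ?thesis
      by (simp add: reflection_n_def fun_eq_iff)
  qed (simp add: reflection_n_def)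
  have "(LINT \<xi>|\<sigma>. sgn (inner_n n \<xi> u) * inner_n n \<xi> w')
      = (LINT \<xi>|\<sigma>. sgn (inner_n n (reflection_n n w' \<xi>) u) * inner_n n (reflection_n n w' \<xi>) w')"
    by (rule integral_\<sigma>_reflection[symmetric, of "\<lambda>\<xi>. sgn (inner_n n \<xi> u) * inner_n n \<xi> w'"])
      (use w' in measurable)
  also have "\<dots> = (LINT \<xi>|\<sigma>. - (sgn (inner_n n \<xi> u) * inner_n n \<xi> w'))"
  proof -
    have "inner_n n \<xi> (- w') = - inner_n n \<xi> w'" for \<xi>
      using inner_n_scaleR_right[of n \<xi> "-1" w'] by simp
    then show ?thesis
      by (simp add: inner_reflection_n refl_u refl_w)
  qed
  finally have zero: "(LINT \<xi>|\<sigma>. sgn (inner_n n \<xi> u) * inner_n n \<xi> w') = 0"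
    by simp
  have "inner_n n \<xi> w = inner_n n w u * inner_n n \<xi> u + inner_n n \<xi> w'" for \<xi>
    by (simp add: w'_def inner_n_simps)
  then have "sgn (inner_n n \<xi> u) * inner_n n \<xi> w
      = inner_n n w u * \<bar>inner_n n \<xi> u\<bar> + sgn (inner_n n \<xi> u) * inner_n n \<xi> w'" for \<xi>
    by (simp add: distrib_left sgn_mult_self_eq abs_sgn mult_ac)
  moreover have "integrable \<sigma> (\<lambda>\<xi>. \<bar>inner_n n \<xi> u\<bar>)"
    using inner_n_sphere_le[of _ u]
    by (intro integrable_\<sigma>[where B = "norm_n n u"] measurable_\<sigma>) auto
  ultimately show ?thesis
    using int[of w'] by (simp add: integral_\<sigma>_abs_inner[OF u] zero)
qed

end

section \<open>Approximation of the ball by zonotopes\<close>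

text \<open>Rounding down to multiples of 1 / N. On the sphere it takes finitely many values, so
  integrals against \<sigma> become finite sums; the rounded points need not lie on the
  sphere.\<close>

definition grid :: "nat \<Rightarrow> (nat \<Rightarrow> real) \<Rightarrow> nat \<Rightarrow> real" where
  "grid N x = (\<lambda>i. of_int \<lfloor>real N * x i\<rfloor> / real N)"

lemma grid_Rn: "x \<in> Rn n \<Longrightarrow> grid N x \<in> Rn n"
  by (simp add: grid_def mem_Rn)

lemma grid_dist: "N > 0 \<Longrightarrow> \<bar>grid N x i - x i\<bar> \<le> 1 / real N"
proof -
  assume N: "N > 0"
  have "\<bar>of_int \<lfloor>real N * x i\<rfloor> - real N * x i\<bar> \<le> 1" by linarith
  moreover have "grid N x i - x i = (of_int \<lfloor>real N * x i\<rfloor> - real N * x i) / real N"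
    using N by (simp add: grid_def field_simps)
  ultimately show ?thesis
    using N by (simp add: abs_divide divide_right_mono)
qed

lemma norm_grid_diff: "N > 0 \<Longrightarrow> norm_n n (grid N x - x) \<le> real n / real N"
proof -
  assume N: "N > 0"
  have "norm_n n (grid N x - x) \<le> (\<Sum>i<n. \<bar>(grid N x - x) i\<bar>)"
    by (rule norm_n_le_sum_abs)
  also have "\<dots> \<le> (\<Sum>i<n. 1 / real N)"
    using grid_dist[OF N] by (intro sum_mono) simp
  finally show ?thesis by simp
qed

lemma measurable_grid [measurable]: "grid N \<in> borel_measurable borel"
  unfolding grid_def by (rule measurable_coordinatewise_then_product) measurable

lemma finite_grid_sphere: "finite (grid N ` unit_sphere n)"
proof -
  let ?K = "PiE {..<n} (\<lambda>_. {- int N..int N})"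
  have "grid N ` unit_sphere n \<subseteq> (\<lambda>k i. if i < n then of_int (k i) / real N else 0) ` ?K"
  proof safe
    fix x assume x: "x \<in> unit_sphere n"
    have "restrict (\<lambda>i. \<lfloor>real N * x i\<rfloor>) {..<n} \<in> ?K"
    proof (rule PiE_I)
      fix i assume i: "i \<in> {..<n}"
      then have "\<bar>x i\<bar> \<le> 1"
        using x abs_le_norm_n[of i n x] by (simp add: unit_sphere_def)
      then have "\<bar>real N * x i\<bar> \<le> real N * 1"
        unfolding abs_mult by (intro mult_mono) auto
      then have "- real N \<le> real N * x i" "real N * x i \<le> real N"
        by (simp_all add: abs_le_iff)
      then have "- int N \<le> \<lfloor>real N * x i\<rfloor>" "\<lfloor>real N * x i\<rfloor> \<le> int N"
        by linarith+
      then show "restrict (\<lambda>i. \<lfloor>real N * x i\<rfloor>) {..<n} i \<in> {- int N..int N}"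
        using i by simp
    qed auto
    then have "(\<lambda>i. if i < n then of_int (restrict (\<lambda>i. \<lfloor>real N * x i\<rfloor>) {..<n} i) / real N else 0)
        \<in> (\<lambda>k i. if i < n then of_int (k i) / real N else 0) ` ?K"
      by (rule imageI)
    moreover have "grid N x = (\<lambda>i. if i < n then of_int (restrict (\<lambda>i. \<lfloor>real N * x i\<rfloor>) {..<n} i) / real N else 0)"
      using unit_sphereD(1)[OF x] by (auto simp: grid_def mem_Rn fun_eq_iff)
    ultimately show "grid N x \<in> (\<lambda>k i. if i < n then of_int (k i) / real N else 0) ` ?K"
      by (simp only:)
  qed
  moreover have "finite ?K"
    by (intro finite_PiE) auto
  ultimately show ?thesis
    using finite_surj by blast
qed

context sphere_measure
begin

definition cell :: "nat \<Rightarrow> (nat \<Rightarrow> real) \<Rightarrow> (nat \<Rightarrow> real) set" where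
  "cell N \<zeta> = {\<xi> \<in> unit_sphere n. grid N \<xi> = \<zeta>}"

lemma cell_sets [measurable]: "cell N \<zeta> \<in> sets \<sigma>"
proof -
  have "(\<lambda>\<xi>. grid N \<xi>) -` {\<zeta>} \<inter> space \<sigma> \<in> sets \<sigma>"
    using measurable_\<sigma>[OF measurable_grid] by (rule measurable_sets) simp
  moreover have "(\<lambda>\<xi>. grid N \<xi>) -` {\<zeta>} \<inter> space \<sigma> = cell N \<zeta>"
    by (auto simp: cell_def space_\<sigma>)
  ultimately show ?thesis by simp
qed

text \<open>The cells partition the sphere. The weight \<open>g\<close> is 1 for plain averages, and
  a sign when points of the ball are represented.\<close>

lemma sum_cells:
  fixes f g :: "(nat \<Rightarrow> real) \<Rightarrow> real"
  assumes g: "integrable \<sigma> g"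
  shows "(\<Sum>\<zeta>\<in>grid N ` unit_sphere n. (LINT \<xi>|\<sigma>. indicator (cell N \<zeta>) \<xi> * g \<xi>) * f \<zeta>)
    = (LINT \<xi>|\<sigma>. g \<xi> * f (grid N \<xi>))"
proof -
  have int: "integrable \<sigma> (\<lambda>\<xi>. indicator (cell N \<zeta>) \<xi> * g \<xi>)" for \<zeta>
    using integrable_mult_indicator[OF cell_sets g] by simp
  have "(\<Sum>\<zeta>\<in>grid N ` unit_sphere n. (LINT \<xi>|\<sigma>. indicator (cell N \<zeta>) \<xi> * g \<xi>) * f \<zeta>)
      = (LINT \<xi>|\<sigma>. (\<Sum>\<zeta>\<in>grid N ` unit_sphere n. indicator (cell N \<zeta>) \<xi> * g \<xi> * f \<zeta>))"
    using int by (subst Bochner_Integration.integral_sum) auto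
  also have "\<dots> = (LINT \<xi>|\<sigma>. g \<xi> * f (grid N \<xi>))"
  proof (rule integral_\<sigma>_cong)
    fix \<xi> assume \<xi>: "\<xi> \<in> unit_sphere n"
    have "(\<Sum>\<zeta>\<in>grid N ` unit_sphere n. indicator (cell N \<zeta>) \<xi> * g \<xi> * f \<zeta>)
        = (\<Sum>\<zeta>\<in>grid N ` unit_sphere n. if \<zeta> = grid N \<xi> then g \<xi> * f \<zeta> else 0)"
      using \<xi> by (intro sum.cong refl) (auto simp: cell_def indicator_def)
    then show "(\<Sum>\<zeta>\<in>grid N ` unit_sphere n. indicator (cell N \<zeta>) \<xi> * g \<xi> * f \<zeta>) = g \<xi> * f (grid N \<xi>)"
      using \<xi> finite_grid_sphere[of N n] by simp
  qed
  finally show ?thesis .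
qed

lemma measure_cell: "measure \<sigma> (cell N \<zeta>) = (LINT \<xi>|\<sigma>. indicator (cell N \<zeta>) \<xi> * 1)"
  by simp

lemma sum_measure_cells:
  fixes f :: "(nat \<Rightarrow> real) \<Rightarrow> real"
  shows "(\<Sum>\<zeta>\<in>grid N ` unit_sphere n. measure \<sigma> (cell N \<zeta>) * f \<zeta>) = (LINT \<xi>|\<sigma>. f (grid N \<xi>))"
  using sum_cells[of "\<lambda>_. 1" N f] finite_measure.integrable_const[OF finite_measure_\<sigma>, of "1::real"]
  unfolding measure_cell by simp

text \<open>The zonotope of these vectors is a Riemann sum for the average of the segments
  [-\<xi>, \<xi>] / \<alpha>. At a unit vector u the support function of that average is the mean of
  |<\<xi>, u>| / \<alpha>, which is 1 as for the unit ball.\<close>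

definition zone :: "nat \<Rightarrow> (nat \<Rightarrow> real) \<Rightarrow> nat \<Rightarrow> real" where
  "zone N \<zeta> = (measure \<sigma> (cell N \<zeta>) / \<alpha>) *\<^sub>R \<zeta>"

lemma zone_Rn: "\<zeta> \<in> grid N ` unit_sphere n \<Longrightarrow> zone N \<zeta> \<in> Rn n"
  unfolding zone_def by (intro Rn_scaleR) (use grid_Rn unit_sphereD(1) in blast)

lemma integrable_grid:
  fixes f :: "(nat \<Rightarrow> real) \<Rightarrow> real"
  shows "integrable \<sigma> (\<lambda>\<xi>. f (grid N \<xi>))"
proof -
  have "integrable \<sigma> (\<lambda>\<xi>. \<Sum>\<zeta>\<in>grid N ` unit_sphere n. indicator (cell N \<zeta>) \<xi> * f \<zeta>)"
    using finite_measure.emeasure_finite[OF finite_measure_\<sigma>]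
    by (intro Bochner_Integration.integrable_sum integrable_mult_left integrable_real_indicator)
      (auto simp: less_top)
  moreover have "(\<Sum>\<zeta>\<in>grid N ` unit_sphere n. indicator (cell N \<zeta>) \<xi> * f \<zeta>) = f (grid N \<xi>)"
    if \<xi>: "\<xi> \<in> space \<sigma>" for \<xi>
  proof -
    have "(\<Sum>\<zeta>\<in>grid N ` unit_sphere n. indicator (cell N \<zeta>) \<xi> * f \<zeta>)
        = (\<Sum>\<zeta>\<in>grid N ` unit_sphere n. if \<zeta> = grid N \<xi> then f \<zeta> else 0)"
      using \<xi> by (intro sum.cong refl) (auto simp: cell_def indicator_def space_\<sigma>)
    then show ?thesis
      using \<xi> finite_grid_sphere[of N n] by (simp add: space_\<sigma>)
  qed
  ultimately show ?thesis
    using Bochner_Integration.integrable_cong[OF refl, of \<sigma>] by (metis (no_types, lifting))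
qed

text \<open>Tested in the direction u = z / |z|, the support function exceeds 1 at most by the
  rounding error n / N, divided by \<alpha>.\<close>

lemma zonotope_zone_subset:
  assumes N: "N > 0" and z: "z \<in> zonotope (grid N ` unit_sphere n) (zone N)"
  shows "norm_n n z \<le> 1 + real n / (\<alpha> * real N)"
proof (cases "z = 0")
  case True
  then show ?thesis using mean_abs_pos by simp
next
  case False
  have "compact_convex n (zonotope (grid N ` unit_sphere n) (zone N))"
    by (intro compact_convex_zonotope zone_Rn)
  then have zR: "z \<in> Rn n"
    using z compact_convexD(3) by blast
  define u where "u = (1 / norm_n n z) *\<^sub>R z"
  have nz: "norm_n n z > 0"
    using False norm_n_eq_0[OF zR] by (metis norm_n_nonneg order_le_less)
  have u: "u \<in> Rn n" "norm_n n u = 1"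
    using zR nz by (auto simp: u_def norm_n_scaleR intro!: Rn_scaleR)
  have abs_int: "integrable \<sigma> (\<lambda>\<xi>. \<bar>inner_n n \<xi> u\<bar>)"
    using inner_n_sphere_le[of _ u] by (intro integrable_\<sigma>[where B = "norm_n n u"] measurable_\<sigma>) auto
  have "norm_n n z = inner_n n z u"
    using nz by (simp add: u_def inner_n_simps inner_n_self power2_eq_square)
  also have "\<dots> \<le> (\<Sum>\<zeta>\<in>grid N ` unit_sphere n. \<bar>inner_n n (zone N \<zeta>) u\<bar>)"
    by (rule inner_zonotope_le[OF finite_grid_sphere z])
  also have "\<dots> = (\<Sum>\<zeta>\<in>grid N ` unit_sphere n. measure \<sigma> (cell N \<zeta>) * (\<bar>inner_n n \<zeta> u\<bar> / \<alpha>))"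
    using mean_abs_pos by (simp add: zone_def inner_n_simps abs_mult)
  also have "\<dots> = (LINT \<xi>|\<sigma>. \<bar>inner_n n (grid N \<xi>) u\<bar> / \<alpha>)"
    by (rule sum_measure_cells)
  also have "\<dots> \<le> (LINT \<xi>|\<sigma>. (\<bar>inner_n n \<xi> u\<bar> + real n / real N) / \<alpha>)"
  proof (rule integral_\<sigma>_mono)
    show "integrable \<sigma> (\<lambda>\<xi>. \<bar>inner_n n (grid N \<xi>) u\<bar> / \<alpha>)"
      by (rule integrable_grid[of "\<lambda>\<zeta>. \<bar>inner_n n \<zeta> u\<bar> / \<alpha>"])
    show "integrable \<sigma> (\<lambda>\<xi>. (\<bar>inner_n n \<xi> u\<bar> + real n / real N) / \<alpha>)"
      by (intro Bochner_Integration.integrable_divide Bochner_Integration.integrable_add abs_int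
          finite_measure.integrable_const[OF finite_measure_\<sigma>])
    fix \<xi> assume "\<xi> \<in> unit_sphere n"
    have "inner_n n (grid N \<xi>) u = inner_n n \<xi> u + inner_n n (grid N \<xi> - \<xi>) u"
      by (simp only: inner_n_simps)
    moreover have "\<bar>inner_n n (grid N \<xi> - \<xi>) u\<bar> \<le> real n / real N"
      using norm_n_cauchy_schwarz[of n "grid N \<xi> - \<xi>" u] norm_grid_diff[OF N, of n \<xi>] u by simp
    ultimately show "\<bar>inner_n n (grid N \<xi>) u\<bar> / \<alpha> \<le> (\<bar>inner_n n \<xi> u\<bar> + real n / real N) / \<alpha>"
      using mean_abs_pos by (intro divide_right_mono; linarith)
  qed
  also have "\<dots> = ((LINT \<xi>|\<sigma>. \<bar>inner_n n \<xi> u\<bar>) + real n / real N) / \<alpha>"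
    using abs_int finite_measure.integrable_const[OF finite_measure_\<sigma>, of "real n / real N"]
    by (simp add: measure_\<sigma>)
  also have "\<dots> = 1 + real n / (\<alpha> * real N)"
    using mean_abs_pos by (simp add: integral_\<sigma>_abs_inner[OF u] add_divide_distrib mult.commute)
  finally show ?thesis .
qed

text \<open>The identity \<open>\<integral>sgn \<langle>\<xi>, u\<rangle> \<xi> d\<sigma> = \<alpha> u\<close> writes the ball as an average of segments.\<close>

lemma unit_ball_subset_zonotope:
  assumes N: "N > 0" and x: "x \<in> unit_ball n"
  shows "\<exists>z\<in>zonotope (grid N ` unit_sphere n) (zone N). norm_n n (x - z) \<le> real n / (\<alpha> * real N)"
proof (cases "x = 0")
  case True
  then show ?thesis
    using zero_in_zonotope mean_abs_pos by (intro bexI[of _ 0]) auto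
next
  case False
  let ?J = "grid N ` unit_sphere n"
  have xR: "x \<in> Rn n" "norm_n n x \<le> 1"
    using x by (auto simp: unit_ball_def)
  have nx: "norm_n n x > 0"
    using False norm_n_eq_0[OF xR(1)] by (metis norm_n_nonneg order_le_less)
  define u where "u = (1 / norm_n n x) *\<^sub>R x"
  have u: "u \<in> Rn n" "norm_n n u = 1"
    using xR nx by (auto simp: u_def norm_n_scaleR intro!: Rn_scaleR)
  have x_eq: "x = norm_n n x *\<^sub>R u"
    using nx by (simp add: u_def)
  define s where "s \<xi> = sgn (inner_n n \<xi> u)" for \<xi>
  have s_meas: "s \<in> borel_measurable borel"
    unfolding s_def by measurable
  have s_le: "\<bar>s \<xi>\<bar> \<le> 1" for \<xi>
    by (simp add: s_def sgn_if)
  have s_int: "integrable \<sigma> s"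
    using s_le by (intro integrable_\<sigma>[where B = 1] measurable_\<sigma> s_meas)
  define I where "I \<zeta> = (LINT \<xi>|\<sigma>. indicator (cell N \<zeta>) \<xi> * s \<xi>)" for \<zeta>
  have I_le: "\<bar>I \<zeta>\<bar> \<le> measure \<sigma> (cell N \<zeta>)" for \<zeta>
  proof -
    have "\<bar>I \<zeta>\<bar> \<le> (LINT \<xi>|\<sigma>. \<bar>indicator (cell N \<zeta>) \<xi> * s \<xi>\<bar>)"
      unfolding I_def by (rule integral_abs_bound)
    also have "\<dots> \<le> (LINT \<xi>|\<sigma>. indicator (cell N \<zeta>) \<xi> * 1)"
    proof (rule integral_\<sigma>_mono)
      show "integrable \<sigma> (\<lambda>\<xi>. \<bar>indicator (cell N \<zeta>) \<xi> * s \<xi>\<bar>)"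
        using integrable_mult_indicator[OF cell_sets s_int] by (intro integrable_abs) simp
      show "integrable \<sigma> (\<lambda>\<xi>. indicator (cell N \<zeta>) \<xi> * (1::real))"
        using integrable_mult_indicator[OF cell_sets
            finite_measure.integrable_const[OF finite_measure_\<sigma>, of "1::real"]] by simp
    qed (use s_le in \<open>auto simp: indicator_def\<close>)
    finally show ?thesis
      unfolding measure_cell .
  qed
  \<comment> \<open>The coefficient is |x| times the average sign over the cell. A null cell gets 0
    from the division by 0, which is harmless as its segment is a point.\<close>
  define t where "t \<zeta> = norm_n n x * (I \<zeta> / measure \<sigma> (cell N \<zeta>))" for \<zeta>
  have t_le: "\<bar>t \<zeta>\<bar> \<le> 1" for \<zeta>
  proof -
    have "\<bar>I \<zeta> / measure \<sigma> (cell N \<zeta>)\<bar> \<le> 1"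
      using I_le[of \<zeta>] by (cases "measure \<sigma> (cell N \<zeta>) = 0") (auto simp: abs_divide divide_le_eq_1 order_less_le)
    then show ?thesis
      unfolding t_def abs_mult using xR(2) by (intro mult_le_one) auto
  qed
  define z where "z = (\<Sum>\<zeta>\<in>?J. t \<zeta> *\<^sub>R zone N \<zeta>)"
  have z: "z \<in> zonotope ?J (zone N)"
    unfolding z_def by (rule mem_zonotopeI[OF finite_grid_sphere t_le])
  \<comment> \<open>So \<open>z\<close> is the integral that represents \<open>x\<close>, with every
    \<xi> replaced by its rounding.\<close>
  have z_coord: "z i = norm_n n x / \<alpha> * (LINT \<xi>|\<sigma>. s \<xi> * grid N \<xi> i)" for i
  proof -
    have "t \<zeta> * (measure \<sigma> (cell N \<zeta>) / \<alpha>) = norm_n n x / \<alpha> * I \<zeta>" for \<zeta>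
      using I_le[of \<zeta>] by (cases "measure \<sigma> (cell N \<zeta>) = 0") (auto simp: t_def)
    then have "t \<zeta> * (measure \<sigma> (cell N \<zeta>) / \<alpha> * \<zeta> i) = norm_n n x / \<alpha> * (I \<zeta> * \<zeta> i)" for \<zeta>
      by (simp only: mult.assoc[symmetric])
    then have "z i = (\<Sum>\<zeta>\<in>?J. norm_n n x / \<alpha> * (I \<zeta> * \<zeta> i))"
      unfolding z_def zone_def sum_fun_apply scaleR_fun_apply real_scaleR_def by (simp only:)
    also have "\<dots> = norm_n n x / \<alpha> * (LINT \<xi>|\<sigma>. s \<xi> * grid N \<xi> i)"
      unfolding I_def sum_distrib_left[symmetric] by (subst sum_cells[OF s_int, of N "\<lambda>\<zeta>. \<zeta> i"]) simp
    finally show ?thesis .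
  qed
  have x_coord: "x i = norm_n n x / \<alpha> * (LINT \<xi>|\<sigma>. s \<xi> * \<xi> i)" if "i < n" for i
  proof -
    have "(LINT \<xi>|\<sigma>. s \<xi> * \<xi> i) = \<alpha> * u i"
      using integral_\<sigma>_sgn_inner[OF u, of "axis_n i"] that inner_n_axis_n[OF that]
      by (simp add: s_def inner_n_commute[of n "axis_n i" u])
    then show ?thesis
      using mean_abs_pos by (subst x_eq) simp
  qed
  \<comment> \<open>Only rounding separates the two integrals: at most 1 / N in each coordinate,
    times |x| / \<alpha>.\<close>
  have diff: "\<bar>(x - z) i\<bar> \<le> 1 / (\<alpha> * real N)" if i: "i < n" for i
  proof -
    have int1: "integrable \<sigma> (\<lambda>\<xi>. s \<xi> * \<xi> i)"
    proof (rule integrable_\<sigma>[where B = 1])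
      show "(\<lambda>\<xi>. s \<xi> * \<xi> i) \<in> borel_measurable \<sigma>"
        by (intro measurable_\<sigma> borel_measurable_times s_meas measurable_product_coordinates)
      fix \<xi> assume "\<xi> \<in> unit_sphere n"
      then have "\<bar>\<xi> i\<bar> \<le> 1"
        using abs_le_norm_n[OF i, of \<xi>] by (simp add: unit_sphere_def)
      then show "\<bar>s \<xi> * \<xi> i\<bar> \<le> 1"
        unfolding abs_mult using s_le by (intro mult_le_one) auto
    qed
    have int3: "integrable \<sigma> (\<lambda>\<xi>. s \<xi> * (\<xi> i - grid N \<xi> i))"
    proof (rule integrable_\<sigma>[where B = "1 * (1 / real N)"])
      show "(\<lambda>\<xi>. s \<xi> * (\<xi> i - grid N \<xi> i)) \<in> borel_measurable \<sigma>"
        by (intro measurable_\<sigma> borel_measurable_times borel_measurable_diff s_meas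
            measurable_product_coordinates measurable_product_then_coordinatewise[OF measurable_grid])
      show "\<bar>s \<xi> * (\<xi> i - grid N \<xi> i)\<bar> \<le> 1 * (1 / real N)" for \<xi>
        unfolding abs_mult using s_le grid_dist[OF N, of \<xi> i]
        by (intro mult_mono) (auto simp: abs_minus_commute)
    qed
    have "(LINT \<xi>|\<sigma>. s \<xi> * grid N \<xi> i) = (LINT \<xi>|\<sigma>. s \<xi> * \<xi> i - s \<xi> * (\<xi> i - grid N \<xi> i))"
      by (simp add: algebra_simps)
    also have "\<dots> = (LINT \<xi>|\<sigma>. s \<xi> * \<xi> i) - (LINT \<xi>|\<sigma>. s \<xi> * (\<xi> i - grid N \<xi> i))"
      by (rule Bochner_Integration.integral_diff[OF int1 int3])
    finally have eq: "(x - z) i = norm_n n x / \<alpha> * (LINT \<xi>|\<sigma>. s \<xi> * (\<xi> i - grid N \<xi> i))"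
      unfolding fun_diff_def x_coord[OF i] z_coord[of i] right_diff_distrib[symmetric] by simp
    have "\<bar>LINT \<xi>|\<sigma>. s \<xi> * (\<xi> i - grid N \<xi> i)\<bar> \<le> (LINT \<xi>|\<sigma>. \<bar>s \<xi> * (\<xi> i - grid N \<xi> i)\<bar>)"
      by (rule integral_abs_bound)
    also have "\<dots> \<le> (LINT \<xi>|\<sigma>. 1 / real N)"
    proof (rule integral_\<sigma>_mono)
      show "integrable \<sigma> (\<lambda>\<xi>. \<bar>s \<xi> * (\<xi> i - grid N \<xi> i)\<bar>)"
        using int3 by (rule integrable_abs)
      show "\<bar>s \<xi> * (\<xi> i - grid N \<xi> i)\<bar> \<le> 1 / real N" for \<xi>
        unfolding abs_mult using s_le[of \<xi>] grid_dist[OF N, of \<xi> i]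
          mult_mono[of "\<bar>s \<xi>\<bar>" 1 "\<bar>\<xi> i - grid N \<xi> i\<bar>" "1 / real N"] by (simp add: abs_minus_commute)
    qed (rule finite_measure.integrable_const[OF finite_measure_\<sigma>])
    also have "\<dots> = 1 / real N"
      by (rule integral_\<sigma>_const)
    finally have "\<bar>(x - z) i\<bar> \<le> norm_n n x / \<alpha> * (1 / real N)"
      unfolding eq abs_mult using nx mean_abs_pos by (intro mult_mono) auto
    also have "\<dots> \<le> 1 / \<alpha> * (1 / real N)"
      using xR(2) mean_abs_pos by (intro mult_right_mono divide_right_mono) auto
    finally show ?thesis by simp
  qed
  have "norm_n n (x - z) \<le> (\<Sum>i<n. \<bar>(x - z) i\<bar>)"
    by (rule norm_n_le_sum_abs)
  also have "\<dots> \<le> (\<Sum>i<n. 1 / (\<alpha> * real N))"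
    using diff by (intro sum_mono) auto
  finally show ?thesis
    using z by auto
qed

lemma ball_approx_zone:
  assumes N: "N > 0" and \<delta>: "\<delta> > 0" "real n / (\<alpha> * real N) \<le> \<delta>"
  shows "ball_approx n \<delta> (grid N ` unit_sphere n) (zone N)"
  unfolding ball_approx_def
proof (intro conjI ballI subsetI)
  let ?Z = "zonotope (grid N ` unit_sphere n) (zone N)"
  have ZR: "?Z \<subseteq> Rn n"
    by (intro compact_convexD(3) compact_convex_zonotope zone_Rn)
  show "z \<in> (*\<^sub>R) (1 + \<delta>) ` unit_ball n" if "z \<in> ?Z" for z
    using zonotope_zone_subset[OF N that] \<delta> ZR that scaleR_unit_ball[of "1 + \<delta>" n] by auto
  show "x \<in> ?Z + (*\<^sub>R) \<delta> ` unit_ball n" if x: "x \<in> unit_ball n" for x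
  proof -
    obtain z where z: "z \<in> ?Z" "norm_n n (x - z) \<le> real n / (\<alpha> * real N)"
      using unit_ball_subset_zonotope[OF N x] by blast
    have "x - z \<in> Rn n"
      using x z(1) ZR by (intro Rn_diff) (auto simp: unit_ball_def)
    then have "x - z \<in> (*\<^sub>R) \<delta> ` unit_ball n"
      using z(2) \<delta> by (simp add: scaleR_unit_ball)
    then have "z + (x - z) \<in> ?Z + (*\<^sub>R) \<delta> ` unit_ball n"
      by (rule set_plus_intro[OF z(1)])
    then show ?thesis by simp
  qed
qed (auto simp: finite_grid_sphere intro: zone_Rn)

lemma ball_approximable: "ball_approximable n"
  unfolding ball_approximable_def
proof (intro allI impI)
  fix \<delta> :: real assume \<delta>: "\<delta> > 0"
  obtain N where N: "real N > real n / (\<alpha> * \<delta>)"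
    using reals_Archimedean2 by blast
  moreover have "real n / (\<alpha> * \<delta>) > 0"
    using n \<delta> mean_abs_pos by simp
  ultimately have N': "real N > 0"
    by linarith
  then have "real n / (\<alpha> * real N) \<le> \<delta>"
    using N \<delta> mean_abs_pos by (simp add: field_simps)
  then show "\<exists>(J :: (nat \<Rightarrow> real) set) \<eta>. ball_approx n \<delta> J \<eta>"
    using ball_approx_zone[OF _ \<delta>] N' by (simp only: of_nat_0_less_iff) blast
qed

end

section \<open>Regularity of the gain, and projections read in one dimension less\<close>

section \<open>Continuity of the gain\<close>

lemma seg_subset_scaleR_unit_ball:
  assumes "v \<in> Rn n" "norm_n n v \<le> d"
  shows "seg v \<subseteq> (*\<^sub>R) d ` unit_ball n"
proof (cases "d > 0")
  case True
  have "norm_n n (t *\<^sub>R v) \<le> d" if "\<bar>t\<bar> \<le> 1" for t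
    using that assms(2) mult_mono[of "\<bar>t\<bar>" 1 "norm_n n v" d] by (simp add: norm_n_scaleR)
  then show ?thesis
    using assms(1) unfolding scaleR_unit_ball[OF True]
    by (auto simp: seg_def abs_le_iff intro!: Rn_scaleR)
next
  case False
  then have "norm_n n v = 0" "d = 0"
    using assms(2) norm_n_nonneg[of n v] by linarith+
  then have "seg v = {0}"
    using norm_n_eq_0[OF assms(1)] by simp
  moreover have "(0 :: nat \<Rightarrow> real) = d *\<^sub>R 0"
    by (simp only: scaleR_zero_right)
  ultimately show ?thesis
    using imageI[OF zero_in_unit_ball[of n], of "(*\<^sub>R) d"] by (simp only: singletonD subsetI empty_subsetI insert_subset)
qed

text \<open>The segment [-v, v] lies in [-v', v'] + [-(v - v'), v - v'], and the second summand is
  absorbed by a dilation. Norms up to 2 are allowed because grid points leave the sphere.\<close>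

lemma seg_gain_diff_le:
  assumes A: "compact_convex n A" and x: "has_inball n A x r"
    and v: "v \<in> Rn n" "norm_n n v \<le> 2" and v': "v' \<in> Rn n" "norm_n n v' \<le> 2"
  shows "\<bar>seg_gain n A v - seg_gain n A v'\<bar>
    \<le> ((1 + norm_n n (v - v') / r) ^ n - 1) * vol n (A + (*\<^sub>R) 2 ` unit_ball n)"
proof -
  let ?C = "vol n (A + (*\<^sub>R) 2 ` unit_ball n)"
  have r: "r > 0" using x by (simp add: has_inball_def)
  have le: "seg_gain n A v - seg_gain n A v' \<le> ((1 + norm_n n (v - v') / r) ^ n - 1) * ?C"
    if v: "v \<in> Rn n" and v': "v' \<in> Rn n" "norm_n n v' \<le> 2" for v v'
  proof -
    let ?d = "norm_n n (v - v')"
    have d: "v - v' \<in> Rn n"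
      by (rule Rn_diff[OF v v'(1)])
    have A': "compact_convex n (A + seg v')"
      by (intro compact_convex_plus A compact_convex_seg v'(1))
    have sub: "seg v \<subseteq> seg v' + seg (v - v')"
    proof
      fix y assume "y \<in> seg v"
      then obtain t where t: "t \<in> {-1..1}" "y = t *\<^sub>R v"
        by (auto simp: seg_def)
      have "t *\<^sub>R v' + t *\<^sub>R (v - v') \<in> seg v' + seg (v - v')"
        using t(1) unfolding seg_def by (intro set_plus_intro imageI)
      then show "y \<in> seg v' + seg (v - v')"
        unfolding t(2) scaleR_add_right[symmetric] by simp
    qed
    have "A + seg v \<subseteq> (A + seg v') + seg (v - v')"
      unfolding add.assoc by (intro set_plus_mono2 order_refl sub)
    then have "vol n (A + seg v) \<le> vol n ((A + seg v') + seg (v - v'))"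
      using A v v'(1) d by (intro vol_mono compact_convex_plus compact_convex_seg)
    also have "\<dots> \<le> (1 + ?d / r) ^ n * vol n (A + seg v')"
    proof (rule vol_plus_le[OF A'])
      have "A \<subseteq> A + seg v'"
        using set_zero_plus2[OF zero_in_seg[of v'], of A] by (simp only: add.commute)
      then show "has_inball n (A + seg v') x r"
        by (rule has_inball_mono[OF x])
    qed (use d in \<open>simp_all add: compact_convex_seg seg_subset_scaleR_unit_ball\<close>)
    finally have "seg_gain n A v - seg_gain n A v' \<le> ((1 + ?d / r) ^ n - 1) * vol n (A + seg v')"
      by (simp add: seg_gain_def algebra_simps)
    also have "\<dots> \<le> ((1 + ?d / r) ^ n - 1) * ?C"
      using r A v' seg_subset_scaleR_unit_ball[OF v']
      by (intro mult_left_mono vol_mono compact_convex_plus compact_convex_scaleR compact_convex_unit_ball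
          compact_convex_seg set_plus_mono2) auto
    finally show ?thesis .
  qed
  from le[OF v(1) v'] le[OF v'(1) v] show ?thesis
    unfolding norm_n_minus_commute[of n v' v] by (simp add: abs_le_iff)
qed

text \<open>Supplies the measurability of the gain with respect to \<sigma>.\<close>

lemma continuous_on_seg_gain:
  assumes A: "compact_convex n A" and x: "has_inball n A x r"
  shows "continuous_on (unit_sphere n) (seg_gain n A)"
  unfolding continuous_on_def
proof
  fix \<xi> assume \<xi>: "\<xi> \<in> unit_sphere n"
  let ?C = "vol n (A + (*\<^sub>R) 2 ` unit_ball n)"
  let ?f = "\<lambda>v. ((1 + norm_n n (v - \<xi>) / r) ^ n - 1) * ?C"
  have r: "r > 0" using x by (simp add: has_inball_def)
  have "continuous_on UNIV (\<lambda>v. norm_n n (v + (-1) *\<^sub>R \<xi>))"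
    by (intro continuous_on_norm_n continuous_on_fun_add continuous_on_const continuous_on_id)
  then have "continuous_on UNIV (\<lambda>v. norm_n n (v - \<xi>))"
    by simp
  then have "continuous_on UNIV ?f"
    using r by (intro continuous_on_mult continuous_on_diff continuous_on_power continuous_on_add
        continuous_on_divide continuous_on_const) auto
  then have "(?f \<longlongrightarrow> ?f \<xi>) (at \<xi> within UNIV)"
    unfolding continuous_on_def by blast
  then have "(?f \<longlongrightarrow> 0) (at \<xi>)"
    by simp
  then have "(?f \<longlongrightarrow> 0) (at \<xi> within unit_sphere n)"
    by (rule tendsto_within_subset) simp
  then have "((\<lambda>v. seg_gain n A v - seg_gain n A \<xi>) \<longlongrightarrow> 0) (at \<xi> within unit_sphere n)"
  proof (rule Lim_null_comparison[rotated])
    show "\<forall>\<^sub>F v in at \<xi> within unit_sphere n. norm (seg_gain n A v - seg_gain n A \<xi>) \<le> ?f v"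
      using seg_gain_diff_le[OF A x] \<xi> by (auto simp: eventually_at_filter unit_sphere_def)
  qed
  then show "(seg_gain n A \<longlongrightarrow> seg_gain n A \<xi>) (at \<xi> within unit_sphere n)"
    by (simp add: LIM_zero_iff)
qed

section \<open>Projections\<close>

locale hyperplane_isometry =
  fixes m :: nat and \<xi> :: "nat \<Rightarrow> real" and T :: "(nat \<Rightarrow> real) \<Rightarrow> nat \<Rightarrow> real"
  assumes \<xi>: "\<xi> \<in> unit_sphere (Suc m)"
    and T: "linear_isometry_onto m (Suc m) (hyperplane (Suc m) \<xi>) T"
begin

text \<open>The adjoint of \<open>T\<close>, linear on all sequences. It gives the coordinates in
  \<open>Rn m\<close> of the projection to the hyperplane: on \<open>Rn (Suc m)\<close>,
  \<open>Q\<close> followed by \<open>T\<close> is that projection.\<close>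

definition Q :: "(nat \<Rightarrow> real) \<Rightarrow> nat \<Rightarrow> real" where
  "Q = frame (Suc m) m (\<lambda>i. T (axis_n i))"

lemma linear_Q: "linear Q"
  unfolding Q_def by (rule linear_frame)

lemma Q_Rn: "Q z \<in> Rn m"
  unfolding Q_def by (rule frame_Rn)

lemma compact_convex_Q: "compact_convex (Suc m) A \<Longrightarrow> compact_convex m (Q ` A)"
  unfolding Q_def by (rule compact_convex_frame)

lemma inner_T:
  assumes "y \<in> Rn m"
  shows "inner_n (Suc m) (T y) z = inner_n m y (Q z)"
proof -
  have "T y = T (\<Sum>i<m. y i *\<^sub>R axis_n i)"
    using Rn_eq_sum_axis_n[OF assms] by simp
  also have "\<dots> = (\<Sum>i<m. T (y i *\<^sub>R axis_n i))"
    by (rule isometry_sum[OF T]) (auto intro!: Rn_scaleR axis_n_Rn)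
  also have "\<dots> = (\<Sum>i<m. y i *\<^sub>R T (axis_n i))"
    by (intro sum.cong refl isometry_scaleR[OF T] axis_n_Rn) simp
  finally show ?thesis
    by (simp only: inner_n_sum_left inner_n_scaleR_left)
      (simp add: Q_def frame_def inner_n_def[of m] inner_n_commute[of "Suc m" z])
qed

lemma Q_T:
  assumes "y \<in> Rn m"
  shows "Q (T y) = y"
proof (rule ext)
  fix i
  show "Q (T y) i = y i"
    using isometry_inner[OF T assms axis_n_Rn[of i m]] assms
    by (cases "i < m") (simp_all add: Q_def frame_def inner_n_axis_n mem_Rn)
qed

text \<open>Cauchy-Schwarz for <T (Q z), z> = |Q z|^2.\<close>

lemma norm_Q: "norm_n m (Q z) \<le> norm_n (Suc m) z"
proof (cases "norm_n m (Q z) = 0")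
  case False
  then have "norm_n m (Q z) > 0"
    using norm_n_nonneg[of m "Q z"] by linarith
  moreover have "norm_n m (Q z) * norm_n m (Q z) \<le> norm_n m (Q z) * norm_n (Suc m) z"
    using inner_T[OF Q_Rn, of z z] norm_n_cauchy_schwarz[of "Suc m" "T (Q z)" z]
      isometry_norm[OF T Q_Rn, of z]
    by (simp add: inner_n_self power2_eq_square)
  ultimately show ?thesis by simp
qed simp

text \<open>\<open>Q\<close> does not increase norms, and each \<open>y\<close> in the smaller ball
  is the image of \<open>T y\<close>. Hence \<open>Q\<close> commutes with forming parallel
  bodies.\<close>

lemma Q_unit_ball: "Q ` unit_ball (Suc m) = unit_ball m"
proof (intro subset_antisym subsetI)
  fix y assume "y \<in> Q ` unit_ball (Suc m)"
  then show "y \<in> unit_ball m"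
    using norm_Q Q_Rn by (auto simp: unit_ball_def intro: order_trans)
next
  fix y assume y: "y \<in> unit_ball m"
  then have "T y \<in> unit_ball (Suc m)" "Q (T y) = y"
    using isometry_norm[OF T, of y] isometry_mem_Rn[OF T, of y] Q_T[of y] by (auto simp: unit_ball_def)
  then show "y \<in> Q ` unit_ball (Suc m)"
    by (metis imageI)
qed

lemma has_inball_Q:
  assumes "has_inball (Suc m) A x r"
  shows "has_inball m (Q ` A) (Q x) r"
proof -
  have "{Q x} + (*\<^sub>R) r ` unit_ball m = Q ` ({x} + (*\<^sub>R) r ` unit_ball (Suc m))"
    by (simp add: linear_image_set_plus[OF linear_Q] linear_image_scaleR[OF linear_Q] Q_unit_ball)
  then show ?thesis
    using assms Q_Rn by (simp add: has_inball_def image_mono)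
qed

lemma Q_parallel_body: "Q ` parallel_body (Suc m) A \<epsilon> = parallel_body m (Q ` A) \<epsilon>"
  by (simp add: parallel_body_eq linear_image_set_plus[OF linear_Q] linear_image_scaleR[OF linear_Q] Q_unit_ball)

text \<open>Zonotopes and balls project to zonotopes and balls, with the same \<delta>. This also
  reaches dimension 1, which the argument on the sphere for n \<ge> 2 does not cover.\<close>

lemma ball_approximable_pred:
  assumes "ball_approximable (Suc m)"
  shows "ball_approximable m"
  unfolding ball_approximable_def
proof (intro allI impI)
  fix \<delta> :: real assume "\<delta> > 0"
  then obtain J :: "(nat \<Rightarrow> real) set" and \<eta> where J: "ball_approx (Suc m) \<delta> J \<eta>"
    using assms unfolding ball_approximable_def by blast
  have "Q ` zonotope J \<eta> \<subseteq> Q ` (*\<^sub>R) (1 + \<delta>) ` unit_ball (Suc m)"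
    "Q ` unit_ball (Suc m) \<subseteq> Q ` (zonotope J \<eta> + (*\<^sub>R) \<delta> ` unit_ball (Suc m))"
    using J unfolding ball_approx_def by (auto intro!: image_mono)
  then have "ball_approx m \<delta> J (\<lambda>j. Q (\<eta> j))"
    unfolding linear_image_set_plus[OF linear_Q] linear_image_scaleR[OF linear_Q] Q_unit_ball
      linear_image_zonotope[OF linear_Q]
    using J Q_Rn by (simp add: ball_approx_def)
  then show "\<exists>(J :: (nat \<Rightarrow> real) set) \<eta>. ball_approx m \<delta> J \<eta>"
    by blast
qed

lemma vol_Q: "compact_convex (Suc m) A \<Longrightarrow> vol m (Q ` A) = seg_gain (Suc m) A \<xi> / 2"
  using vol_plus_seg[OF \<xi> T, of A 1] by (simp add: seg_gain_def Q_def)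

lemma vimage_hyperplane_proj:
  assumes "A \<subseteq> Rn (Suc m)"
  shows "{y \<in> Rn m. T y \<in> hyperplane_proj (Suc m) \<xi> ` A} = Q ` A"
proof -
  have proj: "hyperplane_proj (Suc m) \<xi> z = T (Q z)" if z: "z \<in> Rn (Suc m)" for z
  proof -
    obtain y where y: "y \<in> Rn m" "T y = hyperplane_proj (Suc m) \<xi> z"
      using isometry_surj[OF T hyperplane_proj_in_hyperplane[OF \<xi> z]] by blast
    \<comment> \<open>\<open>Q\<close> annihilates \<xi>, so it takes the same value at a point and
      at its projection.\<close>
    have "inner_n (Suc m) \<xi> (T (axis_n i)) = 0" if "i < m" for i
      using isometry_mem[OF T axis_n_Rn[OF that]] by (simp add: hyperplane_def inner_n_commute)
    then have "Q \<xi> = 0"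
      by (auto simp: Q_def frame_def fun_eq_iff)
    have "hyperplane_proj (Suc m) \<xi> z = z - inner_n (Suc m) z \<xi> *\<^sub>R \<xi>"
      by (simp add: hyperplane_proj_def fun_eq_iff)
    then have "Q (hyperplane_proj (Suc m) \<xi> z) = Q z"
      by (simp only: linear_diff[OF linear_Q] linear_scale[OF linear_Q] \<open>Q \<xi> = 0\<close> scaleR_zero_right diff_zero)
    then have "y = Q z"
      using Q_T[OF y(1)] y(2) by simp
    then show ?thesis using y(2) by simp
  qed
  show ?thesis
  proof (intro subset_antisym subsetI)
    fix y assume "y \<in> {y \<in> Rn m. T y \<in> hyperplane_proj (Suc m) \<xi> ` A}"
    then obtain z where z: "y \<in> Rn m" "z \<in> A" "T y = hyperplane_proj (Suc m) \<xi> z"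
      by blast
    then have "T y = T (Q z)"
      using proj[of z] assms by auto
    then have "Q (T y) = Q (T (Q z))"
      by (rule arg_cong)
    then have "y = Q z"
      by (simp only: Q_T[OF z(1)] Q_T[OF Q_Rn])
    then show "y \<in> Q ` A"
      using z(2) by (rule image_eqI)
  next
    fix y assume "y \<in> Q ` A"
    then obtain z where z: "z \<in> A" "y = Q z" by blast
    then have "T y = hyperplane_proj (Suc m) \<xi> z"
      using proj[of z] assms by auto
    then show "y \<in> {y \<in> Rn m. T y \<in> hyperplane_proj (Suc m) \<xi> ` A}"
      using z Q_Rn by simp
  qed
qed

end

text \<open>Resolves the \<open>SOME\<close>. The isometry depends on \<xi> in an uncontrolled way,
  so measurability will rest on expressions free of it.\<close>

lemma surface_area_in_hyperplane:
  assumes "\<xi> \<in> unit_sphere (Suc m)" "A \<subseteq> Rn (Suc m)"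
  obtains T where "hyperplane_isometry m \<xi> T"
    and "surface_area_in m (Suc m) (hyperplane (Suc m) \<xi>) (hyperplane_proj (Suc m) \<xi> ` A)
      = surface_area m (hyperplane_isometry.Q m T ` A)"
proof -
  define T where "T = (SOME T. linear_isometry_onto m (Suc m) (hyperplane (Suc m) \<xi>) T)"
  have "linear_isometry_onto m (Suc m) (hyperplane (Suc m) \<xi>) T"
    unfolding T_def
    by (rule someI_ex[of "linear_isometry_onto m (Suc m) (hyperplane (Suc m) \<xi>)"])
      (rule exists_isometry_onto_hyperplane[OF assms(1)])
  then interpret hyperplane_isometry m \<xi> T
    using assms(1) by unfold_locales
  have "surface_area_in m (Suc m) (hyperplane (Suc m) \<xi>) (hyperplane_proj (Suc m) \<xi> ` A) = surface_area m (Q ` A)"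
    unfolding surface_area_in_def T_def[symmetric] Let_def vimage_hyperplane_proj[OF assms(2)] ..
  then show thesis
    using that hyperplane_isometry_axioms by blast
qed

text \<open>An open set of the product topology contains a basic box around each of its points.
  Within \<open>Rn n\<close> only the first n sides constrain, and their minimum yields the radius
  of a ball.\<close>

lemma convex_bodyD:
  assumes "convex_body n K"
  shows "compact_convex n K" and "\<exists>x r. has_inball n K x r"
proof -
  have E: "Euclidean_space n = subtopology euclidean (Rn n)"
    by (simp add: Euclidean_space_def euclidean_product_topology topspace_subtopology)
  have K: "compactin (Euclidean_space n) K" "convex_n K" "Euclidean_space n interior_of K \<noteq> {}"
    using assms by (auto simp: convex_body_def)
  have "compactin (subtopology euclidean (Rn n)) K"
    using K(1) E by metis
  then have "compact K" "K \<subseteq> Rn n"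
    by (auto simp: compactin_subtopology)
  then show "compact_convex n K"
    using K(2) by (simp add: compact_convex_def convex_n_iff_convex)
  obtain x where x: "x \<in> Euclidean_space n interior_of K"
    using K(3) by blast
  have "openin (subtopology euclidean (Rn n)) (Euclidean_space n interior_of K)"
    using openin_interior_of[of "Euclidean_space n" K] E by metis
  then obtain W where W: "open W" "Euclidean_space n interior_of K = W \<inter> Rn n"
    unfolding openin_subtopology by auto
  have "openin (product_topology (\<lambda>i::nat. euclidean :: real topology) UNIV) W"
    using W(1) by (simp add: euclidean_product_topology)
  moreover have "x \<in> W"
    using x W(2) by blast
  ultimately have "\<exists>X. x \<in> (\<Pi>\<^sub>E i\<in>UNIV. X i) \<and> (\<forall>i. openin euclidean (X i)) \<and>
      finite {i. X i \<noteq> topspace (euclidean :: real topology)} \<and> (\<Pi>\<^sub>E i\<in>UNIV. X i) \<subseteq> W"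
    by (rule product_topology_open_contains_basis)
  then obtain X where "x \<in> (\<Pi>\<^sub>E i\<in>UNIV. X i) \<and> (\<forall>i. openin euclidean (X i)) \<and>
      finite {i. X i \<noteq> topspace (euclidean :: real topology)} \<and> (\<Pi>\<^sub>E i\<in>UNIV. X i) \<subseteq> W"
    by (elim exE)
  then have X: "x \<in> (\<Pi>\<^sub>E i\<in>UNIV. X i)" "\<And>i. open (X i)" "(\<Pi>\<^sub>E i\<in>UNIV. X i) \<subseteq> W"
    by (simp_all only: open_openin)
  have "\<exists>e>0. \<forall>t. dist t (x i) < e \<longrightarrow> t \<in> X i" for i
    using X(1) X(2)[of i] unfolding open_dist by auto
  then obtain e where e: "\<And>i. e i > 0" "\<And>i t. dist t (x i) < e i \<Longrightarrow> t \<in> X i"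
    by metis
  \<comment> \<open>The 1 keeps the set nonempty for n = 0, and halving makes \<open>r\<close>
    strictly smaller than each of the first n sides.\<close>
  define r where "r = Min (insert 1 (e ` {..<n})) / 2"
  have "Min (insert 1 (e ` {..<n})) > 0"
    using e(1) by (subst Min_gr_iff) auto
  moreover have "Min (insert 1 (e ` {..<n})) \<le> e i" if "i < n" for i
    using that by (intro Min_le) auto
  moreover have "M / 2 < e i" if "M > 0" "M \<le> e i" for M :: real and i
    using that by linarith
  ultimately have r: "r > 0" "i < n \<Longrightarrow> r < e i" for i
    unfolding r_def by (simp, blast)
  have xR: "x \<in> Rn n"
    using x W(2) by blast
  have "{x} + (*\<^sub>R) r ` unit_ball n \<subseteq> K"
  proof
    fix y assume "y \<in> {x} + (*\<^sub>R) r ` unit_ball n"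
    then obtain b where b: "b \<in> unit_ball n" "y = x + r *\<^sub>R b"
      by (auto elim!: set_plus_elim)
    have yR: "y \<in> Rn n"
      using b xR by (auto simp: unit_ball_def intro!: Rn_add Rn_scaleR)
    have "y i \<in> X i" for i
    proof (cases "i < n")
      case True
      have "\<bar>b i\<bar> \<le> 1"
        using b(1) abs_le_norm_n[OF True, of b] by (simp add: unit_ball_def)
      then have "dist (y i) (x i) \<le> r * 1"
        using r(1) by (simp add: b(2) dist_real_def abs_mult)
      then show ?thesis
        using r(2)[OF True] by (intro e(2)) simp
    next
      case False
      then have "y i = x i"
        using xR yR by (simp add: mem_Rn)
      then show ?thesis using e by simp
    qed
    then have "y \<in> W \<inter> Rn n"
      using X(3) yR by auto
    then show "y \<in> K"
      using W(2) interior_of_subset[of "Euclidean_space n" K] by blast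
  qed
  then show "\<exists>x r. has_inball n K x r"
    using r(1) xR unfolding has_inball_def by blast
qed

section \<open>Integration over the sphere\<close>

section \<open>The surface area of projections\<close>

context sphere_measure
begin

lemma measurable_seg_gain:
  assumes "compact_convex n A" "has_inball n A x r"
  shows "seg_gain n A \<in> borel_measurable \<sigma>"
  unfolding measurable_cong_sets[OF sets_\<sigma> refl]
  by (rule borel_measurable_continuous_on_restrict[OF continuous_on_seg_gain[OF assms]])

lemma seg_gain_sphere_le:
  assumes A: "compact_convex n A" and \<xi>: "\<xi> \<in> unit_sphere n"
  shows "seg_gain n A \<xi> \<le> vol n (A + unit_ball n)"
proof -
  have "seg \<xi> \<subseteq> unit_ball n"
    using seg_subset_scaleR_unit_ball[of \<xi> n 1] \<xi> by (simp add: unit_sphere_def)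
  then have "vol n (A + seg \<xi>) \<le> vol n (A + unit_ball n)"
    using A \<xi> by (intro vol_mono compact_convex_plus compact_convex_seg compact_convex_unit_ball set_plus_mono2)
      (auto simp: unit_sphere_def)
  moreover have "0 \<le> vol n A" by simp
  ultimately show ?thesis
    unfolding seg_gain_def by linarith
qed

lemma integrable_seg_gain:
  assumes "compact_convex n A" "has_inball n A x r"
  shows "integrable \<sigma> (seg_gain n A)"
proof (rule integrable_\<sigma>[OF measurable_seg_gain[OF assms]])
  fix \<xi> assume \<xi>: "\<xi> \<in> unit_sphere n"
  show "\<bar>seg_gain n A \<xi>\<bar> \<le> vol n (A + unit_ball n)"
    using seg_gain_nonneg[OF assms(1) unit_sphereD(1)[OF \<xi>]] seg_gain_sphere_le[OF assms(1) \<xi>] by simp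
qed

text \<open>One half of Cauchy's surface area formula, since the gain is twice the volume of the projection.\<close>

theorem surface_area_le_integral:
  assumes A: "compact_convex n A" and x: "has_inball n A x r"
  shows "\<alpha> * surface_area n A \<le> (LINT \<xi>|\<sigma>. seg_gain n A \<xi>)"
proof -
  define C where "C = vol n (A + (*\<^sub>R) 2 ` unit_ball n)"
  define I where "I = (LINT \<xi>|\<sigma>. seg_gain n A \<xi>)"
  \<comment> \<open>The zonotope bound with \<delta> = n / (\<alpha> N), after grid points have been
    replaced by points of the sphere. The errors vanish as \<open>N\<close> grows, and I / \<alpha>
    remains.\<close>
  define X where "X N = real n * ((real n / \<alpha> / real N) / r) * vol n A
      + (I + ((1 + real n / real N / r) ^ n - 1) * C) / \<alpha>" for N
  have r: "r > 0" using x by (simp add: has_inball_def)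
  have le: "surface_area n A \<le> X N" if N: "N > 0" "n \<le> N" "real n / \<alpha> \<le> real N" for N
  proof -
    define \<delta> where "\<delta> = real n / \<alpha> / real N"
    have \<delta>: "0 < \<delta>" "\<delta> \<le> 1" "real n / (\<alpha> * real N) \<le> \<delta>"
      using N n mean_abs_pos by (auto simp: \<delta>_def pos_divide_le_eq mult.commute)
    have grid: "grid N \<xi> \<in> Rn n" "norm_n n (grid N \<xi>) \<le> 2" if "\<xi> \<in> unit_sphere n" for \<xi>
    proof -
      show "grid N \<xi> \<in> Rn n"
        by (rule grid_Rn[OF unit_sphereD(1)[OF that]])
      have "norm_n n (\<xi> + (grid N \<xi> - \<xi>)) \<le> norm_n n \<xi> + norm_n n (grid N \<xi> - \<xi>)"
        by (rule norm_n_triangle)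
      also have "\<dots> \<le> 1 + real n / real N"
        using norm_grid_diff[OF N(1), of n \<xi>] unit_sphereD(2)[OF that] by simp
      also have "\<dots> \<le> 2"
        using N by simp
      finally show "norm_n n (grid N \<xi>) \<le> 2"
        by simp
    qed
    have "surface_area n A \<le> real n * (\<delta> / r) * vol n A
        + (\<Sum>\<zeta>\<in>grid N ` unit_sphere n. seg_gain n A (zone N \<zeta>))"
      by (rule surface_area_le[OF A x ball_approximable ball_approx_zone[OF N(1) \<delta>(1,3)] \<delta>(1,2)])
    \<comment> \<open>By homogeneity the gain of a zone is the mass of its cell times the gain at
      the grid point, over \<alpha>; so the sum is an integral over the sphere.\<close>
    also have "(\<Sum>\<zeta>\<in>grid N ` unit_sphere n. seg_gain n A (zone N \<zeta>))
        = (\<Sum>\<zeta>\<in>grid N ` unit_sphere n. measure \<sigma> (cell N \<zeta>) * (seg_gain n A \<zeta> / \<alpha>))"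
    proof (rule sum.cong[OF refl])
      fix \<zeta> assume "\<zeta> \<in> grid N ` unit_sphere n"
      then have "\<zeta> \<in> Rn n" using grid(1) by auto
      then show "seg_gain n A (zone N \<zeta>) = measure \<sigma> (cell N \<zeta>) * (seg_gain n A \<zeta> / \<alpha>)"
        using mean_abs_pos unfolding zone_def by (subst seg_gain_scaleR[OF A]) auto
    qed
    also have "\<dots> = (LINT \<xi>|\<sigma>. seg_gain n A (grid N \<xi>) / \<alpha>)"
      by (rule sum_measure_cells)
    also have "\<dots> \<le> (LINT \<xi>|\<sigma>. (seg_gain n A \<xi> + ((1 + real n / real N / r) ^ n - 1) * C) / \<alpha>)"
    proof (rule integral_\<sigma>_mono)
      show "integrable \<sigma> (\<lambda>\<xi>. seg_gain n A (grid N \<xi>) / \<alpha>)"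
        by (rule integrable_grid)
      show "integrable \<sigma> (\<lambda>\<xi>. (seg_gain n A \<xi> + ((1 + real n / real N / r) ^ n - 1) * C) / \<alpha>)"
        by (intro Bochner_Integration.integrable_divide Bochner_Integration.integrable_add
            integrable_seg_gain[OF A x] finite_measure.integrable_const[OF finite_measure_\<sigma>])
      fix \<xi> assume \<xi>: "\<xi> \<in> unit_sphere n"
      have "seg_gain n A (grid N \<xi>) - seg_gain n A \<xi> \<le> ((1 + norm_n n (grid N \<xi> - \<xi>) / r) ^ n - 1) * C"
        using seg_gain_diff_le[OF A x grid[OF \<xi>], of \<xi>] unit_sphereD[OF \<xi>] by (simp add: C_def)
      also have "\<dots> \<le> ((1 + real n / real N / r) ^ n - 1) * C"
        using r norm_grid_diff[OF N(1), of n \<xi>]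
        by (intro mult_right_mono diff_right_mono power_mono add_left_mono divide_right_mono) (auto simp: C_def)
      finally show "seg_gain n A (grid N \<xi>) / \<alpha> \<le> (seg_gain n A \<xi> + ((1 + real n / real N / r) ^ n - 1) * C) / \<alpha>"
        using mean_abs_pos by (intro divide_right_mono) auto
    qed
    also have "\<dots> = (I + ((1 + real n / real N / r) ^ n - 1) * C) / \<alpha>"
      unfolding integral_divide_zero
        Bochner_Integration.integral_add[OF integrable_seg_gain[OF A x] finite_measure.integrable_const[OF finite_measure_\<sigma>]]
      by (simp add: I_def measure_\<sigma>)
    finally show ?thesis
      by (simp add: X_def \<delta>_def)
  qed
  have "X \<longlonglongrightarrow> real n * (0 / r) * vol n A + (I + ((1 + 0 / r) ^ n - 1) * C) / \<alpha>"
    unfolding X_def using r mean_abs_pos by (intro tendsto_intros lim_const_over_n) auto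
  then have "X \<longlonglongrightarrow> I / \<alpha>"
    by simp
  moreover have "\<exists>N0. \<forall>N\<ge>N0. surface_area n A \<le> X N"
  proof -
    obtain k where "real n / \<alpha> \<le> real k"
      using real_arch_simple by blast
    then show ?thesis
      by (intro exI[of _ "Suc (max n k)"] allI impI le) auto
  qed
  ultimately have "surface_area n A \<le> I / \<alpha>"
    by (rule LIMSEQ_le_const)
  then show ?thesis
    using mean_abs_pos by (simp add: I_def pos_le_divide_eq mult.commute)
qed

text \<open>The integrand is measurable as a pointwise limit of quotients of gains, which are
  continuous in \<xi>, and integrable because the quotient at \<epsilon> = 1 bounds it from above.
  Only then does a pointwise lower bound carry over to the integral.\<close>

theorem integral_surface_area_projection_ge:
  assumes K: "compact_convex n K" and x: "has_inball n K x r"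
  shows "surface_area n K powr ((real n - 2) / (real n - 1)) / 8
    \<le> (LINT \<xi>|\<sigma>. surface_area_in (n - 1) n (hyperplane n \<xi>) (hyperplane_proj n \<xi> ` K))"
proof -
  obtain m where m: "n = Suc m" "m \<ge> 1"
    using n by (cases n) auto
  define s where "s \<xi> = surface_area_in (n - 1) n (hyperplane n \<xi>) (hyperplane_proj n \<xi> ` K)" for \<xi>
  define S where "S = surface_area n K"
  let ?P = "parallel_body n K"
  have P: "compact_convex n (?P \<epsilon>)" for \<epsilon>
    by (rule compact_convex_parallel_body[OF K])
  have P_in: "has_inball n (?P \<epsilon>) x r" if "\<epsilon> > 0" for \<epsilon>
  proof (rule has_inball_mono[OF x])
    have "0 \<in> (*\<^sub>R) \<epsilon> ` unit_ball n"
      using that by (simp add: scaleR_unit_ball Rn_0)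
    from set_zero_plus2[OF this, of K] show "K \<subseteq> ?P \<epsilon>"
      unfolding parallel_body_eq by (simp only: add.commute)
  qed
  \<comment> \<open>The difference quotient of the projected body in dimension m: the volume of a
    projection is half the gain, hence the 2.\<close>
  define q where "q \<epsilon> \<xi> = (seg_gain n (?P \<epsilon>) \<xi> - seg_gain n K \<xi>) / (2 * \<epsilon>)" for \<epsilon> \<xi>
  have proj: "((\<lambda>\<epsilon>. q \<epsilon> \<xi>) \<longlongrightarrow> s \<xi>) (at_right 0) \<and> (\<forall>\<epsilon>>0. s \<xi> \<le> q \<epsilon> \<xi>) \<and> 0 < seg_gain n K \<xi> \<and>
      2 * sqrt (real m) * (seg_gain n K \<xi> / 2) powr ((real m - 1) / real m) \<le> s \<xi>"
    if \<xi>: "\<xi> \<in> unit_sphere n" for \<xi>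
  proof -
    obtain T where "hyperplane_isometry m \<xi> T" and s: "s \<xi> = surface_area m (hyperplane_isometry.Q m T ` K)"
      using surface_area_in_hyperplane[of \<xi> m K] \<xi> compact_convexD(3)[OF K] by (auto simp: m(1) s_def)
    then interpret hyperplane_isometry m \<xi> T
      by simp
    have QK: "compact_convex m (Q ` K)"
      using compact_convex_Q K m(1) by simp
    have Q_in: "has_inball m (Q ` K) (Q x) r"
      using has_inball_Q x m(1) by simp
    have app: "ball_approximable m"
      using ball_approximable_pred ball_approximable m(1) by simp
    have vol_Q': "vol m (Q ` A) = seg_gain n A \<xi> / 2" if "compact_convex n A" for A
      using vol_Q that m(1) by simp
    have "area_quotient m (Q ` K) \<epsilon> = q \<epsilon> \<xi>" for \<epsilon>
    proof -
      have "parallel_body m (Q ` K) \<epsilon> = Q ` ?P \<epsilon>"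
        using Q_parallel_body[of K \<epsilon>] m(1) by simp
      then show ?thesis
        by (simp add: area_quotient_def vol_Q'[OF P] vol_Q'[OF K] q_def diff_divide_distrib)
    qed
    then have "area_quotient m (Q ` K) = (\<lambda>\<epsilon>. q \<epsilon> \<xi>)"
      by blast
    moreover have "0 < seg_gain n K \<xi>"
    proof -
      have r: "r > 0" using x by (simp add: has_inball_def)
      have ball: "compact_convex m ({Q x} + (*\<^sub>R) r ` unit_ball m)"
        by (intro compact_convex_plus compact_convex_singleton compact_convex_scaleR compact_convex_unit_ball Q_Rn)
      have "0 < vol m (unit_ball m)"
        using emeasure_unit_ball_pos[of m] by (simp add: emeasure_eq_vol[OF compact_convex_unit_ball])
      then have "0 < vol m ({Q x} + (*\<^sub>R) r ` unit_ball m)"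
        using r by (subst vol_translate) (auto intro: compact_convex_scaleR compact_convex_unit_ball Q_Rn
            simp: vol_scaleR compact_convex_unit_ball)
      also have "\<dots> \<le> vol m (Q ` K)"
        using Q_in by (intro vol_mono ball QK) (simp add: has_inball_def)
      finally show ?thesis
        by (simp add: vol_Q'[OF K])
    qed
    ultimately show ?thesis
      using surface_area_exists[OF QK Q_in app] isoperimetric[OF m(2) QK Q_in app]
      by (simp add: s vol_Q'[OF K])
  qed
  have q_meas: "q \<epsilon> \<in> borel_measurable \<sigma>" if "\<epsilon> > 0" for \<epsilon>
    unfolding q_def
    by (intro borel_measurable_divide borel_measurable_diff borel_measurable_const
        measurable_seg_gain[OF K x] measurable_seg_gain[OF P P_in[OF that]])
  have "s \<in> borel_measurable \<sigma>"
  proof (rule borel_measurable_LIMSEQ_real)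
    show "q (1 / real (Suc k)) \<in> borel_measurable \<sigma>" for k
      by (rule q_meas) simp
    fix \<xi> assume "\<xi> \<in> space \<sigma>"
    then have "((\<lambda>\<epsilon>. q \<epsilon> \<xi>) \<longlongrightarrow> s \<xi>) (at_right 0)"
      using proj by (simp add: space_\<sigma>)
    moreover have "filterlim (\<lambda>k. 1 / real (Suc k)) (at_right 0) sequentially"
      unfolding filterlim_at using LIMSEQ_Suc[OF lim_const_over_n[of "1::real"]]
      by (auto intro!: always_eventually)
    ultimately show "(\<lambda>k. q (1 / real (Suc k)) \<xi>) \<longlonglongrightarrow> s \<xi>"
      by (rule filterlim_compose)
  qed
  then have s_int: "integrable \<sigma> s"
  proof (rule integrable_\<sigma>)
    fix \<xi> assume \<xi>: "\<xi> \<in> unit_sphere n"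
    have "0 \<le> 2 * sqrt (real m) * (seg_gain n K \<xi> / 2) powr ((real m - 1) / real m)"
      by simp
    also have "\<dots> \<le> s \<xi>"
      using proj[OF \<xi>] by blast
    finally have "0 \<le> s \<xi>" .
    moreover have "s \<xi> \<le> q 1 \<xi>"
      using proj[OF \<xi>] by simp
    moreover have "q 1 \<xi> \<le> vol n (?P 1 + unit_ball n)"
    proof -
      have "0 < seg_gain n K \<xi>"
        using proj[OF \<xi>] by blast
      then have "q 1 \<xi> \<le> seg_gain n (?P 1) \<xi> / 2"
        by (simp add: q_def)
      then show ?thesis
        using seg_gain_sphere_le[OF P[of 1] \<xi>] measure_nonneg[of "lborel_n n" "?P 1 + unit_ball n"] by linarith
    qed
    ultimately show "\<bar>s \<xi>\<bar> \<le> vol n (?P 1 + unit_ball n)"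
      by linarith
  qed
  \<comment> \<open>The single segment [-\<xi>, \<xi>] is used as a zonotope inside the
    ball.\<close>
  have gain_le: "seg_gain n K \<xi> \<le> S" if \<xi>: "\<xi> \<in> unit_sphere n" for \<xi>
  proof -
    have "seg \<xi> \<subseteq> unit_ball n"
      using seg_subset_scaleR_unit_ball[of \<xi> n 1] \<xi> by (simp add: unit_sphere_def)
    then show ?thesis
      using surface_area_ge[OF K x ball_approximable, of "{()}" "\<lambda>_. \<xi>"] unit_sphereD(1)[OF \<xi>] by (simp add: S_def)
  qed
  have "axis_n 0 \<in> unit_sphere n"
    using m by (simp add: unit_sphere_def)
  then have S: "S > 0"
    using gain_le proj by (meson less_le_trans)
  \<comment> \<open>With w the gain, linearizing the power of w / 2 turns the isoperimetric bound
    into sqrt m times w times \<open>S powr (- 1 / real m)\<close>.\<close>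
  define k where "k = sqrt (real m) * S powr (- 1 / real m)"
  have "k * seg_gain n K \<xi> \<le> s \<xi>" if \<xi>: "\<xi> \<in> unit_sphere n" for \<xi>
  proof -
    have "seg_gain n K \<xi> / 2 * S powr (- 1 / real m) \<le> (seg_gain n K \<xi> / 2) powr ((real m - 1) / real m)"
      using proj[OF \<xi>] gain_le[OF \<xi>] m(2) by (intro mult_powr_minus_le) auto
    then have "2 * sqrt (real m) * (seg_gain n K \<xi> / 2 * S powr (- 1 / real m))
        \<le> 2 * sqrt (real m) * (seg_gain n K \<xi> / 2) powr ((real m - 1) / real m)"
      by (intro mult_left_mono) auto
    also have "\<dots> \<le> s \<xi>"
      using proj[OF \<xi>] by blast
    finally show ?thesis
      by (simp add: k_def mult_ac)
  qed
  then have "(LINT \<xi>|\<sigma>. k * seg_gain n K \<xi>) \<le> (LINT \<xi>|\<sigma>. s \<xi>)"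
    using integrable_seg_gain[OF K x] s_int by (intro integral_\<sigma>_mono integrable_mult_right) auto
  then have "k * (LINT \<xi>|\<sigma>. seg_gain n K \<xi>) \<le> (LINT \<xi>|\<sigma>. s \<xi>)"
    by simp
  moreover have "k * (\<alpha> * S) \<le> k * (LINT \<xi>|\<sigma>. seg_gain n K \<xi>)"
    using surface_area_le_integral[OF K x] by (intro mult_left_mono) (auto simp: k_def S_def)
  moreover have "S powr ((real n - 2) / (real n - 1)) / 8 \<le> k * (\<alpha> * S)"
  proof -
    \<comment> \<open>Here n = m + 1 \<le> 2 m, and 8 / 5 bounds sqrt 2. Together with \<alpha>
      \<ge> 1 / (5 sqrt n) this produces the constant 1 / 8.\<close>
    have "sqrt (real n) \<le> sqrt (2 * real m)"
      using m by simp
    also have "\<dots> \<le> sqrt ((8 / 5)\<^sup>2 * real m)"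
      by (intro real_sqrt_le_mono mult_right_mono) (auto simp: power2_eq_square)
    also have "\<dots> = 8 / 5 * sqrt (real m)"
      unfolding real_sqrt_mult real_sqrt_abs by simp
    finally have "1 / 8 \<le> sqrt (real m) * (1 / (5 * sqrt (real n)))"
      using m by (simp add: field_simps)
    also have "\<dots> \<le> sqrt (real m) * \<alpha>"
      using mean_abs_ge by (intro mult_left_mono) auto
    finally have "1 / 8 * S powr ((real m - 1) / real m) \<le> sqrt (real m) * \<alpha> * S powr ((real m - 1) / real m)"
      by (intro mult_right_mono) auto
    moreover have "S powr ((real m - 1) / real m) = S powr (- 1 / real m) * S"
    proof -
      have "(real m - 1) / real m = - 1 / real m + 1"
        using m by (simp add: field_simps)
      then show ?thesis
        using S by (simp only: powr_add) simp
    qed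
    moreover have "(real n - 2) / (real n - 1) = (real m - 1) / real m"
      using m by simp
    ultimately show ?thesis
      by (simp add: k_def mult_ac)
  qed
  ultimately show ?thesis
    unfolding s_def S_def by linarith
qed

end

theorem theorem1p5:
  shows "\<exists>c\<^sub>3 :: real. c\<^sub>3 > 0 \<and>
    (\<forall>(n :: nat) (K :: (nat \<Rightarrow> real) set) (\<sigma> :: (nat \<Rightarrow> real) measure).
       n \<ge> 2 \<longrightarrow> convex_body n K \<longrightarrow> rotation_invariant_prob n \<sigma> \<longrightarrow>
       (LINT \<xi>|\<sigma>. surface_area_in (n - 1) n (hyperplane n \<xi>) (hyperplane_proj n \<xi> ` K))
         \<ge> c\<^sub>3 * surface_area n K powr ((real n - 2) / (real n - 1)))"
proof (intro exI[of _ "1 / 8"] conjI allI impI)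
  fix n :: nat and K :: "(nat \<Rightarrow> real) set" and \<sigma> :: "(nat \<Rightarrow> real) measure"
  assume "n \<ge> 2" "convex_body n K" "rotation_invariant_prob n \<sigma>"
  then interpret sphere_measure n \<sigma>
    by unfold_locales
  obtain x r where "has_inball n K x r"
    using convex_bodyD(2)[OF \<open>convex_body n K\<close>] by blast
  from integral_surface_area_projection_ge[OF convex_bodyD(1)[OF \<open>convex_body n K\<close>] this]
  show "(LINT \<xi>|\<sigma>. surface_area_in (n - 1) n (hyperplane n \<xi>) (hyperplane_proj n \<xi> ` K))
      \<ge> 1 / 8 * surface_area n K powr ((real n - 2) / (real n - 1))"
    by simp
qed simp

end
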